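(* Let $\Omega$ be a bounded regular domain of an oriented Riemannian manifold $(M,g)$. Let $(g_\varepsilon)$ be a differentiable variation of the metric $g$ (with $g_0=g$). Let $\phi_\varepsilon\in\mathcal C^\infty(\Omega)$ be a differentiable family of functions and $\Lambda_\varepsilon$ a differentiable family of real numbers such that, for all $\varepsilon$, $\|\phi_\varepsilon\|_{L^2(\Omega,g_\varepsilon)}=1$ and $$\Delta_{g_\varepsilon}\phi_\varepsilon=\Lambda_\varepsilon\phi_\varepsilon\ \text{ in }\Omega,\qquad \phi_\varepsilon=0\ \text{ on }\partial\Omega .$$ Then $$\frac{d}{d\varepsilon}\Lambda_\varepsilon\Big|_{\varepsilon=0}=\int_\Omega\phi_0\,\Delta'\phi_0\,v_g=-\int_\Omega\Big\langle d\phi_0\otimes d\phi_0+\tfrac14\,\Delta(\phi_0^2)\,g\,,\,h\Big\rangle v_g ,$$ where $h:=\frac{d}{d\varepsilon}g_\varepsilon\big|_{\varepsilon=0}$, $\Delta':=\frac{d}{d\varepsilon}\Delta_{g_\varepsilon}\big|_{\varepsilon=0}$ and $\langle\cdot,\cdot\rangle$ is the inner product induced by $g$ on the space of covariant tensors.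
   Context: A bounded regular domain is a connected open set with compact closure and nonempty smooth boundary; functions in $\mathcal C^\infty(\Omega)$ are smooth up to the boundary. $\Delta_{g}$ denotes the nonnegative Laplacian of the metric $g$ ($\Delta_g=-\mathrm{div}_g\nabla$), $\Delta=\Delta_g$, and $v_g$ is the Riemannian volume element of $g$. *)

theory Defs
  imports "HOL-Analysis.Analysis"
begin

section \<open>Smooth maps on open subsets of Euclidean space\<close>

definition partial_deriv :: "'n \<Rightarrow> (real^'n \<Rightarrow> 'b::real_normed_vector) \<Rightarrow> real^'n \<Rightarrow> 'b"
  where "partial_deriv i f x = frechet_derivative f (at x) (axis i 1)"

text \<open>The multi-index of an iterated partial derivative is given as a list of directions.\<close>

primrec partial_derivs :: "'n list \<Rightarrow> (real^'n \<Rightarrow> 'b::real_normed_vector) \<Rightarrow> real^'n \<Rightarrow> 'b"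
  where
    "partial_derivs [] f = f"
  | "partial_derivs (i # is) f = partial_deriv i (partial_derivs is f)"

definition smooth_on :: "(real^'n) set \<Rightarrow> (real^'n \<Rightarrow> 'b::real_normed_vector) \<Rightarrow> bool"
  where "smooth_on S f \<longleftrightarrow> open S \<and> (\<forall>is. partial_derivs is f differentiable_on S)"

definition jacobian :: "(real^'n \<Rightarrow> real^'n) \<Rightarrow> real^'n \<Rightarrow> real^'n^'n"
  where "jacobian f x = matrix (frechet_derivative f (at x))"

text \<open>
  \<open>Cinf_has_deriv V S F F' e\<close>: the curve \<open>F\<close> of functions has derivative \<open>F'\<close> at \<open>e\<close> for the
  seminorms \<open>f \<mapsto> sup |D^\<alpha> f|\<close> over \<open>K \<inter> S\<close>, with \<open>K \<subseteq> V\<close> compact. For \<open>S = V\<close> open this is the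
  usual topology of smooth functions on \<open>V\<close>; for \<open>S \<subseteq> V\<close> with smooth boundary in \<open>V\<close> it is the
  topology of functions on \<open>S\<close> that are smooth up to the boundary, as \<open>K\<close> may meet the boundary.
\<close>

definition Cinf_has_deriv :: "(real^'n) set \<Rightarrow> (real^'n) set \<Rightarrow>
    (real \<Rightarrow> real^'n \<Rightarrow> 'b::real_normed_vector) \<Rightarrow> (real^'n \<Rightarrow> 'b) \<Rightarrow> real \<Rightarrow> bool"
  where "Cinf_has_deriv V S F F' e \<longleftrightarrow>
    (\<forall>K is. compact K \<longrightarrow> K \<subseteq> V \<longrightarrow>
       uniform_limit (K \<inter> S)
         (\<lambda>t. partial_derivs is (\<lambda>y. (F (e + t) y - F e y) /\<^sub>R t))
         (partial_derivs is F') (at 0))"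


section \<open>Oriented manifolds\<close>

text \<open>
  The manifold is the whole of a Hausdorff, second countable type \<open>'a\<close>. A chart is a pair of
  a domain and a coordinate map (arbitrary outside the domain). Its dimension is \<open>CARD('n)\<close>.
\<close>

type_synonym ('a, 'n) chart = "'a set \<times> ('a \<Rightarrow> real^'n)"

abbreviation cdom :: "('a, 'n) chart \<Rightarrow> 'a set" where "cdom \<equiv> fst"
abbreviation coord :: "('a, 'n) chart \<Rightarrow> 'a \<Rightarrow> real^'n" where "coord \<equiv> snd"

definition param :: "('a, 'n) chart \<Rightarrow> real^'n \<Rightarrow> 'a"
  where "param c = inv_into (cdom c) (coord c)"

definition is_chart :: "('a::topological_space, 'n::finite) chart \<Rightarrow> bool"
  where "is_chart c \<longleftrightarrow> open (cdom c) \<and> open (coord c ` cdom c) \<and>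
    homeomorphism (cdom c) (coord c ` cdom c) (coord c) (param c)"

definition transition :: "('a, 'n) chart \<Rightarrow> ('a, 'n) chart \<Rightarrow> real^'n \<Rightarrow> real^'n"
  where "transition c c' = coord c' \<circ> param c"

definition oriented_atlas :: "('a::{t2_space,second_countable_topology}, 'n::finite) chart set \<Rightarrow> bool"
  where "oriented_atlas A \<longleftrightarrow>
    (\<forall>c\<in>A. is_chart c) \<and> (\<Union>c\<in>A. cdom c) = UNIV \<and>
    (\<forall>c\<in>A. \<forall>c'\<in>A. smooth_on (coord c ` (cdom c \<inter> cdom c')) (transition c c') \<and>
       (\<forall>p\<in>cdom c \<inter> cdom c'. det (jacobian (transition c c') (coord c p)) > 0))"

definition smooth_fun_on :: "('a::topological_space, 'n::finite) chart set \<Rightarrow> 'a set \<Rightarrow>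
    ('a \<Rightarrow> real) \<Rightarrow> bool"
  where "smooth_fun_on A V f \<longleftrightarrow> open V \<and>
    (\<forall>c\<in>A. smooth_on (coord c ` (cdom c \<inter> V)) (f \<circ> param c))"

text \<open>
  Scalar quantities given by a coordinate expression are evaluated in an arbitrary chart
  around the point; the expressions below do not depend on that choice.
\<close>

definition chart_at :: "('a, 'n) chart set \<Rightarrow> 'a \<Rightarrow> ('a, 'n) chart"
  where "chart_at A p = (SOME c. c \<in> A \<and> p \<in> cdom c)"


section \<open>Tensor fields and Riemannian metrics\<close>

text \<open>
  Vector fields, covector fields and covariant 2-tensor fields are given by their components
  in each chart, as functions of the point of the manifold.
\<close>

type_synonym ('a, 'n) vec_field = "('a, 'n) chart \<Rightarrow> 'a \<Rightarrow> real^'n"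
type_synonym ('a, 'n) covec_field = "('a, 'n) chart \<Rightarrow> 'a \<Rightarrow> real^'n"
type_synonym ('a, 'n) tensor2 = "('a, 'n) chart \<Rightarrow> 'a \<Rightarrow> real^'n^'n"

definition smooth_tensor2 :: "('a::topological_space, 'n::finite) chart set \<Rightarrow>
    ('a, 'n) tensor2 \<Rightarrow> bool"
  where "smooth_tensor2 A T \<longleftrightarrow>
    (\<forall>c\<in>A. smooth_on (coord c ` cdom c) (T c \<circ> param c)) \<and>
    (\<forall>c\<in>A. \<forall>c'\<in>A. \<forall>p\<in>cdom c \<inter> cdom c'.
       (let J = jacobian (transition c c') (coord c p)
        in T c p = transpose J ** T c' p ** J))"

definition riemannian_metric :: "('a::topological_space, 'n::finite) chart set \<Rightarrow>
    ('a, 'n) tensor2 \<Rightarrow> bool"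
  where "riemannian_metric A g \<longleftrightarrow> smooth_tensor2 A g \<and>
    (\<forall>c\<in>A. \<forall>p\<in>cdom c. transpose (g c p) = g c p \<and> (\<forall>v. v \<noteq> 0 \<longrightarrow> v \<bullet> (g c p *v v) > 0))"

definition volume_density :: "('a, 'n::finite) tensor2 \<Rightarrow> ('a, 'n) chart \<Rightarrow> 'a \<Rightarrow> real"
  where "volume_density g c p = sqrt (det (g c p))"

text \<open>The Borel measure that has density \<open>sqrt (det g)\<close> in the coordinates of every chart.\<close>

definition riemannian_volume :: "('a::topological_space, 'n::finite) chart set \<Rightarrow>
    ('a, 'n) tensor2 \<Rightarrow> 'a measure"
  where "riemannian_volume A g = (THE \<mu>. sets \<mu> = sets borel \<and>
    (\<forall>c\<in>A. \<forall>B\<in>sets borel. B \<subseteq> cdom c \<longrightarrow>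
       emeasure \<mu> B = (\<integral>\<^sup>+y\<in>coord c ` B. ennreal (volume_density g c (param c y)) \<partial>lborel)))"

definition differential :: "('a \<Rightarrow> real) \<Rightarrow> ('a, 'n::finite) covec_field"
  where "differential f c p = (\<chi> i. partial_deriv i (f \<circ> param c) (coord c p))"

definition gradient :: "('a, 'n::finite) tensor2 \<Rightarrow> ('a \<Rightarrow> real) \<Rightarrow> ('a, 'n) vec_field"
  where "gradient g f c p = matrix_inv (g c p) *v differential f c p"

definition divergence :: "('a, 'n::finite) chart set \<Rightarrow> ('a, 'n) tensor2 \<Rightarrow>
    ('a, 'n) vec_field \<Rightarrow> 'a \<Rightarrow> real"
  where "divergence A g X p = (let c = chart_at A p in
    (\<Sum>i\<in>UNIV. partial_deriv i ((\<lambda>q. volume_density g c q * X c q $ i) \<circ> param c) (coord c p))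
      / volume_density g c p)"

definition laplacian :: "('a, 'n::finite) chart set \<Rightarrow> ('a, 'n) tensor2 \<Rightarrow> ('a \<Rightarrow> real) \<Rightarrow> 'a \<Rightarrow> real"
  where "laplacian A g f p = - divergence A g (gradient g f) p"

definition tensor_prod :: "('a, 'n::finite) covec_field \<Rightarrow> ('a, 'n) covec_field \<Rightarrow> ('a, 'n) tensor2"
  where "tensor_prod \<alpha> \<beta> c p = (\<chi> i j. \<alpha> c p $ i * \<beta> c p $ j)"

text \<open>In coordinates, \<open>\<langle>S, T\<rangle> = g^{ik} g^{jl} S_{ij} T_{kl}\<close>.\<close>

definition tensor2_inner :: "('a, 'n::finite) chart set \<Rightarrow> ('a, 'n) tensor2 \<Rightarrow>
    ('a, 'n) tensor2 \<Rightarrow> ('a, 'n) tensor2 \<Rightarrow> 'a \<Rightarrow> real"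
  where "tensor2_inner A g S T p = (let c = chart_at A p; G = matrix_inv (g c p) in
    (\<Sum>i\<in>UNIV. \<Sum>j\<in>UNIV. \<Sum>k\<in>UNIV. \<Sum>l\<in>UNIV.
       G $ i $ k * G $ j $ l * S c p $ i $ j * T c p $ k $ l))"


section \<open>Regular domains and functions on them\<close>

text \<open>Smoothness of the boundary: locally, the domain is a strict sublevel set of a submersion.\<close>

definition bounded_regular_domain :: "('a::topological_space, 'n::finite) chart set \<Rightarrow> 'a set \<Rightarrow> bool"
  where "bounded_regular_domain A \<Omega> \<longleftrightarrow>
    open \<Omega> \<and> connected \<Omega> \<and> compact (closure \<Omega>) \<and> frontier \<Omega> \<noteq> {} \<and>
    (\<forall>p\<in>frontier \<Omega>. \<exists>V f. p \<in> V \<and> smooth_fun_on A V f \<and> f p = 0 \<and>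
       (\<forall>c\<in>A. \<forall>q\<in>cdom c \<inter> V. differential f c q \<noteq> 0) \<and> \<Omega> \<inter> V = {q\<in>V. f q < 0})"

definition smooth_up_to_boundary :: "('a::topological_space, 'n::finite) chart set \<Rightarrow> 'a set \<Rightarrow>
    ('a \<Rightarrow> real) \<Rightarrow> bool"
  where "smooth_up_to_boundary A \<Omega> \<phi> \<longleftrightarrow>
    (\<exists>V \<psi>. closure \<Omega> \<subseteq> V \<and> smooth_fun_on A V \<psi> \<and> (\<forall>p\<in>closure \<Omega>. \<psi> p = \<phi> p))"

definition L2_norm_on :: "('a::topological_space, 'n::finite) chart set \<Rightarrow> ('a, 'n) tensor2 \<Rightarrow>
    'a set \<Rightarrow> ('a \<Rightarrow> real) \<Rightarrow> real"
  where "L2_norm_on A g \<Omega> \<phi> = sqrt (LINT p:\<Omega>|riemannian_volume A g. (\<phi> p)\<^sup>2)"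


section \<open>Differentiable families\<close>

text \<open>
  A differentiable family is a differentiable curve in the space of smooth objects; jointly
  smooth families are a special case.
\<close>

definition differentiable_metric_family :: "('a::topological_space, 'n::finite) chart set \<Rightarrow>
    real set \<Rightarrow> (real \<Rightarrow> ('a, 'n) tensor2) \<Rightarrow> bool"
  where "differentiable_metric_family A I G \<longleftrightarrow>
    (\<forall>e\<in>I. riemannian_metric A (G e)) \<and>
    (\<forall>e\<in>I. \<exists>T. smooth_tensor2 A T \<and>
       (\<forall>c\<in>A. Cinf_has_deriv (coord c ` cdom c) (coord c ` cdom c)
          (\<lambda>s. G s c \<circ> param c) (T c \<circ> param c) e))"

definition differentiable_function_family :: "('a::topological_space, 'n::finite) chart set \<Rightarrow>
    'a set \<Rightarrow> real set \<Rightarrow> (real \<Rightarrow> 'a \<Rightarrow> real) \<Rightarrow> bool"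
  where "differentiable_function_family A \<Omega> I \<phi> \<longleftrightarrow>
    (\<forall>e\<in>I. smooth_up_to_boundary A \<Omega> (\<phi> e)) \<and>
    (\<forall>e\<in>I. \<exists>\<psi>. smooth_up_to_boundary A \<Omega> \<psi> \<and>
       (\<forall>c\<in>A. Cinf_has_deriv (coord c ` cdom c) (coord c ` (cdom c \<inter> \<Omega>))
          (\<lambda>s. \<phi> s \<circ> param c) (\<psi> \<circ> param c) e))"

definition metric_variation :: "(real \<Rightarrow> ('a, 'n::finite) tensor2) \<Rightarrow> ('a, 'n) tensor2"
  where "metric_variation G c p = vector_derivative (\<lambda>e. G e c p) (at 0)"

definition laplacian_variation :: "('a, 'n::finite) chart set \<Rightarrow> (real \<Rightarrow> ('a, 'n) tensor2) \<Rightarrow>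
    ('a \<Rightarrow> real) \<Rightarrow> 'a \<Rightarrow> real"
  where "laplacian_variation A G f p = deriv (\<lambda>e. laplacian A (G e) f p) 0"

end

theory Submission
  imports Defs
begin

text \<open>
  Everything is derived from the weak form of the eigenvalue equation. Let \<open>\<rho>\<^sub>t\<close> be the density of the
  volume of \<open>g\<^sub>t\<close> with respect to that of \<open>g\<close>. Integration by parts, for functions vanishing on the
  boundary, gives \<open>\<integral> \<langle>d\<phi>\<^sub>t, d\<phi>\<^sub>0\<rangle>\<^sub>t \<rho>\<^sub>t = \<Lambda>\<^sub>t \<integral> \<rho>\<^sub>t \<phi>\<^sub>0 \<phi>\<^sub>t\<close> and \<open>\<integral> \<langle>d\<phi>\<^sub>t, d\<phi>\<^sub>0\<rangle> = \<Lambda>\<^sub>0 \<integral> \<phi>\<^sub>0 \<phi>\<^sub>t\<close>;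
  subtracting, dividing by \<open>t\<close> and letting \<open>t\<close> tend to \<open>0\<close> expresses \<open>\<Lambda>'\<close> through first derivatives of
  \<open>\<phi>\<^sub>0\<close> only. With \<open>\<theta> = tr\<^sub>g h / 2\<close> and \<open>X = \<theta> \<nabla>\<phi>\<^sub>0 - h(\<nabla>\<phi>\<^sub>0)\<close> the result is
  \<open>\<integral> d\<phi>\<^sub>0(X) - \<theta> \<phi>\<^sub>0 \<Delta>\<phi>\<^sub>0\<close>. As \<open>\<Delta>'\<phi>\<^sub>0 = - div X - \<theta> \<Delta>\<phi>\<^sub>0\<close> and
  \<open>\<Delta>(\<phi>\<^sub>0\<^sup>2) = 2 \<phi>\<^sub>0 \<Delta>\<phi>\<^sub>0 - 2 |d\<phi>\<^sub>0|\<^sup>2\<close>, both integrals of the theorem have this value.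

  In the integration by parts, a function \<open>u\<close> vanishing on the boundary is approximated by
  compositions \<open>F(u)\<close> of compact support, using that \<open>du = 0\<close> almost everywhere on \<open>{u = 0}\<close>.
\<close>

section \<open>Continuously differentiable maps\<close>

text \<open>In both identities the same product of \<open>d\<phi>_0\<close> and
  \<open>d\<phi>_t\<close> is contracted with metric coefficients and integrated against the fixed
  volume of \<open>g\<close>. Their difference quotient therefore touches the metric alone:
  \<open>\<phi>_t\<close> has to converge together with its first derivatives, but is never
  differentiated in \<open>t\<close>. The field \<open>X\<close> is the derivative at
  \<open>t = 0\<close> of \<open>\<rho>_t \<nabla>_t \<phi>_0\<close>. For the divergence of
  \<open>g\<close> one has \<open>div (\<rho>_t \<nabla>_t f) = - \<rho>_t \<Delta>_t f\<close>, and
  differentiating this gives the formula for \<open>\<Delta>'\<close>. Two obstacles shape the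
  development. The volume is introduced by a definite description, so it must first be constructed,
  and its existence rests on the change of variables between charts. Moreover, the extensions of the
  functions \<open>\<phi>_t\<close> beyond the boundary are chosen for each \<open>t\<close>
  separately, so nothing is uniform in \<open>t\<close> outside \<open>\<Omega>\<close>: estimates
  are made on \<open>\<Omega>\<close> only, near each point of the closure, and combined by
  compactness.\<close>

definition C1_on :: "'e::euclidean_space set \<Rightarrow> ('e \<Rightarrow> 'b::real_normed_vector) \<Rightarrow> bool"
  where "C1_on S f \<longleftrightarrow> open S \<and> (\<exists>f'. (\<forall>x\<in>S. (f has_derivative f' x) (at x)) \<and>
    (\<forall>v. continuous_on S (\<lambda>x. f' x v)))"

lemma C1_onI:
  assumes "open S" "\<And>x. x \<in> S \<Longrightarrow> (f has_derivative f' x) (at x)"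
    "\<And>v. continuous_on S (\<lambda>x. f' x v)"
  shows "C1_on S f"
  using assms unfolding C1_on_def by blast

lemma C1_onE:
  assumes "C1_on S f"
  obtains f' where "open S" "\<And>x. x \<in> S \<Longrightarrow> (f has_derivative f' x) (at x)"
    "\<And>v. continuous_on S (\<lambda>x. f' x v)"
  using assms unfolding C1_on_def by blast

lemma C1_on_open: "C1_on S f \<Longrightarrow> open S"
  by (simp add: C1_on_def)

lemma C1_on_differentiable: "C1_on S f \<Longrightarrow> x \<in> S \<Longrightarrow> f differentiable (at x)"
  by (auto simp: C1_on_def differentiable_def)

lemma C1_on_continuous: "C1_on S f \<Longrightarrow> continuous_on S f"
  by (meson C1_on_differentiable continuous_at_imp_continuous_on differentiable_imp_continuous_within)

lemma C1_on_subset: "C1_on S f \<Longrightarrow> open T \<Longrightarrow> T \<subseteq> S \<Longrightarrow> C1_on T f"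
  unfolding C1_on_def by (meson continuous_on_subset subsetD)

lemma C1_on_frechet_derivative:
  assumes "C1_on S f"
  shows "continuous_on S (\<lambda>x. frechet_derivative f (at x) v)"
proof -
  obtain f' where f': "\<And>x. x \<in> S \<Longrightarrow> (f has_derivative f' x) (at x)"
    "\<And>v. continuous_on S (\<lambda>x. f' x v)" using C1_onE[OF assms(1)] by metis
  have "frechet_derivative f (at x) = f' x" if "x \<in> S" for x
    using f'(1)[OF that] frechet_derivative_at by metis
  then show ?thesis using f'(2)[of v] by (simp cong: continuous_on_cong)
qed

lemma C1_on_frechet:
  assumes "open S" "\<And>x. x \<in> S \<Longrightarrow> f differentiable (at x)"
    "\<And>v. continuous_on S (\<lambda>x. frechet_derivative f (at x) v)"
  shows "C1_on S f"
  using assms by (intro C1_onI) (auto simp: frechet_derivative_works)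

lemma C1_on_partial_deriv: "C1_on S f \<Longrightarrow> continuous_on S (partial_deriv i f)"
  unfolding partial_deriv_def by (rule C1_on_frechet_derivative)

lemma frechet_derivative_cong:
  assumes "open S" "x \<in> S" "\<And>y. y \<in> S \<Longrightarrow> f y = g y"
  shows "frechet_derivative f (at x) = frechet_derivative g (at x)"
proof -
  have "(f has_derivative D) (at x) \<longleftrightarrow> (g has_derivative D) (at x)" for D
    using has_derivative_transform_within_open[OF _ assms(1,2), of f D UNIV g]
      has_derivative_transform_within_open[OF _ assms(1,2), of g D UNIV f] assms(3) by auto
  then show ?thesis unfolding frechet_derivative_def by simp
qed

lemma partial_deriv_cong:
  assumes "open S" "x \<in> S" "\<And>y. y \<in> S \<Longrightarrow> f y = g y"
  shows "partial_deriv i f x = partial_deriv i g x"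
  unfolding partial_deriv_def by (simp add: frechet_derivative_cong[OF assms])

lemma has_derivative_partial:
  "(f has_derivative D) (at x) \<Longrightarrow> partial_deriv i f x = D (axis i 1)"
  unfolding partial_deriv_def by (simp add: frechet_derivative_at[symmetric])

lemma frechet_derivative_partial:
  fixes f :: "real^'n \<Rightarrow> 'b::real_normed_vector"
  assumes "f differentiable (at x)"
  shows "frechet_derivative f (at x) v = (\<Sum>i\<in>UNIV. v $ i *\<^sub>R partial_deriv i f x)"
proof -
  have "linear (frechet_derivative f (at x))"
    using assms by (metis frechet_derivative_works has_derivative_linear)
  moreover have "v = (\<Sum>i\<in>UNIV. v $ i *\<^sub>R axis i 1)"
    by (simp add: basis_expansion scalar_mult_eq_scaleR[symmetric])
  ultimately have "frechet_derivative f (at x) v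
      = (\<Sum>i\<in>UNIV. frechet_derivative f (at x) (v $ i *\<^sub>R axis i 1))"
    by (metis (no_types) linear_sum)
  then show ?thesis
    using \<open>linear _\<close> by (simp add: partial_deriv_def linear_cmul)
qed

lemma C1_on_cong:
  assumes "C1_on S f" "\<And>x. x \<in> S \<Longrightarrow> f x = g x"
  shows "C1_on S g"
proof -
  obtain f' where f': "open S" "\<And>x. x \<in> S \<Longrightarrow> (f has_derivative f' x) (at x)"
    "\<And>v. continuous_on S (\<lambda>x. f' x v)" using C1_onE[OF assms(1)] by metis
  show ?thesis
  proof (rule C1_onI[OF f'(1) _ f'(3)])
    show "(g has_derivative f' x) (at x)" if "x \<in> S" for x
      using has_derivative_transform_within_open[OF f'(2)[OF that] f'(1) that] assms(2) by blast
  qed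
qed

text \<open>Used to glue: a function given by a C1 expression on one open set and by zero on another
  is C1 on their union.\<close>

lemma C1_on_local:
  assumes "\<And>x. x \<in> S \<Longrightarrow> \<exists>N. x \<in> N \<and> C1_on N f"
    and "open S"
  shows "C1_on S f"
proof (rule C1_on_frechet[OF assms(2)])
  show "f differentiable (at x)" if "x \<in> S" for x
    using assms(1)[OF that] C1_on_differentiable by blast
  show "continuous_on S (\<lambda>x. frechet_derivative f (at x) v)" for v
  proof (rule continuous_at_imp_continuous_on, rule ballI)
    fix x assume "x \<in> S"
    then obtain N where N: "x \<in> N" "C1_on N f" using assms(1) by blast
    show "isCont (\<lambda>x. frechet_derivative f (at x) v) x"
      using C1_on_frechet_derivative[OF N(2), of v] N C1_on_open[OF N(2)]
      by (simp add: continuous_on_eq_continuous_at)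
  qed
qed

lemma C1_on_const [intro!]: "open S \<Longrightarrow> C1_on S (\<lambda>x. c)"
  by (rule C1_onI[where f' = "\<lambda>x v. 0"]) (auto intro: derivative_intros)

lemma C1_on_bounded_linear:
  assumes "bounded_linear L" "C1_on S f"
  shows "C1_on S (\<lambda>x. L (f x))"
proof -
  obtain f' where f': "open S" "\<And>x. x \<in> S \<Longrightarrow> (f has_derivative f' x) (at x)"
    "\<And>v. continuous_on S (\<lambda>x. f' x v)" using C1_onE[OF assms(2)] by metis
  show ?thesis
    by (rule C1_onI[OF f'(1) bounded_linear.has_derivative[OF assms(1) f'(2)]])
      (auto intro: bounded_linear.continuous_on[OF assms(1)] f'(3))
qed

lemma C1_on_ident: "open S \<Longrightarrow> C1_on S (\<lambda>x. x)"
  by (rule C1_onI[where f' = "\<lambda>x v. v"]) (auto intro: derivative_intros)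

lemma C1_on_linear: "bounded_linear L \<Longrightarrow> open S \<Longrightarrow> C1_on S L"
  using C1_on_bounded_linear[OF _ C1_on_ident] by blast

lemma C1_on_nth: "C1_on S f \<Longrightarrow> C1_on S (\<lambda>x. f x $ i)"
  by (rule C1_on_bounded_linear[OF bounded_linear_vec_nth])

lemma C1_on_add:
  assumes "C1_on S f" "C1_on S g"
  shows "C1_on S (\<lambda>x. f x + g x)"
proof -
  obtain f' where f': "open S" "\<And>x. x \<in> S \<Longrightarrow> (f has_derivative f' x) (at x)"
    "\<And>v. continuous_on S (\<lambda>x. f' x v)" using C1_onE[OF assms(1)] by metis
  obtain g' where g': "\<And>x. x \<in> S \<Longrightarrow> (g has_derivative g' x) (at x)"
    "\<And>v. continuous_on S (\<lambda>x. g' x v)" using C1_onE[OF assms(2)] by metis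
  show ?thesis
    by (rule C1_onI[OF f'(1) has_derivative_add[OF f'(2) g'(1)]]) (auto intro: continuous_intros f' g')
qed

lemma C1_on_scaleR:
  fixes f :: "'e::euclidean_space \<Rightarrow> real"
  assumes "C1_on S f" "C1_on S g"
  shows "C1_on S (\<lambda>x. f x *\<^sub>R g x)"
proof -
  obtain f' where f': "open S" "\<And>x. x \<in> S \<Longrightarrow> (f has_derivative f' x) (at x)"
    "\<And>v. continuous_on S (\<lambda>x. f' x v)" using C1_onE[OF assms(1)] by metis
  obtain g' where g': "\<And>x. x \<in> S \<Longrightarrow> (g has_derivative g' x) (at x)"
    "\<And>v. continuous_on S (\<lambda>x. g' x v)" using C1_onE[OF assms(2)] by metis
  show ?thesis
    by (rule C1_onI[OF f'(1) has_derivative_scaleR[OF f'(2) g'(1)]])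
      (assumption | intro continuous_on_add continuous_on_scaleR f' g'
        C1_on_continuous[OF assms(1)] C1_on_continuous[OF assms(2)])+
qed

lemma C1_on_mult:
  fixes f g :: "'e::euclidean_space \<Rightarrow> real"
  shows "C1_on S f \<Longrightarrow> C1_on S g \<Longrightarrow> C1_on S (\<lambda>x. f x * g x)"
  using C1_on_scaleR[of S f g] by simp

lemma C1_on_cmult:
  fixes f :: "'e::euclidean_space \<Rightarrow> real"
  shows "C1_on S f \<Longrightarrow> C1_on S (\<lambda>x. c * f x)"
  by (rule C1_on_bounded_linear[OF bounded_linear_mult_right])

lemma C1_on_minus: "C1_on S f \<Longrightarrow> C1_on S (\<lambda>x. - f x)"
  by (rule C1_on_bounded_linear[OF bounded_linear_minus[OF bounded_linear_ident]])

lemma C1_on_diff: "C1_on S f \<Longrightarrow> C1_on S g \<Longrightarrow> C1_on S (\<lambda>x. f x - g x)"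
  using C1_on_add[of S f "\<lambda>x. - g x"] C1_on_minus[of S g] by simp

lemma C1_on_sum:
  assumes "open S" "\<And>i. i \<in> K \<Longrightarrow> C1_on S (f i)"
  shows "C1_on S (\<lambda>x. \<Sum>i\<in>K. f i x)"
  using assms(2)
proof (induction K rule: infinite_finite_induct)
  case (insert i K)
  then show ?case using C1_on_add[of S "f i" "\<lambda>x. \<Sum>i\<in>K. f i x"] by simp
qed (simp_all add: C1_on_const assms(1))

lemma C1_on_prod:
  fixes f :: "'i \<Rightarrow> 'e::euclidean_space \<Rightarrow> real"
  assumes "open S" "\<And>i. i \<in> K \<Longrightarrow> C1_on S (f i)"
  shows "C1_on S (\<lambda>x. \<Prod>i\<in>K. f i x)"
  using assms(2)
proof (induction K rule: infinite_finite_induct)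
  case (insert i K)
  then show ?case using C1_on_mult[of S "f i" "\<lambda>x. \<Prod>i\<in>K. f i x"] by simp
qed (simp_all add: C1_on_const assms(1))

text \<open>In the derivative \<open>f' (g x) (g' x v)\<close> the direction moves with
  \<open>x\<close>, whereas \<open>C1_on\<close> gives continuity for fixed directions only.
  Expanding the direction in the basis separates the two dependences.\<close>

lemma C1_on_compose:
  fixes f :: "'e::euclidean_space \<Rightarrow> 'b::real_normed_vector" and g :: "'d::euclidean_space \<Rightarrow> 'e"
  assumes "C1_on T f" "C1_on S g" "g ` S \<subseteq> T"
  shows "C1_on S (\<lambda>x. f (g x))"
proof -
  obtain f' where f': "open T" "\<And>x. x \<in> T \<Longrightarrow> (f has_derivative f' x) (at x)"
    "\<And>v. continuous_on T (\<lambda>x. f' x v)" using C1_onE[OF assms(1)] by metis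
  obtain g' where g': "open S" "\<And>x. x \<in> S \<Longrightarrow> (g has_derivative g' x) (at x)"
    "\<And>v. continuous_on S (\<lambda>x. g' x v)" using C1_onE[OF assms(2)] by metis
  show ?thesis
  proof (rule C1_onI[OF g'(1), where f' = "\<lambda>x v. f' (g x) (g' x v)"])
    show "((\<lambda>x. f (g x)) has_derivative (\<lambda>v. f' (g x) (g' x v))) (at x)" if "x \<in> S" for x
    proof -
      have "g x \<in> T" using that assms(3) by blast
      from has_derivative_compose[OF g'(2)[OF that] f'(2)[OF this]] show ?thesis .
    qed
    show "continuous_on S (\<lambda>x. f' (g x) (g' x v))" for v
    proof -
      have "f' (g x) (g' x v) = (\<Sum>b\<in>Basis. (g' x v \<bullet> b) *\<^sub>R f' (g x) b)" if "x \<in> S" for x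
      proof -
        have "linear (f' (g x))" using f'(2) that assms(3) by (blast intro: has_derivative_linear)
        then show ?thesis
          using linear_sum[of "f' (g x)" "\<lambda>b. (g' x v \<bullet> b) *\<^sub>R b" Basis]
          by (simp add: euclidean_representation linear_cmul)
      qed
      moreover have "continuous_on S (\<lambda>x. \<Sum>b\<in>Basis. (g' x v \<bullet> b) *\<^sub>R f' (g x) b)"
        using assms(3) C1_on_continuous[OF assms(2)]
        by (auto intro!: continuous_intros g' continuous_on_compose2[OF f'(3)])
      ultimately show ?thesis by (simp cong: continuous_on_cong)
    qed
  qed
qed

lemma C1_on_real:
  fixes h :: "real \<Rightarrow> real"
  assumes "open S" "\<And>x. x \<in> S \<Longrightarrow> (h has_real_derivative h' x) (at x)" "continuous_on S h'"
  shows "C1_on S h"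
  by (rule C1_onI[OF assms(1) assms(2)[unfolded has_field_derivative_def]])
    (auto intro!: continuous_intros assms)

lemma C1_on_inverse:
  fixes f :: "'e::euclidean_space \<Rightarrow> real"
  assumes "C1_on S f" "\<And>x. x \<in> S \<Longrightarrow> f x \<noteq> 0"
  shows "C1_on S (\<lambda>x. inverse (f x))"
proof (rule C1_on_compose[OF _ assms(1), where T = "- {0}"])
  show "C1_on (- {0}) (inverse :: real \<Rightarrow> real)"
    by (rule C1_on_real[OF _ DERIV_inverse]) (auto intro!: continuous_intros)
qed (use assms in auto)

lemma C1_on_divide:
  fixes f :: "'e::euclidean_space \<Rightarrow> real"
  assumes "C1_on S f" "C1_on S g" "\<And>x. x \<in> S \<Longrightarrow> g x \<noteq> 0"
  shows "C1_on S (\<lambda>x. f x / g x)"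
  unfolding divide_inverse by (intro C1_on_mult C1_on_inverse assms)

lemma C1_on_sqrt:
  fixes f :: "'e::euclidean_space \<Rightarrow> real"
  assumes "C1_on S f" "\<And>x. x \<in> S \<Longrightarrow> f x > 0"
  shows "C1_on S (\<lambda>x. sqrt (f x))"
proof (rule C1_on_compose[OF _ assms(1), where T = "{0<..}"])
  show "C1_on {0<..} sqrt"
    by (rule C1_on_real[where h' = "\<lambda>x. inverse (sqrt x) / 2"])
      (auto intro!: DERIV_real_sqrt continuous_intros)
qed (use assms in auto)

lemma C1_on_det:
  fixes F :: "'e::euclidean_space \<Rightarrow> real^'n^'n"
  assumes "open S" "\<And>i j. C1_on S (\<lambda>x. F x $ i $ j)"
  shows "C1_on S (\<lambda>x. det (F x))"
  unfolding det_def by (intro C1_on_sum C1_on_cmult C1_on_prod assms finite_permutations finite)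

section \<open>Inverse matrices as functions of their entries\<close>

lemma matrix_inv_inverse:
  fixes M :: "real^'n^'n"
  assumes "det M \<noteq> 0"
  shows "M ** matrix_inv M = mat 1" "matrix_inv M ** M = mat 1"
proof -
  have "\<exists>B. M ** B = mat 1 \<and> B ** M = mat 1"
    using assms invertible_det_nz unfolding invertible_def by blast
  then have "M ** matrix_inv M = mat 1 \<and> matrix_inv M ** M = mat 1"
    unfolding matrix_inv_def by (rule someI_ex)
  then show "M ** matrix_inv M = mat 1" "matrix_inv M ** M = mat 1" by auto
qed

text \<open>Every entry becomes a quotient of polynomials in the entries of the matrix. Regularity
  of the inverse, in space as well as in the parameter, is obtained from this formula.\<close>

lemma matrix_inv_cramer:
  fixes M :: "real^'n^'n"
  assumes "det M \<noteq> 0"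
  shows "matrix_inv M $ k $ l = det (\<chi> i j. if j = k then axis l 1 $ i else M $ i $ j) / det M"
proof -
  note inv = matrix_inv_inverse(1)[OF assms]
  have "M *v (matrix_inv M *v axis l 1) = axis l 1"
    by (simp add: matrix_vector_mul_assoc inv)
  then have "matrix_inv M *v axis l 1
      = (\<chi> k. det (\<chi> i j. if j = k then axis l 1 $ i else M $ i $ j) / det M)"
    using cramer[OF assms] by blast
  then have "(matrix_inv M *v axis l 1) $ k = det (\<chi> i j. if j = k then axis l 1 $ i else M $ i $ j) / det M"
    by simp
  then show ?thesis unfolding matrix_vector_mult_basis by (simp add: column_def)
qed

lemma C1_on_matrix_inv:
  fixes F :: "'e::euclidean_space \<Rightarrow> real^'n^'n"
  assumes "open S" "\<And>i j. C1_on S (\<lambda>x. F x $ i $ j)" "\<And>x. x \<in> S \<Longrightarrow> det (F x) \<noteq> 0"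
  shows "C1_on S (\<lambda>x. matrix_inv (F x) $ k $ l)"
proof (rule C1_on_cong)
  show "C1_on S (\<lambda>x. det (\<chi> i j. if j = k then axis l 1 $ i else F x $ i $ j) / det (F x))"
  proof (intro C1_on_divide C1_on_det assms)
    fix i j
    show "C1_on S (\<lambda>x. (\<chi> i j. if j = k then axis l 1 $ i else F x $ i $ j) $ i $ j)"
      using assms(2)[of i j] assms(1) by (cases "j = k") auto
  qed
qed (simp add: matrix_inv_cramer assms(3))

lemma inner_transpose: "(transpose M *v x) \<bullet> y = x \<bullet> (M *v y)" for M :: "real^'n^'n"
  by (metis dot_lmul_matrix transpose_matrix_vector)

text \<open>On a compact ball the sum of the absolute partial derivatives is bounded and dominates
  the operator norm; the mean value inequality on the convex ball does the rest. Applied to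
  functions of the metric coefficients, it bounds their difference quotients in the
  parameter.\<close>

lemma C1_on_locally_Lipschitz:
  fixes f :: "'e::euclidean_space \<Rightarrow> real"
  assumes "C1_on S f" "x \<in> S"
  obtains r L where "r > 0" "L \<ge> 0" "ball x r \<subseteq> S"
    "\<And>y z. y \<in> ball x r \<Longrightarrow> z \<in> ball x r \<Longrightarrow> \<bar>f y - f z\<bar> \<le> L * norm (y - z)"
proof -
  obtain f' where f': "open S" "\<And>x. x \<in> S \<Longrightarrow> (f has_derivative f' x) (at x)"
    "\<And>v. continuous_on S (\<lambda>x. f' x v)" using C1_onE[OF assms(1)] by metis
  obtain r where r: "r > 0" "cball x r \<subseteq> S" using f'(1) assms(2) open_contains_cball by blast
  have "continuous_on (cball x r) (\<lambda>y. \<Sum>b\<in>Basis. \<bar>f' y b\<bar>)"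
    by (intro continuous_on_sum continuous_on_rabs continuous_on_subset[OF f'(3) r(2)])
  then have "bounded ((\<lambda>y. \<Sum>b\<in>Basis. \<bar>f' y b\<bar>) ` cball x r)"
    by (intro compact_imp_bounded compact_continuous_image compact_cball)
  then obtain L where "\<forall>z\<in>(\<lambda>y. \<Sum>b\<in>Basis. \<bar>f' y b\<bar>) ` cball x r. norm z \<le> L"
    unfolding bounded_iff by blast
  then have L: "\<bar>\<Sum>b\<in>Basis. \<bar>f' y b\<bar>\<bar> \<le> L" if "y \<in> cball x r" for y
    using that by simp
  have L0: "L \<ge> 0" using order_trans[OF abs_ge_zero L[of x]] r by simp
  have on: "onorm (f' y) \<le> L" if "y \<in> ball x r" for y
  proof (rule onorm_bound[OF L0])
    fix v
    have lin: "linear (f' y)" using has_derivative_linear[OF f'(2)] subsetD[OF r(2), of y] that by simp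
    have "f' y v = (\<Sum>b\<in>Basis. (v \<bullet> b) *\<^sub>R f' y b)"
    proof -
      have "f' y v = f' y (\<Sum>b\<in>Basis. (v \<bullet> b) *\<^sub>R b)" by (simp only: euclidean_representation)
      then show ?thesis using lin by (simp add: linear_sum linear_cmul)
    qed
    also have "norm \<dots> \<le> (\<Sum>b\<in>Basis. norm v * \<bar>f' y b\<bar>)"
      by (rule order_trans[OF norm_sum])
        (auto intro!: sum_mono mult_right_mono simp: abs_mult Basis_le_norm)
    also have "\<dots> = norm v * (\<Sum>b\<in>Basis. \<bar>f' y b\<bar>)" by (simp add: sum_distrib_left)
    also have "\<dots> \<le> norm v * L" using L[of y] that by (intro mult_left_mono) auto
    finally show "norm (f' y v) \<le> L * norm v" by (simp add: mult.commute)
  qed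
  show ?thesis
  proof (rule that[OF r(1) L0])
    show "ball x r \<subseteq> S" using r by auto
    show "\<bar>f y - f z\<bar> \<le> L * norm (y - z)" if "y \<in> ball x r" "z \<in> ball x r" for y z
    proof -
      have "(f has_derivative f' w) (at w within ball x r)" if "w \<in> ball x r" for w
        using f'(2) subsetD[OF r(2), of w] that by (auto intro: has_derivative_at_withinI)
      from differentiable_bound[OF convex_ball this on, of y z] that show ?thesis by simp
    qed
  qed
qed

lemma smooth_on_partial_deriv:
  fixes f :: "real^'n \<Rightarrow> 'b::real_normed_vector"
  assumes "smooth_on S f"
  shows "smooth_on S (partial_deriv i f)"
proof -
  have "partial_derivs js (partial_deriv i f) = partial_derivs (js @ [i]) f" for js
    by (induction js) auto
  then show ?thesis using assms unfolding smooth_on_def by metis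
qed

lemma smooth_on_imp_C1_on:
  fixes f :: "real^'n \<Rightarrow> 'b::real_normed_vector"
  assumes "smooth_on S f"
  shows "C1_on S f"
proof (rule C1_on_frechet)
  show S: "open S" using assms by (simp add: smooth_on_def)
  have d: "partial_derivs is f differentiable (at x)" if "x \<in> S" for "is" x
    using assms that S unfolding smooth_on_def differentiable_on_def
    by (metis at_within_open)
  show "f differentiable (at x)" if "x \<in> S" for x
    using d[OF that, of "[]"] by simp
  moreover have "continuous_on S (\<lambda>x. \<Sum>i\<in>UNIV. v $ i *\<^sub>R partial_deriv i f x)" for v
  proof (intro continuous_intros)
    fix i
    show "continuous_on S (partial_deriv i f)"
      using d[of _ "[i]"] by (auto intro: continuous_at_imp_continuous_on differentiable_imp_continuous_within)
  qed
  ultimately show "continuous_on S (\<lambda>x. frechet_derivative f (at x) v)" for v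
    by (simp add: frechet_derivative_partial cong: continuous_on_cong)
qed

section \<open>Change of variables for nonnegative functions\<close>

text \<open>The library proves the change of variables formula for wellordered index types only.\<close>

typedef 'a ordered_copy = "UNIV :: 'a set" morphisms of_copy to_copy
  by simp

lemma of_to_copy [simp]: "of_copy (to_copy x) = x"
  by (simp add: to_copy_inverse)

lemma to_of_copy [simp]: "to_copy (of_copy x) = x"
  by (simp add: of_copy_inverse)

lemma bij_of_copy: "bij of_copy"
  by (metis bijI' of_to_copy to_of_copy)

lemma bij_to_copy: "bij to_copy"
  by (metis bijI' of_to_copy to_of_copy)

instance ordered_copy :: (finite) finite
proof
  show "finite (UNIV :: 'a ordered_copy set)"
    using finite_imageI[OF finite, of to_copy] bij_is_surj[OF bij_to_copy] by metis
qed

text \<open>Any injection will do: the order pulled back from \<open>nat\<close> is a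
  wellorder.\<close>

definition copy_index :: "'a::finite ordered_copy \<Rightarrow> nat"
  where "copy_index = (SOME f. inj f)"

lemma inj_copy_index: "inj copy_index"
proof -
  have "\<exists>f :: 'a ordered_copy \<Rightarrow> nat. inj f"
    using finite_imp_inj_to_nat_seg[OF finite[of UNIV]] by blast
  then show ?thesis unfolding copy_index_def by (rule someI_ex)
qed

instantiation ordered_copy :: (finite) wellorder
begin

definition "x \<le> y \<longleftrightarrow> copy_index x \<le> copy_index y"
definition "x < y \<longleftrightarrow> copy_index x < copy_index y"

instance
proof
  fix x y z :: "'a ordered_copy" and P :: "'a ordered_copy \<Rightarrow> bool"
  show "x < y \<longleftrightarrow> x \<le> y \<and> \<not> y \<le> x" "x \<le> x" "x \<le> y \<Longrightarrow> y \<le> z \<Longrightarrow> x \<le> z" "x \<le> y \<or> y \<le> x"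
    by (auto simp: less_eq_ordered_copy_def less_ordered_copy_def)
  show "x \<le> y \<Longrightarrow> y \<le> x \<Longrightarrow> x = y"
    using inj_copy_index by (auto simp: less_eq_ordered_copy_def dest: injD)
  show "P x" if step: "\<And>x. (\<And>y. y < x \<Longrightarrow> P y) \<Longrightarrow> P x"
  proof (induction x rule: measure_induct_rule[of copy_index])
    case (less x)
    show ?case by (rule step) (simp add: less_ordered_copy_def less)
  qed
qed

end

definition from_copy :: "real^('n::finite) ordered_copy \<Rightarrow> real^'n"
  where "from_copy x = (\<chi> i. x $ to_copy i)"

definition into_copy :: "real^'n \<Rightarrow> real^('n::finite) ordered_copy"
  where "into_copy x = (\<chi> i. x $ of_copy i)"

lemma from_into_copy [simp]: "from_copy (into_copy x) = x"
  by (simp add: from_copy_def into_copy_def vec_eq_iff)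

lemma into_from_copy [simp]: "into_copy (from_copy x) = x"
  by (simp add: from_copy_def into_copy_def vec_eq_iff)

lemma bounded_linear_from_copy: "bounded_linear from_copy"
  by (intro linear_conv_bounded_linear[THEN iffD1] linearI) (auto simp: from_copy_def vec_eq_iff)

lemma bounded_linear_into_copy: "bounded_linear into_copy"
  by (intro linear_conv_bounded_linear[THEN iffD1] linearI) (auto simp: into_copy_def vec_eq_iff)

lemma measurable_from_copy: "from_copy \<in> borel_measurable borel"
  by (intro borel_measurable_continuous_onI linear_continuous_on bounded_linear_from_copy)

lemma prod_Basis_cart:
  fixes x :: "real^'n"
  shows "(\<Prod>b\<in>Basis. x \<bullet> b) = (\<Prod>i\<in>UNIV. x $ i)"
proof -
  have "(Basis :: (real^'n) set) = range (\<lambda>i. axis i 1)"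
    by (auto simp: Basis_vec_def)
  moreover have "inj (\<lambda>i :: 'n. axis i (1 :: real))"
    by (auto simp: inj_on_def axis_eq_axis)
  ultimately have "(\<Prod>b\<in>Basis. x \<bullet> b) = (\<Prod>i\<in>UNIV. x \<bullet> axis i 1)"
    by (metis (no_types, lifting) prod.reindex_cong)
  then show ?thesis by (simp add: inner_axis)
qed

text \<open>Relabelling coordinates maps boxes to boxes and permutes the factors of their volume,
  and Lebesgue measure is determined by its values on boxes.\<close>

lemma distr_from_copy: "distr lborel borel from_copy = (lborel :: (real^'n) measure)"
proof (rule lborel_eqI[symmetric])
  fix l u :: "real^'n"
  assume le: "\<And>b. b \<in> Basis \<Longrightarrow> l \<bullet> b \<le> u \<bullet> b"
  have le': "l $ i \<le> u $ i" for i
    using le[of "axis i 1"] by (simp add: inner_axis)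
  have "from_copy -` box l u = box (into_copy l) (into_copy u)"
    by (auto simp: mem_box_cart from_copy_def into_copy_def) (metis of_to_copy to_of_copy)+
  then have "emeasure (distr lborel borel from_copy) (box l u)
      = emeasure lborel (box (into_copy l) (into_copy u))"
    by (simp add: emeasure_distr measurable_from_copy)
  also have "\<dots> = ennreal (\<Prod>b\<in>Basis. (into_copy u - into_copy l) \<bullet> b)"
    by (subst emeasure_lborel_box_eq) (auto simp: Basis_vec_def inner_axis into_copy_def le')
  also have "(\<Prod>b\<in>Basis. (into_copy u - into_copy l) \<bullet> b) = (\<Prod>i\<in>UNIV. u $ of_copy i - l $ of_copy i)"
    by (simp add: prod_Basis_cart into_copy_def)
  also have "\<dots> = (\<Prod>i\<in>UNIV. u $ i - l $ i)"
    by (rule prod.reindex_bij_betw[OF bij_of_copy])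
  also have "\<dots> = (\<Prod>b\<in>Basis. (u - l) \<bullet> b)"
    by (simp add: prod_Basis_cart)
  finally show "emeasure (distr lborel borel from_copy) (box l u) = ennreal (\<Prod>b\<in>Basis. (u - l) \<bullet> b)" .
qed simp

text \<open>Conjugation by the relabelling turns a product of transpositions into a product of
  equally many transpositions, so parity is kept.\<close>

lemma sign_copy:
  fixes p :: "'n::finite \<Rightarrow> 'n"
  assumes "p permutes UNIV"
  shows "sign (to_copy \<circ> p \<circ> of_copy) = sign p"
proof -
  have "swapidseq n (to_copy \<circ> p \<circ> of_copy)" if "swapidseq n p" for n
    using that
  proof (induction n p rule: swapidseq.induct)
    case id
    have "to_copy \<circ> id \<circ> of_copy = (id :: 'n ordered_copy \<Rightarrow> 'n ordered_copy)" by (rule ext) simp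
    then show ?case by (simp only: swapidseq.id)
  next
    case (comp_Suc n p a b)
    have "to_copy \<circ> (Transposition.transpose a b \<circ> p) \<circ> of_copy
        = Transposition.transpose (to_copy a) (to_copy b) \<circ> (to_copy \<circ> p \<circ> of_copy)"
      by (auto simp: fun_eq_iff Transposition.transpose_def) (metis of_to_copy)+
    moreover have "to_copy a \<noteq> to_copy b" using comp_Suc by (metis of_to_copy)
    ultimately show ?case using comp_Suc swapidseq.comp_Suc by metis
  qed
  moreover obtain n where "swapidseq n p"
    using permutes_imp_permutation[OF finite assms] by (auto simp: permutation_def)
  ultimately have "evenperm (to_copy \<circ> p \<circ> of_copy) = evenperm p"
    by (metis evenperm_unique)
  then show ?thesis by (simp add: sign_def)
qed

text \<open>In the Leibniz formula, conjugation is a bijection between the two groups of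
  permutations; it preserves signs and only reorders the factors of each product.\<close>

lemma det_copy:
  fixes M :: "real^'n^'n"
  shows "det (\<chi> a b. M $ of_copy a $ of_copy b) = det M"
proof -
  let ?c = "\<lambda>p. to_copy \<circ> p \<circ> of_copy"
  have bij: "bij_betw ?c {p. p permutes (UNIV :: 'n set)} {p. p permutes UNIV}"
  proof (rule bij_betw_byWitness[where f' = "\<lambda>p. of_copy \<circ> p \<circ> to_copy"])
    show "?c ` {p. p permutes UNIV} \<subseteq> {p. p permutes UNIV}"
      by (auto simp: bij_imp_permutes permutes_bij intro!: bij_imp_permutes bij_comp bij_of_copy bij_to_copy)
    show "(\<lambda>p. of_copy \<circ> p \<circ> to_copy) ` {p. p permutes UNIV} \<subseteq> {p. p permutes (UNIV :: 'n set)}"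
      by (auto simp: permutes_bij intro!: bij_imp_permutes bij_comp bij_of_copy bij_to_copy)
  qed (auto simp: fun_eq_iff)
  have "det (\<chi> a b. M $ of_copy a $ of_copy b)
      = (\<Sum>p | p permutes UNIV. of_int (sign (?c p)) * (\<Prod>i\<in>UNIV. M $ of_copy i $ of_copy (?c p i)))"
    unfolding det_def by (subst sum.reindex_bij_betw[OF bij, symmetric]) simp
  also have "\<dots> = det M"
    unfolding det_def
  proof (rule sum.cong[OF refl])
    fix p :: "'n \<Rightarrow> 'n" assume "p \<in> {p. p permutes UNIV}"
    then have "sign (?c p) = sign p" by (simp add: sign_copy)
    moreover have "(\<Prod>i\<in>UNIV. M $ of_copy i $ p (of_copy i)) = (\<Prod>i\<in>UNIV. M $ i $ p i)"
      by (rule prod.reindex_bij_betw[OF bij_of_copy])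
    ultimately show "of_int (sign (?c p)) * (\<Prod>i\<in>UNIV. M $ of_copy i $ of_copy (?c p i))
        = of_int (sign p) * (\<Prod>i\<in>UNIV. M $ i $ p i)" by simp
  qed
  finally show ?thesis .
qed

text \<open>The formula for absolutely integrable functions says that one side has the finite value
  \<open>b\<close> exactly when the other side does. For nonnegative integrands this determines both
  sides, since neither can be infinite while the other is finite.\<close>

lemma nn_integral_change_of_variables_wellorder:
  fixes g :: "real^'m::{finite,wellorder} \<Rightarrow> real^'m::_" and f :: "real^'m::_ \<Rightarrow> real"
  assumes S: "S \<in> sets borel"
    and der: "\<And>x. x \<in> S \<Longrightarrow> (g has_derivative g' x) (at x)" and inj: "inj_on g S"
    and nonneg: "\<And>y. 0 \<le> f y"
    and m1: "(\<lambda>y. indicator (g ` S) y * f y) \<in> borel_measurable borel"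
    and m2: "(\<lambda>x. indicator S x * (\<bar>det (matrix (g' x))\<bar> * f (g x))) \<in> borel_measurable borel"
  shows "(\<integral>\<^sup>+y. ennreal (indicator (g ` S) y * f y) \<partial>lborel)
    = (\<integral>\<^sup>+x. ennreal (indicator S x * (\<bar>det (matrix (g' x))\<bar> * f (g x))) \<partial>lborel)" (is "?l = ?r")
proof -
  let ?D = "\<lambda>x. \<bar>det (matrix (g' x))\<bar> * f (g x)"
  have abs: "?D absolutely_integrable_on S \<and> integral S ?D = b
      \<longleftrightarrow> f absolutely_integrable_on (g ` S) \<and> integral (g ` S) f = b" for b
  proof -
    \<comment> \<open>One-dimensional vectors carry the real integrand through a formula stated for
      vector values.\<close>
    have "(\<lambda>x. \<bar>det (matrix (g' x))\<bar> *\<^sub>R (vec (f (g x)) :: real^1)) absolutely_integrable_on S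
        \<and> integral S (\<lambda>x. \<bar>det (matrix (g' x))\<bar> *\<^sub>R (vec (f (g x)) :: real^1)) = vec b
      \<longleftrightarrow> (\<lambda>x. vec (f x) :: real^1) absolutely_integrable_on (g ` S)
        \<and> integral (g ` S) (\<lambda>x. vec (f x) :: real^1) = vec b"
      using S der inj
      by (intro has_absolute_integral_change_of_variables) (auto intro: has_derivative_at_withinI)
    then show ?thesis
      by (simp add: absolutely_integrable_on_1_iff integral_on_1_eq)
  qed
  have conv: "(\<integral>\<^sup>+x. ennreal (indicator T x * h x) \<partial>lborel) = ennreal b
      \<longleftrightarrow> h absolutely_integrable_on T \<and> integral T h = b"
    if m: "(\<lambda>x. indicator T x * h x) \<in> borel_measurable borel" and h0: "\<And>x. 0 \<le> h x" and "0 \<le> b"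
    for T :: "(real^'m::_) set" and h b
  proof -
    have "(\<integral>\<^sup>+x. ennreal (indicator T x * h x) \<partial>lborel) = ennreal b
        \<longleftrightarrow> integrable lborel (\<lambda>x. indicator T x * h x) \<and> integral\<^sup>L lborel (\<lambda>x. indicator T x * h x) = b"
      using m h0 \<open>0 \<le> b\<close> by (intro nn_integral_eq_integrable) auto
    also have "\<dots> \<longleftrightarrow> set_integrable lebesgue T h \<and> set_lebesgue_integral lebesgue T h = b"
      using m by (simp add: set_integrable_def set_lebesgue_integral_def integrable_completion integral_completion)
    also have "\<dots> \<longleftrightarrow> h absolutely_integrable_on T \<and> integral T h = b"
      using set_lebesgue_integral_eq_integral(2)[of T h] by auto
    finally show ?thesis .
  qed
  have iff: "?l = ennreal b \<longleftrightarrow> ?r = ennreal b" if "0 \<le> b" for b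
    using conv[OF m1 nonneg that] conv[OF m2 _ that] abs[of b] nonneg by simp
  show ?thesis
  proof (cases "?l")
    case (real b)
    then show ?thesis using iff[of b] by simp
  next
    case top
    then show ?thesis using iff by (cases "?r") auto
  qed
qed

text \<open>Both integrals are transported to the relabelled space: Lebesgue measure is preserved by
  \<open>distr_from_copy\<close>, and the Jacobian determinant by \<open>det_copy\<close>.\<close>

lemma nn_integral_change_of_variables:
  fixes g :: "real^'n \<Rightarrow> real^'n" and f :: "real^'n \<Rightarrow> real"
  assumes S: "S \<in> sets borel"
    and der: "\<And>x. x \<in> S \<Longrightarrow> (g has_derivative g' x) (at x)" and inj: "inj_on g S"
    and nonneg: "\<And>y. 0 \<le> f y"
    and m1: "(\<lambda>y. indicator (g ` S) y * f y) \<in> borel_measurable borel"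
    and m2: "(\<lambda>x. indicator S x * (\<bar>det (matrix (g' x))\<bar> * f (g x))) \<in> borel_measurable borel"
  shows "(\<integral>\<^sup>+y. ennreal (indicator (g ` S) y * f y) \<partial>lborel)
    = (\<integral>\<^sup>+x. ennreal (indicator S x * (\<bar>det (matrix (g' x))\<bar> * f (g x))) \<partial>lborel)" (is "?l = ?r")
proof -
  let ?S = "into_copy ` S" and ?g = "\<lambda>x. into_copy (g (from_copy x))" and ?f = "\<lambda>y. f (from_copy y)"
    and ?g' = "\<lambda>x v. into_copy (g' (from_copy x) (from_copy v))"
  have mem: "x \<in> into_copy ` T \<longleftrightarrow> from_copy x \<in> T" for x :: "real^'n ordered_copy" and T
    by (metis (no_types, lifting) from_into_copy image_iff into_from_copy)
  have ind: "indicator (into_copy ` T) x = (indicator T (from_copy x) :: real)"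
    for x :: "real^'n ordered_copy" and T by (simp add: indicator_def mem)
  have gS: "?g ` ?S = into_copy ` g ` S" by (auto simp: image_image)
  have det: "det (matrix (?g' x)) = det (matrix (g' (from_copy x)))" for x
  proof -
    have ax: "from_copy (axis b 1) = axis (of_copy b) 1" for b :: "'n ordered_copy"
      by (auto simp: from_copy_def axis_def vec_eq_iff)
    have "matrix (?g' x) = (\<chi> a b. matrix (g' (from_copy x)) $ of_copy a $ of_copy b)"
      by (simp add: matrix_def vec_eq_iff ax) (simp add: into_copy_def)
    then show ?thesis by (simp add: det_copy)
  qed
  have "?l = (\<integral>\<^sup>+y. ennreal (indicator (g ` S) y * f y) \<partial>distr lborel borel from_copy)"
    by (simp add: distr_from_copy)
  also have "\<dots> = (\<integral>\<^sup>+y. ennreal (indicator (g ` S) (from_copy y) * f (from_copy y)) \<partial>lborel)"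
    by (rule nn_integral_distr) (use m1 measurable_from_copy in auto)
  also have "\<dots> = (\<integral>\<^sup>+y. ennreal (indicator (?g ` ?S) y * ?f y) \<partial>lborel)"
    unfolding gS by (simp add: ind)
  also have "\<dots> = (\<integral>\<^sup>+x. ennreal (indicator ?S x * (\<bar>det (matrix (?g' x))\<bar> * ?f (?g x))) \<partial>lborel)"
  proof (rule nn_integral_change_of_variables_wellorder)
    have "?S = from_copy -` S" using mem by auto
    then show "?S \<in> sets borel" using measurable_sets[OF measurable_from_copy S] by simp
    show "(?g has_derivative ?g' x) (at x)" if "x \<in> ?S" for x
    proof -
      have "(from_copy has_derivative from_copy) (at x)"
        by (simp add: bounded_linear_imp_has_derivative bounded_linear_from_copy)
      from has_derivative_compose[OF this der] that
      have "((\<lambda>x. g (from_copy x)) has_derivative (\<lambda>v. g' (from_copy x) (from_copy v))) (at x)"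
        by (simp add: mem)
      then show ?thesis by (rule bounded_linear.has_derivative[OF bounded_linear_into_copy])
    qed
    show "inj_on ?g ?S"
    proof (rule inj_onI)
      fix x y assume xy: "x \<in> ?S" "y \<in> ?S" "?g x = ?g y"
      then have "g (from_copy x) = g (from_copy y)" by (metis from_into_copy)
      then have "from_copy x = from_copy y" using inj_onD[OF inj] xy by (simp add: mem)
      then show "x = y" by (metis into_from_copy)
    qed
    show "(\<lambda>y. indicator (?g ` ?S) y * ?f y) \<in> borel_measurable borel"
      unfolding gS ind using measurable_compose[OF measurable_from_copy m1] by simp
    show "(\<lambda>x. indicator ?S x * (\<bar>det (matrix (?g' x))\<bar> * ?f (?g x))) \<in> borel_measurable borel"
      unfolding det ind using measurable_compose[OF measurable_from_copy m2] by simp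
  qed (use nonneg in auto)
  also have "\<dots> = (\<integral>\<^sup>+x. ennreal (indicator S (from_copy x)
      * (\<bar>det (matrix (g' (from_copy x)))\<bar> * f (g (from_copy x)))) \<partial>lborel)"
    by (simp add: det ind)
  also have "\<dots> = (\<integral>\<^sup>+x. ennreal (indicator S x * (\<bar>det (matrix (g' x))\<bar> * f (g x)))
      \<partial>distr lborel borel from_copy)"
    by (rule nn_integral_distr[symmetric]) (use m2 measurable_from_copy in auto)
  also have "\<dots> = ?r" by (simp add: distr_from_copy)
  finally show ?thesis .
qed

section \<open>Partial derivatives\<close>

lemma has_derivative_frechet:
  "f differentiable (at x) \<Longrightarrow> (f has_derivative frechet_derivative f (at x)) (at x)"
  by (simp add: frechet_derivative_works)

lemma partial_deriv_const [simp]: "partial_deriv i (\<lambda>y. c) x = 0"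
  by (rule has_derivative_partial[OF has_derivative_const])

lemma partial_deriv_add:
  assumes "f differentiable (at x)" "g differentiable (at x)"
  shows "partial_deriv i (\<lambda>y. f y + g y) x = partial_deriv i f x + partial_deriv i g x"
  using has_derivative_partial[OF has_derivative_add[OF assms[THEN has_derivative_frechet]]]
  by (simp add: partial_deriv_def)

lemma partial_deriv_diff:
  assumes "f differentiable (at x)" "g differentiable (at x)"
  shows "partial_deriv i (\<lambda>y. f y - g y) x = partial_deriv i f x - partial_deriv i g x"
  using has_derivative_partial[OF has_derivative_diff[OF assms[THEN has_derivative_frechet]]]
  by (simp add: partial_deriv_def)

lemma partial_deriv_bounded_linear:
  assumes "bounded_linear L" "f differentiable (at x)"
  shows "partial_deriv i (\<lambda>y. L (f y)) x = L (partial_deriv i f x)"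
  using has_derivative_partial[OF bounded_linear.has_derivative[OF assms(1) has_derivative_frechet[OF assms(2)]]]
  by (simp add: partial_deriv_def)

lemma partial_deriv_mult:
  fixes f g :: "real^'n \<Rightarrow> real"
  assumes "f differentiable (at x)" "g differentiable (at x)"
  shows "partial_deriv i (\<lambda>y. f y * g y) x = f x * partial_deriv i g x + partial_deriv i f x * g x"
  using has_derivative_partial[OF has_derivative_mult[OF assms[THEN has_derivative_frechet]]]
  by (simp add: partial_deriv_def)

lemma partial_deriv_chain_real:
  fixes f :: "real^'n \<Rightarrow> real"
  assumes "f differentiable (at x)" "(h has_real_derivative h') (at (f x))"
  shows "partial_deriv i (\<lambda>y. h (f y)) x = h' * partial_deriv i f x"
  using has_derivative_partial[OF has_derivative_compose[OF has_derivative_frechet[OF assms(1)]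
        assms(2)[unfolded has_field_derivative_def]]]
  by (simp add: partial_deriv_def)

lemma differentiable_mult_real:
  fixes f g :: "'e::real_normed_vector \<Rightarrow> real"
  shows "f differentiable (at x) \<Longrightarrow> g differentiable (at x) \<Longrightarrow> (\<lambda>y. f y * g y) differentiable (at x)"
  by simp

lemma differentiable_chain_real:
  fixes f :: "'e::real_normed_vector \<Rightarrow> real"
  assumes "f differentiable (at x)" "(h has_real_derivative h') (at (f x))"
  shows "(\<lambda>y. h (f y)) differentiable (at x)"
  using has_derivative_compose[OF has_derivative_frechet[OF assms(1)] assms(2)[unfolded has_field_derivative_def]]
  by (auto simp: differentiable_def)

lemma partial_deriv_chain:
  fixes f :: "real^'m \<Rightarrow> real" and \<tau> :: "real^'n \<Rightarrow> real^'m"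
  assumes "\<tau> differentiable (at x)" "f differentiable (at (\<tau> x))"
  shows "partial_deriv i (\<lambda>y. f (\<tau> y)) x
    = (\<Sum>j\<in>UNIV. partial_deriv i \<tau> x $ j * partial_deriv j f (\<tau> x))"
  using has_derivative_partial[OF has_derivative_compose[OF assms[THEN has_derivative_frechet]], of i]
    frechet_derivative_partial[OF assms(2), of "partial_deriv i \<tau> x"]
  by (simp add: partial_deriv_def)

lemma has_real_derivative_line:
  fixes f :: "real^'n \<Rightarrow> real"
  assumes "f differentiable (at (x + t *\<^sub>R v))"
  shows "((\<lambda>t. f (x + t *\<^sub>R v)) has_real_derivative frechet_derivative f (at (x + t *\<^sub>R v)) v) (at t)"
proof -
  have "((\<lambda>t. x + t *\<^sub>R v) has_derivative (\<lambda>s. s *\<^sub>R v)) (at t)"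
    by (auto intro!: derivative_eq_intros)
  from has_derivative_compose[OF this has_derivative_frechet[OF assms]]
  have "((\<lambda>t. f (x + t *\<^sub>R v)) has_derivative (\<lambda>s. frechet_derivative f (at (x + t *\<^sub>R v)) (s *\<^sub>R v))) (at t)" .
  moreover have "linear (frechet_derivative f (at (x + t *\<^sub>R v)))"
    by (rule has_derivative_linear[OF has_derivative_frechet[OF assms]])
  ultimately show ?thesis
    by (simp add: has_field_derivative_def linear_cmul mult_commute_abs)
qed


section \<open>Families whose derivatives in the parameter and in space commute\<close>

text \<open>The last clause is the interchange of the derivative in \<open>t\<close> with the
  partial derivatives in space. The families are differentiable curves rather than jointly smooth
  maps, so the interchange is carried along as a property that survives the algebraic operations
  building the coefficients of the Laplacian.\<close>

definition mixed_deriv :: "(real^'n) set \<Rightarrow> (real \<Rightarrow> real^'n \<Rightarrow> real) \<Rightarrow> (real^'n \<Rightarrow> real) \<Rightarrow> bool"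
  where "mixed_deriv S F F' \<longleftrightarrow> open S \<and> (\<forall>y\<in>S. (\<forall>\<^sub>F t in nhds 0. F t differentiable (at y)) \<and>
    F' differentiable (at y) \<and> ((\<lambda>t. F t y) has_real_derivative F' y) (at 0) \<and>
    (\<forall>i. ((\<lambda>t. partial_deriv i (F t) y) has_real_derivative partial_deriv i F' y) (at 0)))"

lemma mixed_derivD:
  assumes "mixed_deriv S F F'" "y \<in> S"
  shows "\<forall>\<^sub>F t in nhds 0. F t differentiable (at y)" "F 0 differentiable (at y)"
    "F' differentiable (at y)" "((\<lambda>t. F t y) has_real_derivative F' y) (at 0)"
    "((\<lambda>t. partial_deriv i (F t) y) has_real_derivative partial_deriv i F' y) (at 0)"
  using assms eventually_nhds_x_imp_x unfolding mixed_deriv_def by blast+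

text \<open>Separates the two tasks: the closure rules prove the interchange for some derivative,
  and a pointwise computation in \<open>t\<close> then says which derivative it is.\<close>

lemma mixed_deriv_unique:
  assumes "mixed_deriv S F F'" "\<And>y. y \<in> S \<Longrightarrow> ((\<lambda>t. F t y) has_real_derivative F'' y) (at 0)"
  shows "mixed_deriv S F F''"
proof -
  have eq: "F' y = F'' y" if "y \<in> S" for y
    using mixed_derivD(4)[OF assms(1) that] assms(2)[OF that] DERIV_unique by blast
  have S: "open S" using assms(1) by (simp add: mixed_deriv_def)
  have "F'' differentiable (at y)" "partial_deriv i F'' y = partial_deriv i F' y" if "y \<in> S" for y i
  proof -
    show "partial_deriv i F'' y = partial_deriv i F' y"
      using partial_deriv_cong[OF S that] eq by metis
    show "F'' differentiable (at y)"
      using has_derivative_transform_within_open[OF has_derivative_frechet[OF mixed_derivD(3)[OF assms(1) that]] S that]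
        eq by (auto simp: differentiable_def)
  qed
  then show ?thesis using assms unfolding mixed_deriv_def by metis
qed

lemma mixed_deriv_const:
  assumes "open S" "\<And>y. y \<in> S \<Longrightarrow> f differentiable (at y)"
  shows "mixed_deriv S (\<lambda>t. f) (\<lambda>y. 0)"
  using assms unfolding mixed_deriv_def by simp

lemma mixed_deriv_add:
  assumes "mixed_deriv S F F'" "mixed_deriv S G G'"
  shows "mixed_deriv S (\<lambda>t y. F t y + G t y) (\<lambda>y. F' y + G' y)"
  unfolding mixed_deriv_def
proof (intro conjI ballI allI)
  show "open S" using assms(1) by (simp add: mixed_deriv_def)
  fix y i assume y: "y \<in> S"
  note F = mixed_derivD[OF assms(1) y] and G = mixed_derivD[OF assms(2) y]
  show "\<forall>\<^sub>F t in nhds 0. (\<lambda>y. F t y + G t y) differentiable (at y)"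
    using F(1) G(1) by eventually_elim (rule differentiable_add)
  show "(\<lambda>y. F' y + G' y) differentiable (at y)" using F(3) G(3) by (rule differentiable_add)
  show "((\<lambda>t. F t y + G t y) has_real_derivative F' y + G' y) (at 0)"
    using F(4) G(4) by (rule DERIV_add)
  have "\<forall>\<^sub>F t in nhds 0. partial_deriv i (\<lambda>y. F t y + G t y) y = partial_deriv i (F t) y + partial_deriv i (G t) y"
    using F(1) G(1) by eventually_elim (rule partial_deriv_add)
  then show "((\<lambda>t. partial_deriv i (\<lambda>y. F t y + G t y) y) has_real_derivative
      partial_deriv i (\<lambda>y. F' y + G' y) y) (at 0)"
    using DERIV_add[OF F(5) G(5), of i i] partial_deriv_add[OF F(3) G(3)]
    by (subst DERIV_cong_ev[OF refl _ refl]) simp_all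
qed

lemma mixed_deriv_mult:
  assumes "mixed_deriv S F F'" "mixed_deriv S G G'"
  shows "mixed_deriv S (\<lambda>t y. F t y * G t y) (\<lambda>y. F' y * G 0 y + F 0 y * G' y)"
  unfolding mixed_deriv_def
proof (intro conjI ballI allI)
  show "open S" using assms(1) by (simp add: mixed_deriv_def)
  fix y i assume y: "y \<in> S"
  note F = mixed_derivD[OF assms(1) y] and G = mixed_derivD[OF assms(2) y]
  show "\<forall>\<^sub>F t in nhds 0. (\<lambda>y. F t y * G t y) differentiable (at y)"
    using F(1) G(1) by eventually_elim (rule differentiable_mult_real)
  show "(\<lambda>y. F' y * G 0 y + F 0 y * G' y) differentiable (at y)"
    by (intro differentiable_add differentiable_mult_real F G)
  show "((\<lambda>t. F t y * G t y) has_real_derivative F' y * G 0 y + F 0 y * G' y) (at 0)"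
    using DERIV_mult[OF F(4) G(4)] by (simp add: mult.commute)
  have ev: "\<forall>\<^sub>F t in nhds 0. partial_deriv i (\<lambda>y. F t y * G t y) y
      = F t y * partial_deriv i (G t) y + partial_deriv i (F t) y * G t y"
    using F(1) G(1) by eventually_elim (rule partial_deriv_mult)
  have "((\<lambda>t. F t y * partial_deriv i (G t) y + partial_deriv i (F t) y * G t y) has_real_derivative
      partial_deriv i (\<lambda>y. F' y * G 0 y + F 0 y * G' y) y) (at 0)"
    using DERIV_add[OF DERIV_mult[OF F(4) G(5)[of i]] DERIV_mult[OF F(5)[of i] G(4)]]
    by (simp add: partial_deriv_add partial_deriv_mult differentiable_mult_real F G algebra_simps)
  then show "((\<lambda>t. partial_deriv i (\<lambda>y. F t y * G t y) y) has_real_derivative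
      partial_deriv i (\<lambda>y. F' y * G 0 y + F 0 y * G' y) y) (at 0)"
    using ev by (subst DERIV_cong_ev[OF refl _ refl])
qed

text \<open>Two derivatives of \<open>h\<close> are needed, because the partial derivative
  \<open>h' (F t y) * partial_deriv i (F t) y\<close> is itself differentiated in
  \<open>t\<close>.\<close>

lemma mixed_deriv_compose:
  assumes F: "mixed_deriv S F F'" and T: "open T" "\<And>y. y \<in> S \<Longrightarrow> F 0 y \<in> T"
    and h: "\<And>s. s \<in> T \<Longrightarrow> (h has_real_derivative h' s) (at s)"
    and h': "\<And>s. s \<in> T \<Longrightarrow> (h' has_real_derivative h'' s) (at s)"
  shows "mixed_deriv S (\<lambda>t y. h (F t y)) (\<lambda>y. h' (F 0 y) * F' y)"
  unfolding mixed_deriv_def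
proof (intro conjI ballI allI)
  show "open S" using assms(1) by (simp add: mixed_deriv_def)
  fix y i assume y: "y \<in> S"
  note F = mixed_derivD[OF assms(1) y] and y0 = T(2)[OF y]
  \<comment> \<open>Continuity in \<open>t\<close> keeps \<open>F t y\<close> in the open set
    \<open>T\<close> for small \<open>t\<close>, where \<open>h\<close> may be
    differentiated.\<close>
  have "isCont (\<lambda>t. F t y) 0" using F(4) by (rule DERIV_isCont)
  then have "((\<lambda>t. F t y) \<longlongrightarrow> F 0 y) (nhds 0)"
    by (metis continuous_at tendsto_at_iff_tendsto_nhds)
  then have FT: "\<forall>\<^sub>F t in nhds 0. F t y \<in> T" using T(1) y0 by (rule topological_tendstoD)
  show "\<forall>\<^sub>F t in nhds 0. (\<lambda>y. h (F t y)) differentiable (at y)"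
    using F(1) FT by eventually_elim (rule differentiable_chain_real[OF _ h])
  have d': "(\<lambda>y. h' (F 0 y)) differentiable (at y)" by (rule differentiable_chain_real[OF F(2) h'[OF y0]])
  show "(\<lambda>y. h' (F 0 y) * F' y) differentiable (at y)"
    by (intro differentiable_mult_real d' F)
  show "((\<lambda>t. h (F t y)) has_real_derivative h' (F 0 y) * F' y) (at 0)"
    by (rule DERIV_chain2[OF h[OF y0] F(4)])
  have ev: "\<forall>\<^sub>F t in nhds 0. partial_deriv i (\<lambda>y. h (F t y)) y = h' (F t y) * partial_deriv i (F t) y"
    using F(1) FT by eventually_elim (rule partial_deriv_chain_real[OF _ h])
  have "((\<lambda>t. h' (F t y) * partial_deriv i (F t) y) has_real_derivative
      partial_deriv i (\<lambda>y. h' (F 0 y) * F' y) y) (at 0)"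
    using DERIV_mult[OF DERIV_chain2[OF h'[OF y0] F(4)] F(5)[of i]]
    by (simp add: partial_deriv_mult d' F partial_deriv_chain_real[OF F(2) h'[OF y0]] algebra_simps)
  then show "((\<lambda>t. partial_deriv i (\<lambda>y. h (F t y)) y) has_real_derivative
      partial_deriv i (\<lambda>y. h' (F 0 y) * F' y) y) (at 0)"
    using ev by (subst DERIV_cong_ev[OF refl _ refl])
qed

text \<open>Hiding the derivative lets the closure rules below be chained mechanically; its value is
  recovered by \<open>mixed_deriv_unique\<close>.\<close>

definition mixed :: "(real^'n) set \<Rightarrow> (real \<Rightarrow> real^'n \<Rightarrow> real) \<Rightarrow> bool"
  where "mixed S F \<longleftrightarrow> (\<exists>F'. mixed_deriv S F F')"

lemma mixed_const: "open S \<Longrightarrow> (\<And>y. y \<in> S \<Longrightarrow> f differentiable (at y)) \<Longrightarrow> mixed S (\<lambda>t. f)"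
  unfolding mixed_def using mixed_deriv_const by blast

lemma mixed_add: "mixed S F \<Longrightarrow> mixed S G \<Longrightarrow> mixed S (\<lambda>t y. F t y + G t y)"
  unfolding mixed_def using mixed_deriv_add by blast

lemma mixed_mult: "mixed S F \<Longrightarrow> mixed S G \<Longrightarrow> mixed S (\<lambda>t y. F t y * G t y)"
  unfolding mixed_def using mixed_deriv_mult by blast

lemma mixed_sum:
  assumes "open S" "\<And>k. k \<in> K \<Longrightarrow> mixed S (F k)"
  shows "mixed S (\<lambda>t y. \<Sum>k\<in>K. F k t y)"
  using assms(2)
proof (induction K rule: infinite_finite_induct)
  case (insert k K)
  then show ?case using mixed_add[of S "F k" "\<lambda>t y. \<Sum>k\<in>K. F k t y"] by simp
qed (simp_all add: mixed_const assms(1))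

lemma mixed_prod:
  assumes "open S" "\<And>k. k \<in> K \<Longrightarrow> mixed S (F k)"
  shows "mixed S (\<lambda>t y. \<Prod>k\<in>K. F k t y)"
  using assms(2)
proof (induction K rule: infinite_finite_induct)
  case (insert k K)
  then show ?case using mixed_mult[of S "F k" "\<lambda>t y. \<Prod>k\<in>K. F k t y"] by simp
qed (simp_all add: mixed_const assms(1))

lemma mixed_inverse:
  assumes "mixed S F" "\<And>y. y \<in> S \<Longrightarrow> F 0 y \<noteq> 0"
  shows "mixed S (\<lambda>t y. inverse (F t y))"
proof -
  obtain F' where F': "mixed_deriv S F F'" using assms(1) by (auto simp: mixed_def)
  have "mixed_deriv S (\<lambda>t y. inverse (F t y)) (\<lambda>y. - (inverse (F 0 y) ^ 2) * F' y)"
  proof (rule mixed_deriv_compose[OF F', where T = "- {0}" and h' = "\<lambda>s. - (inverse s ^ 2)"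
        and h'' = "\<lambda>s. 2 * inverse s ^ 3"])
    fix s :: real assume "s \<in> - {0}"
    then show "(inverse has_real_derivative - (inverse s ^ 2)) (at s)"
      "((\<lambda>s. - (inverse s ^ 2)) has_real_derivative 2 * inverse s ^ 3) (at s)"
      by (auto intro!: derivative_eq_intros simp: power2_eq_square power3_eq_cube)
  qed (use assms(2) in auto)
  then show ?thesis by (auto simp: mixed_def)
qed

lemma mixed_divide:
  assumes "mixed S F" "mixed S G" "\<And>y. y \<in> S \<Longrightarrow> G 0 y \<noteq> 0"
  shows "mixed S (\<lambda>t y. F t y / G t y)"
  unfolding divide_inverse by (intro mixed_mult mixed_inverse assms)

lemma mixed_sqrt:
  assumes "mixed S F" "\<And>y. y \<in> S \<Longrightarrow> F 0 y > 0"
  shows "mixed S (\<lambda>t y. sqrt (F t y))"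
proof -
  obtain F' where F': "mixed_deriv S F F'" using assms(1) by (auto simp: mixed_def)
  have "mixed_deriv S (\<lambda>t y. sqrt (F t y)) (\<lambda>y. inverse (sqrt (F 0 y)) / 2 * F' y)"
  proof (rule mixed_deriv_compose[OF F', where T = "{0<..}" and h' = "\<lambda>s. inverse (sqrt s) / 2"
        and h'' = "\<lambda>s. - (inverse (sqrt s) * (inverse (sqrt s) / 2) * inverse (sqrt s)) / 2"])
    fix s :: real assume s: "s \<in> {0<..}"
    then show "(sqrt has_real_derivative inverse (sqrt s) / 2) (at s)"
      by (auto intro: DERIV_real_sqrt)
    from DERIV_cdivide[OF DERIV_inverse'[OF this], of 2] s
    show "((\<lambda>s. inverse (sqrt s) / 2) has_real_derivative
        - (inverse (sqrt s) * (inverse (sqrt s) / 2) * inverse (sqrt s)) / 2) (at s)"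
      by simp
  qed (use assms(2) in auto)
  then show ?thesis by (auto simp: mixed_def)
qed

lemma mixed_det:
  fixes F :: "real \<Rightarrow> real^'n \<Rightarrow> real^'m^'m"
  assumes "open S" "\<And>i j. mixed S (\<lambda>t y. F t y $ i $ j)"
  shows "mixed S (\<lambda>t y. det (F t y))"
  unfolding det_def
  by (intro mixed_sum mixed_mult mixed_prod mixed_const assms) auto


section \<open>Integration by parts in Euclidean space\<close>

text \<open>Translation invariance of Lebesgue measure makes the integral of every difference
  quotient zero, and dominated convergence passes to the derivative. No iterated integration is
  involved.\<close>

lemma integral_partial_deriv_zero:
  fixes w :: "real^'n \<Rightarrow> real"
  assumes w: "C1_on UNIV w" and K: "compact K" "\<And>x. x \<notin> K \<Longrightarrow> w x = 0"
  shows "integrable lborel (partial_deriv i w)" "(LINT x|lborel. partial_deriv i w x) = 0"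
proof -
  let ?D = "partial_deriv i w" and ?e = "axis i 1 :: real^'n"
  have contw: "continuous_on UNIV w" and contD: "continuous_on UNIV ?D"
    using C1_on_continuous[OF w] C1_on_partial_deriv[OF w] .
  have D0: "?D x = 0" if "x \<notin> K" for x
    using partial_deriv_cong[of "- K" x w "\<lambda>_. 0" i] K that by (simp add: compact_imp_closed open_Compl)
  have int: "integrable lborel f" if "continuous_on UNIV f" "\<And>x. x \<notin> K \<Longrightarrow> f x = 0"
    for f :: "real^'n \<Rightarrow> real"
  proof -
    have "f = (\<lambda>x. indicator K x *\<^sub>R f x)" using that(2) by (auto simp: indicator_def fun_eq_iff)
    moreover have "integrable lborel (\<lambda>x. indicator K x *\<^sub>R f x)"
      using K(1) that(1) by (intro borel_integrable_compact continuous_on_subset[OF that(1)]) auto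
    ultimately show ?thesis by simp
  qed
  show "integrable lborel ?D" by (rule int[OF contD D0])
  have "bounded (?D ` K)"
    by (intro compact_imp_bounded compact_continuous_image K continuous_on_subset[OF contD]) auto
  then obtain B0 where "\<forall>z\<in>?D ` K. norm z \<le> B0" unfolding bounded_iff by blast
  then have B: "\<bar>?D x\<bar> \<le> max B0 0" for x using D0[of x] by (cases "x \<in> K") auto
  obtain R where R: "\<And>x. x \<in> K \<Longrightarrow> norm x \<le> R"
    using compact_imp_bounded[OF K(1)] unfolding bounded_iff by blast
  define h where "h k = inverse (real (Suc k))" for k
  have h: "h k > 0" "h k \<le> 1" for k by (auto simp: h_def inverse_le_1_iff)
  have h0: "h \<longlonglongrightarrow> 0" unfolding h_def by (rule LIMSEQ_inverse_real_of_nat)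
  define q where "q k x = (w (x + h k *\<^sub>R ?e) - w x) / h k" for k x
  have line: "((\<lambda>t. w (x + t *\<^sub>R ?e)) has_real_derivative ?D (x + t *\<^sub>R ?e)) (at t)" for x t
    using has_real_derivative_line[OF C1_on_differentiable[OF w]] by (simp add: partial_deriv_def)
  \<comment> \<open>The mean value theorem bounds the quotient by a bound of the derivative. Since
    \<open>h k \<le> 1\<close>, the quotient vanishes outside the ball of radius
    \<open>R + 1\<close>.\<close>
  have q_bound: "\<bar>q k x\<bar> \<le> max B0 0 * indicator (cball 0 (R + 1)) x" for k x
  proof (cases "x \<in> cball 0 (R + 1)")
    case True
    have "\<exists>z. 0 < z \<and> z < h k \<and> w (x + h k *\<^sub>R ?e) - w (x + 0 *\<^sub>R ?e) = (h k - 0) * ?D (x + z *\<^sub>R ?e)"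
      by (rule MVT2[OF h(1)]) (rule line)
    then obtain z where "w (x + h k *\<^sub>R ?e) - w x = h k * ?D (x + z *\<^sub>R ?e)" by auto
    then have "q k x = ?D (x + z *\<^sub>R ?e)" using h(1)[of k] by (simp add: q_def)
    then show ?thesis using B True by simp
  next
    case False
    have n: "norm (h k *\<^sub>R ?e) \<le> 1" using h[of k] by simp
    have "x \<notin> K" using False R[of x] by auto
    moreover have "x + h k *\<^sub>R ?e \<notin> K"
    proof
      assume "x + h k *\<^sub>R ?e \<in> K"
      then have "norm (x + h k *\<^sub>R ?e) \<le> R" by (rule R)
      moreover have "norm x \<le> norm (x + h k *\<^sub>R ?e) + norm (h k *\<^sub>R ?e)"
        by (metis add_diff_cancel norm_triangle_ineq4)
      ultimately show False using False n by simp
    qed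
    ultimately show ?thesis using K(2) False by (simp add: q_def)
  qed
  have "(\<lambda>k. LINT x|lborel. q k x) \<longlonglongrightarrow> (LINT x|lborel. ?D x)"
  proof (rule integral_dominated_convergence)
    show "?D \<in> borel_measurable lborel" using contD by (simp add: borel_measurable_continuous_onI)
    show "q k \<in> borel_measurable lborel" for k
      unfolding q_def
      by (simp, intro borel_measurable_continuous_onI continuous_intros continuous_on_compose2[OF contw])
        (use h(1)[of k] in auto)
    show "integrable lborel (\<lambda>x. max B0 0 * indicator (cball 0 (R + 1)) x :: real)"
      by (intro integrable_mult_right integrable_real_indicator) (use emeasure_bounded_finite[OF bounded_cball] in auto)
    show "AE x in lborel. (\<lambda>k. q k x) \<longlonglongrightarrow> ?D x"
    proof (rule AE_I2)
      fix x
      have "(\<lambda>t. (w (x + t *\<^sub>R ?e) - w x) / t) \<midarrow>0\<rightarrow> ?D x"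
        using line[of x 0] by (simp add: DERIV_def)
      moreover have "filterlim h (at 0) sequentially"
        using h0 h(1) by (auto simp: filterlim_at less_imp_neq[OF h(1)] intro!: always_eventually) (metis h(1) less_irrefl)
      ultimately show "(\<lambda>k. q k x) \<longlonglongrightarrow> ?D x"
        unfolding q_def by (rule filterlim_compose)
    qed
    show "AE x in lborel. norm (q k x) \<le> max B0 0 * indicator (cball 0 (R + 1)) x" for k
      using q_bound by simp
  qed
  moreover have "(LINT x|lborel. q k x) = 0" for k
  proof -
    have iw: "integrable lborel w" by (rule int[OF contw K(2)])
    have mw: "w \<in> borel_measurable borel" using contw by (rule borel_measurable_continuous_onI)
    have d: "distr lborel borel ((+) (h k *\<^sub>R ?e)) = lborel" by (rule lborel_distr_plus)
    have "(LINT x|lborel. w x) = (LINT x|distr lborel borel ((+) (h k *\<^sub>R ?e)). w x)" by (simp add: d)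
    also have "\<dots> = (LINT x|lborel. w (h k *\<^sub>R ?e + x))" using mw by (intro integral_distr) auto
    finally have eq: "(LINT x|lborel. w (x + h k *\<^sub>R ?e)) = (LINT x|lborel. w x)" by (simp add: add.commute)
    have "integrable (distr lborel borel ((+) (h k *\<^sub>R ?e))) w" using iw by (simp add: d)
    then have "integrable lborel (\<lambda>x. w (h k *\<^sub>R ?e + x))" using mw by (subst (asm) integrable_distr_eq) auto
    then have "integrable lborel (\<lambda>x. w (x + h k *\<^sub>R ?e))" by (simp add: add.commute)
    then show ?thesis using iw eq by (simp add: q_def)
  qed
  ultimately have "(\<lambda>k. 0) \<longlonglongrightarrow> (LINT x|lborel. ?D x)" by simp
  then show "(LINT x|lborel. ?D x) = 0" using LIMSEQ_unique tendsto_const by blast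
qed

section \<open>Bump functions of class C1 from squared positive parts\<close>

lemma DERIV_max_zero_square: "((\<lambda>s::real. (max 0 s)\<^sup>2) has_real_derivative 2 * max 0 s) (at s)"
proof (cases s "0 :: real" rule: linorder_cases)
  case less
  have "((\<lambda>s. 0) has_real_derivative 2 * max 0 s) (at s)" using less by auto
  moreover have "\<forall>\<^sub>F x in nhds s. (0::real) = (max 0 x)\<^sup>2"
    by (rule eventually_mono[OF eventually_nhds_in_open[of "{..<0}" s]]) (use less in auto)
  ultimately show ?thesis by (subst DERIV_cong_ev[OF refl _ refl, symmetric])
next
  case equal
  have "(max 0 z)\<^sup>2 = max 0 z * z" for z :: real by (auto simp: max_def power2_eq_square)
  moreover have "isCont (\<lambda>z::real. max 0 z) 0" by (intro continuous_intros)
  ultimately show ?thesis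
    unfolding CARAT_DERIV equal by (intro exI[of _ "\<lambda>z. max 0 z"]) simp
next
  case greater
  have "((\<lambda>s. s\<^sup>2) has_real_derivative 2 * max 0 s) (at s)"
    using greater by (auto intro!: derivative_eq_intros)
  moreover have "\<forall>\<^sub>F x in nhds s. x\<^sup>2 = (max 0 x)\<^sup>2"
    by (rule eventually_mono[OF eventually_nhds_in_open[of "{0<..}" s]]) (use greater in auto)
  ultimately show ?thesis by (subst DERIV_cong_ev[OF refl _ refl, symmetric])
qed

lemma C1_on_max_zero_square:
  fixes f :: "'e::euclidean_space \<Rightarrow> real"
  assumes "C1_on S f"
  shows "C1_on S (\<lambda>x. (max 0 (f x))\<^sup>2)"
proof (rule C1_on_compose[OF _ assms, where T = UNIV])
  show "C1_on UNIV (\<lambda>s::real. (max 0 s)\<^sup>2)"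
    by (rule C1_on_real[OF _ DERIV_max_zero_square]) (auto intro!: continuous_intros)
qed simp

text \<open>With \<open>s\<close> the squared distance to \<open>p\<close> divided by
  \<open>r^2\<close>, the value is 1 for \<open>s \<le> 1\<close> and 0 for
  \<open>s \<ge> 2\<close>. Class C1 is all that integration by parts asks of it.\<close>

definition bump :: "real^'n \<Rightarrow> real \<Rightarrow> real^'n \<Rightarrow> real"
  where "bump p r y = (max 0 (1 - (max 0 (((y - p) \<bullet> (y - p)) / r\<^sup>2 - 1))\<^sup>2))\<^sup>2"

lemma C1_on_bump:
  assumes "r > 0"
  shows "C1_on UNIV (bump p r)"
  unfolding bump_def
proof (intro C1_on_max_zero_square C1_on_diff C1_on_const)
  have "C1_on UNIV (\<lambda>y. (y - p) \<bullet> (y - p))"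
    by (rule C1_onI[where f' = "\<lambda>y v. 2 * ((y - p) \<bullet> v)"])
      (auto intro!: derivative_eq_intros continuous_intros simp: inner_commute)
  from C1_on_cmult[OF this, of "1 / r\<^sup>2"]
  show "C1_on UNIV (\<lambda>y. (y - p) \<bullet> (y - p) / r\<^sup>2)" by simp
qed auto

lemma bump_inside:
  assumes "r > 0" "y \<in> cball p r"
  shows "bump p r y = 1"
proof -
  have "(y - p) \<bullet> (y - p) \<le> r\<^sup>2"
    using assms by (simp add: power2_norm_eq_inner[symmetric] dist_norm norm_minus_commute)
  then show ?thesis using assms(1) by (simp add: bump_def divide_le_eq)
qed

lemma bump_outside:
  assumes "r > 0" "y \<notin> cball p (2 * r)"
  shows "bump p r y = 0"
proof -
  have "(2 * r)\<^sup>2 \<le> (y - p) \<bullet> (y - p)"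
    unfolding power2_norm_eq_inner[symmetric]
    using assms by (intro power_mono) (auto simp: dist_norm norm_minus_commute)
  then have "4 \<le> (y - p) \<bullet> (y - p) / r\<^sup>2" using assms(1) by (simp add: pos_le_divide_eq power_mult_distrib)
  then have "1 \<le> ((y - p) \<bullet> (y - p) / r\<^sup>2 - 1)\<^sup>2" by (simp add: one_le_power)
  then show ?thesis using \<open>4 \<le> _\<close> by (simp add: bump_def)
qed

lemma bump_nonneg: "0 \<le> bump p r y"
  by (simp add: bump_def)

text \<open>Near a point \<open>x\<close> of the set, \<open>f\<close> increases strictly along
  every direction close to \<open>e\<close>. Seen from \<open>x - e\<close>, the zeros in a small
  closed ball therefore lie at most one on each ray, and a closed set of this shape is negligible.
  This takes the place of the implicit function theorem.\<close>

lemma negligible_regular_zero_set: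
  fixes f :: "real^'n \<Rightarrow> real"
  assumes f: "C1_on S f"
  shows "negligible {x \<in> S. f x = 0 \<and> partial_deriv i f x \<noteq> 0}" (is "negligible ?N")
  unfolding locally_negligible_alt[of ?N]
proof
  fix x assume x: "x \<in> ?N"
  let ?D = "\<lambda>y. frechet_derivative f (at y)"
  \<comment> \<open>Scaling the axis by the partial derivative turns the derivative of
    \<open>f\<close> at \<open>x\<close> along \<open>e\<close> into a nonzero square.\<close>
  define e where "e = partial_deriv i f x *\<^sub>R (axis i 1 :: real^'n)"
  have lin: "linear (?D y)" if "y \<in> S" for y
    by (rule has_derivative_linear[OF has_derivative_frechet[OF C1_on_differentiable[OF f that]]])
  have pos: "?D x e > 0"
    using lin[of x] x by (simp add: e_def linear_cmul partial_deriv_def)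
      (metis not_real_square_gt_zero)
  define m where "m = ?D x e / 2"
  have m: "m > 0" using pos by (simp add: m_def)
  have contD: "isCont (\<lambda>y. ?D y v) x" for v
    using C1_on_frechet_derivative[OF f, of v] x C1_on_open[OF f] by (simp add: continuous_on_eq_continuous_at)
  define B where "B = (\<Sum>j\<in>UNIV. \<bar>?D x (axis j 1)\<bar>) + 1"
  have "\<forall>\<^sub>F y in nhds x. m < ?D y e"
    using order_tendstoD(1)[OF contD[of e, unfolded continuous_at], of m] pos
    by (simp add: m_def eventually_nhds_conv_at)
  moreover have "\<forall>\<^sub>F y in nhds x. (\<Sum>j\<in>UNIV. \<bar>?D y (axis j 1)\<bar>) < B"
  proof -
    have "isCont (\<lambda>y. \<Sum>j\<in>UNIV. \<bar>?D y (axis j 1)\<bar>) x" by (intro continuous_intros contD)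
    from order_tendstoD(2)[OF this[unfolded continuous_at], of B]
    show ?thesis by (simp add: B_def eventually_nhds_conv_at)
  qed
  moreover have "\<forall>\<^sub>F y in nhds x. y \<in> S" using x C1_on_open[OF f] by (simp add: eventually_nhds_in_open)
  ultimately have "\<forall>\<^sub>F y in nhds x. m < ?D y e \<and> (\<Sum>j\<in>UNIV. \<bar>?D y (axis j 1)\<bar>) < B \<and> y \<in> S"
    by eventually_elim auto
  then obtain r where r: "r > 0"
    "\<And>y. dist y x < r \<Longrightarrow> m < ?D y e \<and> (\<Sum>j\<in>UNIV. \<bar>?D y (axis j 1)\<bar>) < B \<and> y \<in> S"
    unfolding eventually_nhds_metric by blast
  have B: "B > 0" by (simp add: B_def add_nonneg_pos sum_nonneg)
  \<comment> \<open>\<open>B * \<rho> < m\<close> ensures that changing the direction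
    \<open>e\<close> by a vector of norm at most \<open>\<rho>\<close> changes the directional
    derivative by less than \<open>m\<close>, so it stays positive; \<open>r / 2\<close> keeps the
    closed ball inside the radius \<open>r\<close>.\<close>
  define \<rho> where "\<rho> = min (r / 2) (m / (2 * B))"
  have \<rho>: "\<rho> > 0" "\<rho> < r" "B * \<rho> < m"
  proof -
    show "\<rho> > 0" using r m B by (simp add: \<rho>_def)
    show "\<rho> < r" using r by (simp add: \<rho>_def)
    have "B * \<rho> \<le> B * (m / (2 * B))" using B by (intro mult_left_mono) (auto simp: \<rho>_def)
    then show "B * \<rho> < m" using B m by simp
  qed
  let ?C = "cball x \<rho> \<inter> {y \<in> cball x \<rho>. f y = 0}"
  have inS: "cball x \<rho> \<subseteq> S" using r(2) \<rho> by (auto simp: dist_commute)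
  have "negligible ?C"
  \<comment> \<open>A point of the ball is \<open>x - e + v\<close> with \<open>v\<close> within
    distance \<open>\<rho>\<close> of \<open>e\<close>. Two zeros on one ray would make the
    derivative along \<open>v\<close> vanish somewhere between them.\<close>
  proof (rule starlike_negligible_strong[where a = "x - e"])
    have "closed {y \<in> cball x \<rho>. f y = 0}"
      using continuous_closed_preimage_constant[OF continuous_on_subset[OF C1_on_continuous[OF f] inS] closed_cball] .
    then show "closed ?C" by (intro closed_Int closed_cball)
    fix c :: real and v
    assume c: "0 \<le> c" "c < 1" and v: "x - e + v \<in> ?C"
    show "x - e + c *\<^sub>R v \<notin> ?C"
    proof
      assume cv: "x - e + c *\<^sub>R v \<in> ?C"
      let ?l = "\<lambda>t. x - e + t *\<^sub>R v"
      \<comment> \<open>The segment between the two zeros lies in the convex ball, hence in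
        \<open>S\<close>, where the mean value theorem applies.\<close>
      have seg: "?l t \<in> cball x \<rho>" if "c \<le> t" "t \<le> 1" for t
      proof -
        have "?l t = ((1 - t) / (1 - c)) *\<^sub>R ?l c + ((t - c) / (1 - c)) *\<^sub>R ?l 1"
        proof -
          have "(1 - t) / (1 - c) + (t - c) / (1 - c) = 1"
            using c by (simp add: field_simps)
          moreover have "(1 - t) / (1 - c) * c + (t - c) / (1 - c) = (t * (1 - c)) / (1 - c)"
            by (simp add: add_divide_distrib[symmetric] algebra_simps)
          then have "(1 - t) / (1 - c) * c + (t - c) / (1 - c) = t"
            using c by simp
          moreover have "a *\<^sub>R ?l c + b *\<^sub>R ?l 1 = (a + b) *\<^sub>R (x - e) + (a * c + b) *\<^sub>R v" for a b
            by (simp add: algebra_simps)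
          ultimately show ?thesis by simp
        qed
        also have "\<dots> \<in> cball x \<rho>"
        proof (rule convexD[OF convex_cball])
          show "?l c \<in> cball x \<rho>" "?l 1 \<in> cball x \<rho>" using cv v by simp_all
          show "0 \<le> (1 - t) / (1 - c)" "0 \<le> (t - c) / (1 - c)" using c that by auto
          show "(1 - t) / (1 - c) + (t - c) / (1 - c) = 1" using c by (simp add: field_simps)
        qed
        finally show ?thesis .
      qed
      have "\<exists>z. c < z \<and> z < 1 \<and> f (?l 1) - f (?l c) = (1 - c) * ?D (?l z) v"
        using c seg inS
        by (intro MVT2 has_real_derivative_line C1_on_differentiable[OF f]) auto
      then obtain z where z: "c < z" "z < 1" "f (?l 1) - f (?l c) = (1 - c) * ?D (?l z) v" by blast
      have lz: "?l z \<in> cball x \<rho>" using seg z by simp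
      then have lz': "dist (?l z) x < r" using \<rho> by (simp add: dist_commute)
      have Dz: "m < ?D (?l z) e" "(\<Sum>j\<in>UNIV. \<bar>?D (?l z) (axis j 1)\<bar>) < B" "?l z \<in> S"
        using r(2)[OF lz'] by auto
      define u where "u = v - e"
      have nu: "norm u \<le> \<rho>" using v by (simp add: u_def dist_norm algebra_simps norm_minus_commute)
      have "\<bar>?D (?l z) u\<bar> = \<bar>\<Sum>j\<in>UNIV. u $ j *\<^sub>R ?D (?l z) (axis j 1)\<bar>"
        by (simp only: frechet_derivative_partial[OF C1_on_differentiable[OF f Dz(3)], of u] partial_deriv_def)
      also have "\<dots> \<le> (\<Sum>j\<in>UNIV. \<rho> * \<bar>?D (?l z) (axis j 1)\<bar>)"
      proof (rule order_trans[OF sum_abs sum_mono])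
        fix j
        have "\<bar>u $ j\<bar> \<le> \<rho>" using component_le_norm_cart[of u j] nu by simp
        then show "\<bar>u $ j *\<^sub>R ?D (?l z) (axis j 1)\<bar> \<le> \<rho> * \<bar>?D (?l z) (axis j 1)\<bar>"
          by (simp add: abs_mult mult_right_mono)
      qed
      also have "\<dots> \<le> \<rho> * B" using Dz(2) \<rho>(1) by (simp add: sum_distrib_left[symmetric])
      finally have "\<bar>?D (?l z) u\<bar> < m" using \<rho>(3) by (simp add: mult.commute)
      moreover have "?D (?l z) v = ?D (?l z) e + ?D (?l z) u"
        using linear_add[OF lin[OF Dz(3)], of e u] by (simp add: u_def)
      ultimately have "?D (?l z) v > 0" using Dz(1) by simp
      then show False using z c v cv by simp
    qed
  qed
  then have "negligible (?N \<inter> ball x \<rho>)"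
    by (rule negligible_subset) auto
  moreover have "openin (top_of_set ?N) (?N \<inter> ball x \<rho>)" by (simp add: openin_open_Int)
  moreover have "x \<in> ?N \<inter> ball x \<rho>" using x \<rho> by simp
  ultimately show "\<exists>U. openin (top_of_set ?N) U \<and> x \<in> U \<and> negligible U" by blast
qed

section \<open>Charts\<close>

locale oriented_manifold =
  fixes A :: "('a::{t2_space,second_countable_topology}, 'n::finite) chart set"
  assumes atlas: "oriented_atlas A"
begin

lemma is_chart: "c \<in> A \<Longrightarrow> is_chart c"
  using atlas by (simp add: oriented_atlas_def)

lemma open_cdom: "c \<in> A \<Longrightarrow> open (cdom c)"
  using is_chart by (simp add: is_chart_def)

lemma open_coord: "c \<in> A \<Longrightarrow> open (coord c ` cdom c)"
  using is_chart by (simp add: is_chart_def)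

lemma param_coord: "c \<in> A \<Longrightarrow> p \<in> cdom c \<Longrightarrow> param c (coord c p) = p"
  using is_chart by (simp add: is_chart_def homeomorphism_def)

lemma coord_param: "c \<in> A \<Longrightarrow> y \<in> coord c ` cdom c \<Longrightarrow> coord c (param c y) = y"
  using param_coord by fastforce

lemma param_in_cdom: "c \<in> A \<Longrightarrow> y \<in> coord c ` cdom c \<Longrightarrow> param c y \<in> cdom c"
  using param_coord by fastforce

lemma continuous_on_coord: "c \<in> A \<Longrightarrow> continuous_on (cdom c) (coord c)"
  using is_chart by (simp add: is_chart_def homeomorphism_def)

lemma continuous_on_param: "c \<in> A \<Longrightarrow> continuous_on (coord c ` cdom c) (param c)"
  using is_chart by (simp add: is_chart_def homeomorphism_def)

lemma coord_image_iff:
  assumes "c \<in> A"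
  shows "y \<in> coord c ` (cdom c \<inter> V) \<longleftrightarrow> y \<in> coord c ` cdom c \<and> param c y \<in> V"
proof
  assume "y \<in> coord c ` cdom c \<and> param c y \<in> V"
  then have "param c y \<in> cdom c \<inter> V" "y = coord c (param c y)"
    using param_in_cdom[OF assms] coord_param[OF assms] by auto
  then show "y \<in> coord c ` (cdom c \<inter> V)" by (rule rev_image_eqI)
qed (use param_coord[OF assms] in auto)

lemma coord_image_iff':
  assumes "c \<in> A" "p \<in> cdom c"
  shows "coord c p \<in> coord c ` (cdom c \<inter> V) \<longleftrightarrow> p \<in> V"
  using assms coord_image_iff[OF assms(1), of "coord c p" V] param_coord[OF assms] by auto

lemma open_coord_image:
  assumes "c \<in> A" "open V"
  shows "open (coord c ` (cdom c \<inter> V))"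
proof -
  have "coord c ` (cdom c \<inter> V) = coord c ` cdom c \<inter> param c -` V"
    using coord_image_iff[OF assms(1)] by blast
  then show ?thesis
    using continuous_open_preimage[OF continuous_on_param[OF assms(1)] open_coord[OF assms(1)] assms(2)]
    by simp
qed

lemma open_coord_vimage:
  assumes "c \<in> A" "open V"
  shows "open (cdom c \<inter> coord c -` V)"
  using continuous_open_preimage[OF continuous_on_coord[OF assms(1)] open_cdom[OF assms(1)] assms(2)] .

lemma ex_chart: "\<exists>c. c \<in> A \<and> p \<in> cdom c"
  using atlas unfolding oriented_atlas_def by blast

lemma chart_at: "chart_at A p \<in> A" "p \<in> cdom (chart_at A p)"
  using someI_ex[OF ex_chart[of p]] by (simp_all add: chart_at_def)

lemma smooth_transition:
  "c \<in> A \<Longrightarrow> c' \<in> A \<Longrightarrow> smooth_on (coord c ` (cdom c \<inter> cdom c')) (transition c c')"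
  using atlas by (simp add: oriented_atlas_def)

lemma det_jacobian_pos:
  "c \<in> A \<Longrightarrow> c' \<in> A \<Longrightarrow> p \<in> cdom c \<Longrightarrow> p \<in> cdom c' \<Longrightarrow>
    det (jacobian (transition c c') (coord c p)) > 0"
  using atlas by (simp add: oriented_atlas_def)

lemma transition_coord: "c \<in> A \<Longrightarrow> p \<in> cdom c \<Longrightarrow> transition c c' (coord c p) = coord c' p"
  by (simp add: transition_def param_coord)

lemma jacobian_nth: "jacobian f x $ i $ j = partial_deriv j f x $ i"
  by (simp add: jacobian_def matrix_def partial_deriv_def)

lemma differentiable_transition:
  assumes "c \<in> A" "c' \<in> A" "p \<in> cdom c" "p \<in> cdom c'"
  shows "transition c c' differentiable (at (coord c p))"
  using smooth_on_imp_C1_on[OF smooth_transition[OF assms(1,2)]] assms coord_image_iff'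
  by (intro C1_on_differentiable) auto

section \<open>Functions, differentials and vector fields in charts\<close>

definition C1_fun :: "'a set \<Rightarrow> ('a \<Rightarrow> real) \<Rightarrow> bool"
  where "C1_fun V u \<longleftrightarrow> open V \<and> (\<forall>c\<in>A. C1_on (coord c ` (cdom c \<inter> V)) (u \<circ> param c))"

lemma C1_funD: "C1_fun V u \<Longrightarrow> c \<in> A \<Longrightarrow> C1_on (coord c ` (cdom c \<inter> V)) (u \<circ> param c)"
  by (simp add: C1_fun_def)

lemma C1_fun_open: "C1_fun V u \<Longrightarrow> open V"
  by (simp add: C1_fun_def)

lemma C1_fun_subset:
  assumes "C1_fun V u" "open W" "W \<subseteq> V"
  shows "C1_fun W u"
  unfolding C1_fun_def
proof (intro conjI ballI assms(2))
  fix c assume c: "c \<in> A"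
  show "C1_on (coord c ` (cdom c \<inter> W)) (u \<circ> param c)"
    by (rule C1_on_subset[OF C1_funD[OF assms(1) c] open_coord_image[OF c assms(2)]]) (use assms(3) in blast)
qed

lemma smooth_fun_imp_C1_fun: "smooth_fun_on A V u \<Longrightarrow> C1_fun V u"
  unfolding smooth_fun_on_def C1_fun_def using smooth_on_imp_C1_on by blast

lemma C1_fun_mult: "C1_fun V u \<Longrightarrow> C1_fun V v \<Longrightarrow> C1_fun V (\<lambda>p. u p * v p)"
  unfolding C1_fun_def comp_def by (auto intro: C1_on_mult)

lemma C1_fun_diff: "C1_fun V u \<Longrightarrow> C1_fun V v \<Longrightarrow> C1_fun V (\<lambda>p. u p - v p)"
  unfolding C1_fun_def comp_def by (auto intro: C1_on_diff)

lemma C1_fun_const: "open V \<Longrightarrow> C1_fun V (\<lambda>p. k)"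
  unfolding C1_fun_def comp_def by (auto intro!: open_coord_image)

lemma C1_fun_compose:
  fixes h :: "real \<Rightarrow> real"
  assumes "C1_on UNIV h" "C1_fun V u"
  shows "C1_fun V (\<lambda>p. h (u p))"
  using assms C1_on_compose[OF assms(1)] unfolding C1_fun_def comp_def by blast

lemma C1_fun_cong:
  assumes "C1_fun V u" "\<And>p. p \<in> V \<Longrightarrow> u p = v p"
  shows "C1_fun V v"
  unfolding C1_fun_def
proof (intro conjI ballI)
  show "open V" using assms(1) by (simp add: C1_fun_def)
  fix c assume c: "c \<in> A"
  show "C1_on (coord c ` (cdom c \<inter> V)) (v \<circ> param c)"
    by (rule C1_on_cong[OF C1_funD[OF assms(1) c]]) (use assms(2) coord_image_iff[OF c] in auto)
qed

lemma C1_fun_continuous: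
  assumes "C1_fun V u"
  shows "continuous_on V u"
proof (rule continuous_at_imp_continuous_on, rule ballI)
  fix p assume p: "p \<in> V"
  let ?c = "chart_at A p" and ?W = "cdom (chart_at A p) \<inter> V"
  have W: "open ?W" "p \<in> ?W" using chart_at[of p] open_Int[OF open_cdom[OF chart_at(1)] C1_fun_open[OF assms]] p by auto
  have "continuous_on ?W (\<lambda>q. (u \<circ> param ?c) (coord ?c q))"
    by (rule continuous_on_compose2[OF C1_on_continuous[OF C1_funD[OF assms chart_at(1)]]
          continuous_on_subset[OF continuous_on_coord[OF chart_at(1)]]]) auto
  then have "continuous_on ?W u"
    by (rule continuous_on_eq) (simp add: param_coord chart_at(1))
  then show "isCont u p" using W by (simp add: continuous_on_eq_continuous_at)
qed

lemma differential_nth: "differential u c p $ i = partial_deriv i (u \<circ> param c) (coord c p)"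
  by (simp add: differential_def)

lemma C1_fun_differentiable:
  assumes "C1_fun V u" "c \<in> A" "p \<in> cdom c" "p \<in> V"
  shows "(u \<circ> param c) differentiable (at (coord c p))"
  using C1_on_differentiable[OF C1_funD[OF assms(1,2)]] coord_image_iff'[OF assms(2,3)] assms(4) by blast

lemma transition_local:
  assumes "c \<in> A" "c' \<in> A" "y \<in> coord c ` (cdom c \<inter> cdom c')"
  shows "param c' (transition c c' y) = param c y" "transition c c' y \<in> coord c' ` cdom c'"
  using assms coord_image_iff[OF assms(1)] param_coord[OF assms(2)]
  by (auto simp: transition_def)

lemma differential_transform:
  assumes u: "C1_fun V u" and c: "c \<in> A" "c' \<in> A" and p: "p \<in> cdom c" "p \<in> cdom c'" "p \<in> V"
  shows "differential u c p = transpose (jacobian (transition c c') (coord c p)) *v differential u c' p"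
proof -
  let ?\<tau> = "transition c c'"
  let ?S = "coord c ` (cdom c \<inter> cdom c')"
  have y: "coord c p \<in> ?S" using p coord_image_iff'[OF c(1)] by auto
  have "partial_deriv i (u \<circ> param c) (coord c p)
      = partial_deriv i (\<lambda>y. (u \<circ> param c') (?\<tau> y)) (coord c p)" for i
    by (rule partial_deriv_cong[OF open_coord_image[OF c(1) open_cdom[OF c(2)]] y])
      (simp add: transition_local[OF c])
  moreover have "(u \<circ> param c') differentiable (at (?\<tau> (coord c p)))"
    using C1_fun_differentiable[OF u c(2) p(2,3)] by (simp add: transition_coord[OF c(1) p(1)])
  then have "partial_deriv i (\<lambda>y. (u \<circ> param c') (?\<tau> y)) (coord c p)
      = (\<Sum>j\<in>UNIV. partial_deriv i ?\<tau> (coord c p) $ j * partial_deriv j (u \<circ> param c') (coord c' p))" for i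
    using partial_deriv_chain[OF differentiable_transition[OF c p(1,2)], of "u \<circ> param c'" i]
    by (simp add: transition_coord[OF c(1) p(1)])
  ultimately show ?thesis
    by (simp add: vec_eq_iff differential_nth matrix_vector_mult_def transpose_def jacobian_nth)
qed

definition C1_vec :: "'a set \<Rightarrow> ('a, 'n) vec_field \<Rightarrow> bool"
  where "C1_vec V X \<longleftrightarrow> open V \<and>
    (\<forall>c\<in>A. \<forall>i. C1_on (coord c ` (cdom c \<inter> V)) (\<lambda>y. X c (param c y) $ i)) \<and>
    (\<forall>c\<in>A. \<forall>c'\<in>A. \<forall>p\<in>cdom c \<inter> cdom c' \<inter> V.
      X c' p = jacobian (transition c c') (coord c p) *v X c p)"

lemma C1_vec_open: "C1_vec V X \<Longrightarrow> open V"
  by (simp add: C1_vec_def)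

lemma C1_vecD: "C1_vec V X \<Longrightarrow> c \<in> A \<Longrightarrow> C1_on (coord c ` (cdom c \<inter> V)) (\<lambda>y. X c (param c y) $ i)"
  by (simp add: C1_vec_def)

lemma C1_vec_transform:
  "C1_vec V X \<Longrightarrow> c \<in> A \<Longrightarrow> c' \<in> A \<Longrightarrow> p \<in> cdom c \<Longrightarrow> p \<in> cdom c' \<Longrightarrow> p \<in> V \<Longrightarrow>
    X c' p = jacobian (transition c c') (coord c p) *v X c p"
  unfolding C1_vec_def by blast

lemma C1_vec_subset:
  assumes "C1_vec V X" "open W" "W \<subseteq> V"
  shows "C1_vec W X"
  unfolding C1_vec_def
proof (intro conjI ballI allI assms(2))
  fix c i assume c: "c \<in> A"
  show "C1_on (coord c ` (cdom c \<inter> W)) (\<lambda>y. X c (param c y) $ i)"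
    by (rule C1_on_subset[OF C1_vecD[OF assms(1) c] open_coord_image[OF c assms(2)]]) (use assms(3) in blast)
  fix c' p assume "c' \<in> A" "p \<in> cdom c \<inter> cdom c' \<inter> W"
  then show "X c' p = jacobian (transition c c') (coord c p) *v X c p"
    using C1_vec_transform[OF assms(1) c] assms(3) by blast
qed

lemma differential_inner_transform:
  assumes "C1_fun V u" "C1_vec V X" "c \<in> A" "c' \<in> A" "p \<in> cdom c" "p \<in> cdom c'" "p \<in> V"
  shows "differential u c p \<bullet> X c p = differential u c' p \<bullet> X c' p"
  using differential_transform[OF assms(1,3-7)] C1_vec_transform[OF assms(2,3-7)]
  by (simp only: inner_transpose)

section \<open>Bump functions supported in one chart\<close>

definition is_bump :: "'a set \<Rightarrow> 'a \<Rightarrow> ('a \<Rightarrow> real) \<Rightarrow> ('a, 'n) chart \<Rightarrow> 'a set \<Rightarrow> 'a set \<Rightarrow> bool"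
  where "is_bump W p b c K N \<longleftrightarrow> C1_fun UNIV b \<and> open N \<and> p \<in> N \<and> (\<forall>q\<in>N. b q = 1) \<and>
    c \<in> A \<and> compact K \<and> K \<subseteq> cdom c \<inter> W \<and> (\<forall>q. q \<notin> K \<longrightarrow> b q = 0) \<and> (\<forall>q. 0 \<le> b q) \<and> N \<subseteq> K"

lemma is_bumpD:
  assumes "is_bump W p b c K N"
  shows "C1_fun UNIV b" "open N" "p \<in> N" "\<And>q. q \<in> N \<Longrightarrow> b q = 1" "c \<in> A" "compact K"
    "K \<subseteq> cdom c \<inter> W" "\<And>q. q \<notin> K \<Longrightarrow> b q = 0" "\<And>q. 0 \<le> b q" "N \<subseteq> K"
  using assms unfolding is_bump_def by blast+

text \<open>A Euclidean bump is transported by a chart and extended by zero. The extension is C1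
  because the compact set \<open>K\<close> is closed in a Hausdorff space, so that the domain of the
  chart and the complement of \<open>K\<close> are open sets covering the manifold.\<close>

lemma ex_bump:
  assumes "open W" "p \<in> W"
  shows "\<exists>b c K N. is_bump W p b c K N"
proof -
  define c where "c = chart_at A p"
  have c: "c \<in> A" "p \<in> cdom c" using chart_at[of p] by (simp_all add: c_def)
  let ?S = "coord c ` (cdom c \<inter> W)" and ?y = "coord c p"
  have "open ?S" "?y \<in> ?S" using open_coord_image[OF c(1) assms(1)] c assms(2) by auto
  then obtain e where e: "e > 0" "cball ?y e \<subseteq> ?S" using open_contains_cball by blast
  \<comment> \<open>The bump vanishes outside the ball of radius \<open>2 * r = e\<close>, which
    lies in the image of the chart.\<close>
  define r where "r = e / 2"
  have r: "r > 0" "cball ?y (2 * r) \<subseteq> ?S" using e by (simp_all add: r_def)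
  define b where "b q = (if q \<in> cdom c then bump ?y r (coord c q) else 0)" for q
  define K where "K = param c ` cball ?y (2 * r)"
  define N where "N = cdom c \<inter> coord c -` ball ?y r"
  have sub: "cball ?y (2 * r) \<subseteq> coord c ` cdom c" using r(2) by auto
  have K: "compact K" unfolding K_def
    by (intro compact_continuous_image continuous_on_subset[OF continuous_on_param[OF c(1)] sub]) simp
  have Ksub: "K \<subseteq> cdom c \<inter> W"
    unfolding K_def using r(2) coord_image_iff[OF c(1)] param_in_cdom[OF c(1)] by fastforce
  have b0: "b q = 0" if "q \<notin> K" for q
  proof (cases "q \<in> cdom c")
    case True
    then have "coord c q \<notin> cball ?y (2 * r)" using that param_coord[OF c(1)] unfolding K_def by force
    from bump_outside[OF r(1) this] show ?thesis by (simp add: b_def)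
  qed (simp add: b_def)
  have C1: "C1_fun UNIV b"
    unfolding C1_fun_def
  proof (intro conjI ballI open_UNIV)
    fix c' assume c': "c' \<in> A"
    show "C1_on (coord c' ` (cdom c' \<inter> UNIV)) (b \<circ> param c')"
    proof (rule C1_on_local)
      show "open (coord c' ` (cdom c' \<inter> UNIV))" using open_coord[OF c'] by simp
      fix y assume y: "y \<in> coord c' ` (cdom c' \<inter> UNIV)"
      show "\<exists>N. y \<in> N \<and> C1_on N (b \<circ> param c')"
      proof (cases "param c' y \<in> cdom c")
        case True
        have "C1_on (coord c' ` (cdom c' \<inter> cdom c)) (\<lambda>y. bump ?y r (transition c' c y))"
          by (rule C1_on_compose[OF C1_on_bump[OF r(1)] smooth_on_imp_C1_on[OF smooth_transition[OF c' c(1)]] subset_UNIV])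
        then have "C1_on (coord c' ` (cdom c' \<inter> cdom c)) (b \<circ> param c')"
        proof (rule C1_on_cong)
            fix z assume "z \<in> coord c' ` (cdom c' \<inter> cdom c)"
            then have "param c' z \<in> cdom c" using coord_image_iff[OF c', of z "cdom c"] by simp
            then show "bump ?y r (transition c' c z) = (b \<circ> param c') z"
              by (simp add: b_def transition_def)
          qed
        moreover have "y \<in> coord c' ` (cdom c' \<inter> cdom c)" using y True coord_image_iff[OF c', of y "cdom c"] by simp
        ultimately show ?thesis by (intro exI[of _ "coord c' ` (cdom c' \<inter> cdom c)"] conjI)
      next
        case False
        have o: "open (- K)" using compact_imp_closed[OF K] by auto
        have "C1_on (coord c' ` (cdom c' \<inter> - K)) (\<lambda>y. 0 :: real)"
          using open_coord_image[OF c' o] by auto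
        then have "C1_on (coord c' ` (cdom c' \<inter> - K)) (b \<circ> param c')"
        proof (rule C1_on_cong)
            fix z assume "z \<in> coord c' ` (cdom c' \<inter> - K)"
            then have "param c' z \<in> - K" using coord_image_iff[OF c', of z "- K"] by simp
            then show "0 = (b \<circ> param c') z" using b0 by simp
          qed
        moreover have "y \<in> coord c' ` (cdom c' \<inter> - K)" proof -
          have "param c' y \<notin> K" using False Ksub by blast
          then show ?thesis using y coord_image_iff[OF c', of y "- K"] by simp
        qed
        ultimately show ?thesis by (intro exI[of _ "coord c' ` (cdom c' \<inter> - K)"] conjI)
      qed
    qed
  qed
  have "open N" unfolding N_def by (rule open_coord_vimage[OF c(1)]) simp
  moreover have "p \<in> N" using c r by (simp add: N_def)
  moreover have "b q = 1" if "q \<in> N" for q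
    using that by (auto simp: N_def b_def intro!: bump_inside[OF r(1)])
  moreover have "0 \<le> b q" for q by (simp add: b_def bump_nonneg)
  moreover have "N \<subseteq> K"
  proof
    fix q assume "q \<in> N"
    then have "q = param c (coord c q)" "coord c q \<in> cball ?y (2 * r)"
      using param_coord[OF c(1)] r(1) by (auto simp: N_def)
    then show "q \<in> K" unfolding K_def by (rule image_eqI)
  qed
  ultimately have "is_bump W p b c K N"
    unfolding is_bump_def using C1 c(1) K Ksub b0 by blast
  then show ?thesis by blast
qed

end


section \<open>The Riemannian volume\<close>

text \<open>The segment from the identity to \<open>M\<close> consists of positive definite, hence
  invertible, matrices. The determinant is 1 at its start and never zero, so it cannot change
  sign.\<close>

lemma det_pos_of_positive_definite:
  fixes M :: "real^'n^'n"
  assumes pos: "\<And>v. v \<noteq> 0 \<Longrightarrow> v \<bullet> (M *v v) > 0"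
  shows "det M > 0"
proof (rule ccontr)
  assume neg: "\<not> det M > 0"
  define P where "P s = (1 - s) *\<^sub>R mat 1 + s *\<^sub>R M" for s :: real
  have cont: "continuous_on {0..1} (\<lambda>s. det (P s))"
    unfolding det_def P_def by (intro continuous_intros)
  have "\<exists>s. 0 \<le> s \<and> s \<le> 1 \<and> det (P s) = 0"
    by (rule IVT2') (use neg cont in \<open>auto simp: P_def\<close>)
  then obtain s where s: "0 \<le> s" "s \<le> 1" "det (P s) = 0" by blast
  then have "\<not> invertible (P s)" by (simp add: invertible_det_nz)
  then obtain v where v: "v \<noteq> 0" "P s *v v = 0"
    using matrix_left_invertible_ker[of "P s"] invertible_left_inverse[of "P s"] by blast
  have "P s *v v = (1 - s) *\<^sub>R v + s *\<^sub>R (M *v v)"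
    by (simp add: P_def matrix_vector_mult_add_rdistrib scaleR_matrix_vector_assoc[symmetric])
  then have "0 = (1 - s) * (v \<bullet> v) + s * (v \<bullet> (M *v v))"
    using v(2) by (metis inner_add_right inner_scaleR_right inner_zero_right)
  moreover have "(1 - s) * (v \<bullet> v) + s * (v \<bullet> (M *v v)) > 0"
  proof (cases "s = 0")
    case False
    then have "s * (v \<bullet> (M *v v)) > 0" using s pos[OF v(1)] by simp
    moreover have "(1 - s) * (v \<bullet> v) \<ge> 0" using s by simp
    ultimately show ?thesis by linarith
  qed (use v in simp)
  ultimately show False by simp
qed

lemma (in oriented_manifold) metric_det_pos:
  "riemannian_metric A g \<Longrightarrow> c \<in> A \<Longrightarrow> p \<in> cdom c \<Longrightarrow> det (g c p) > 0"
  by (rule det_pos_of_positive_definite) (simp add: riemannian_metric_def)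

lemma (in oriented_manifold) tensor2_transform:
  "smooth_tensor2 A T \<Longrightarrow> c \<in> A \<Longrightarrow> c' \<in> A \<Longrightarrow> p \<in> cdom c \<Longrightarrow> p \<in> cdom c' \<Longrightarrow>
    T c p = transpose (jacobian (transition c c') (coord c p)) ** T c' p ** jacobian (transition c c') (coord c p)"
  unfolding smooth_tensor2_def Let_def by blast

lemma (in oriented_manifold) C1_on_tensor2:
  assumes "smooth_tensor2 A T" "c \<in> A"
  shows "C1_on (coord c ` cdom c) (\<lambda>y. T c (param c y) $ i $ j)"
proof -
  have "C1_on (coord c ` cdom c) (T c \<circ> param c)"
    using assms smooth_on_imp_C1_on unfolding smooth_tensor2_def by blast
  from C1_on_nth[OF C1_on_nth[OF this]] show ?thesis by simp
qed

locale oriented_riemannian = oriented_manifold A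
  for A :: "('a::{t2_space,second_countable_topology}, 'n::finite) chart set" +
  fixes g :: "('a, 'n) tensor2"
  assumes metric: "riemannian_metric A g"
begin

lemma smooth_metric: "smooth_tensor2 A g"
  using metric by (simp add: riemannian_metric_def)

lemma metric_symmetric: "c \<in> A \<Longrightarrow> p \<in> cdom c \<Longrightarrow> transpose (g c p) = g c p"
  using metric by (simp add: riemannian_metric_def)

lemmas det_pos = metric_det_pos[OF metric]

lemma volume_density_pos: "c \<in> A \<Longrightarrow> p \<in> cdom c \<Longrightarrow> volume_density g c p > 0"
  using det_pos by (simp add: volume_density_def)

lemma C1_on_volume_density:
  assumes "c \<in> A"
  shows "C1_on (coord c ` cdom c) (\<lambda>y. volume_density g c (param c y))"
  unfolding volume_density_def
  by (intro C1_on_sqrt C1_on_det open_coord C1_on_tensor2 smooth_metric det_pos param_in_cdom assms)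

text \<open>Taking square roots would leave the absolute value of the Jacobian determinant; the
  orientation of the atlas removes it.\<close>

lemma volume_density_transform:
  assumes "c \<in> A" "c' \<in> A" "p \<in> cdom c" "p \<in> cdom c'"
  shows "volume_density g c p = det (jacobian (transition c c') (coord c p)) * volume_density g c' p"
proof -
  let ?J = "jacobian (transition c c') (coord c p)"
  have "det (g c p) = (det ?J)\<^sup>2 * det (g c' p)"
    using tensor2_transform[OF smooth_metric assms] by (simp add: det_mul det_transpose power2_eq_square)
  then show ?thesis
    using det_jacobian_pos[OF assms] by (simp add: volume_density_def real_sqrt_mult)
qed

section \<open>The volume inside one chart\<close>

definition chart_param :: "('a, 'n) chart \<Rightarrow> real^'n \<Rightarrow> 'a"
  where "chart_param c y = (if y \<in> coord c ` cdom c then param c y else undefined)"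

lemma measurable_chart_param:
  assumes "c \<in> A"
  shows "chart_param c \<in> borel_measurable borel"
  unfolding chart_param_def
  by (intro borel_measurable_continuous_on_if continuous_on_param assms borel_open open_coord) auto

text \<open>Extension by zero makes the density a Borel function on the whole space and cancels the
  default value of \<open>chart_param\<close> off the chart.\<close>

definition chart_density :: "('a, 'n) chart \<Rightarrow> real^'n \<Rightarrow> real"
  where "chart_density c y = (if y \<in> coord c ` cdom c then volume_density g c (param c y) else 0)"

lemma chart_density_nonneg: "c \<in> A \<Longrightarrow> 0 \<le> chart_density c y"
  using volume_density_pos param_in_cdom by (auto simp: chart_density_def less_imp_le)

lemma measurable_chart_density:
  assumes "c \<in> A"
  shows "chart_density c \<in> borel_measurable borel"
  unfolding chart_density_def
  by (rule borel_measurable_continuous_on_if[OF borel_open[OF open_coord[OF assms]]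
        C1_on_continuous[OF C1_on_volume_density[OF assms]] continuous_on_const])

lemma coord_image_eq_vimage:
  assumes "c \<in> A" "B \<subseteq> cdom c"
  shows "coord c ` B = coord c ` cdom c \<inter> chart_param c -` B"
proof (rule set_eqI)
  fix y
  have "cdom c \<inter> B = B" using assms(2) by blast
  then show "y \<in> coord c ` B \<longleftrightarrow> y \<in> coord c ` cdom c \<inter> chart_param c -` B"
    using coord_image_iff[OF assms(1), of y B] by (simp add: chart_param_def)
qed

lemma measurable_coord_image:
  assumes "c \<in> A" "B \<subseteq> cdom c" "B \<in> sets borel"
  shows "coord c ` B \<in> sets borel"
proof -
  have "chart_param c -` B \<in> sets borel"
    using measurable_sets[OF measurable_chart_param[OF assms(1)] assms(3)] by simp
  then show ?thesis
    using coord_image_eq_vimage[OF assms(1,2)] open_coord[OF assms(1)] by auto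
qed

definition chart_volume :: "('a, 'n) chart \<Rightarrow> 'a set \<Rightarrow> ennreal"
  where "chart_volume c B = (\<integral>\<^sup>+y. ennreal (indicator (coord c ` B) y * chart_density c y) \<partial>lborel)"

text \<open>The set function \<open>chart_volume\<close> realised as a Borel measure on the whole
  manifold; being a push-forward, it is countably additive by construction.\<close>

definition chart_measure :: "('a, 'n) chart \<Rightarrow> 'a measure"
  where "chart_measure c = distr (density lborel (\<lambda>y. ennreal (chart_density c y))) borel (chart_param c)"

lemma emeasure_chart_measure:
  assumes "c \<in> A" "B \<in> sets borel"
  shows "emeasure (chart_measure c) B = chart_volume c (cdom c \<inter> B)"
proof -
  have m: "chart_param c -` B \<in> sets borel"
    using measurable_sets[OF measurable_chart_param[OF assms(1)] assms(2)] by simp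
  have "emeasure (chart_measure c) B
      = emeasure (density lborel (\<lambda>y. ennreal (chart_density c y))) (chart_param c -` B)"
    unfolding chart_measure_def using measurable_chart_param[OF assms(1)] assms(2)
    by (subst emeasure_distr) auto
  also have "\<dots> = (\<integral>\<^sup>+y. ennreal (chart_density c y) * indicator (chart_param c -` B) y \<partial>lborel)"
    using measurable_chart_density[OF assms(1)] m by (intro emeasure_density) auto
  also have "\<dots> = chart_volume c (cdom c \<inter> B)"
    unfolding chart_volume_def
  proof (rule nn_integral_cong)
    fix y
    show "ennreal (chart_density c y) * indicator (chart_param c -` B) y
        = ennreal (indicator (coord c ` (cdom c \<inter> B)) y * chart_density c y)"
      using coord_image_iff[OF assms(1), of y B]
      by (cases "y \<in> coord c ` cdom c") (auto simp: indicator_def chart_param_def chart_density_def)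
  qed
  finally show ?thesis .
qed

lemma sets_chart_measure [simp]: "sets (chart_measure c) = sets borel"
  by (simp add: chart_measure_def)

text \<open>Change of variables by the transition map; the Jacobian factor is absorbed by the
  transformation law of the densities.\<close>

lemma chart_volume_compatible:
  assumes c: "c \<in> A" "c' \<in> A" and B: "B \<in> sets borel" "B \<subseteq> cdom c" "B \<subseteq> cdom c'"
  shows "chart_volume c B = chart_volume c' B"
proof -
  let ?\<tau> = "transition c c'" and ?S = "coord c ` B"
  have S: "?S \<in> sets borel" and S': "coord c' ` B \<in> sets borel"
    using measurable_coord_image[OF c(1) B(2,1)] measurable_coord_image[OF c(2) B(3,1)] by auto
  have img: "?\<tau> ` ?S = coord c' ` B"
    using B transition_coord[OF c(1)] by (auto simp: image_image subset_iff cong: image_cong)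
  have eq: "indicator ?S y * (\<bar>det (matrix (frechet_derivative ?\<tau> (at y)))\<bar> * chart_density c' (?\<tau> y))
      = indicator ?S y * chart_density c y" for y
  proof (cases "y \<in> ?S")
    case True
    then obtain p where p: "p \<in> B" "y = coord c p" by blast
    then have pc: "p \<in> cdom c" "p \<in> cdom c'" using B by auto
    have "chart_density c y = volume_density g c p" "chart_density c' (?\<tau> y) = volume_density g c' p"
      using p pc by (auto simp: chart_density_def param_coord c transition_coord)
    moreover have "det (jacobian ?\<tau> y) > 0" using det_jacobian_pos[OF c pc] p by simp
    ultimately show ?thesis
      using volume_density_transform[OF c pc] p by (simp add: jacobian_def)
  qed simp
  have "chart_volume c' B = (\<integral>\<^sup>+y. ennreal (indicator (?\<tau> ` ?S) y * chart_density c' y) \<partial>lborel)"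
    by (simp add: chart_volume_def img)
  also have "\<dots> = (\<integral>\<^sup>+y. ennreal (indicator ?S y
      * (\<bar>det (matrix (frechet_derivative ?\<tau> (at y)))\<bar> * chart_density c' (?\<tau> y))) \<partial>lborel)"
  proof (rule nn_integral_change_of_variables[OF S])
    show "(?\<tau> has_derivative frechet_derivative ?\<tau> (at y)) (at y)" if "y \<in> ?S" for y
      using that B differentiable_transition[OF c] by (auto intro!: has_derivative_frechet)
    show "inj_on ?\<tau> ?S"
    proof (rule inj_onI)
      fix x y assume xy: "x \<in> ?S" "y \<in> ?S" "?\<tau> x = ?\<tau> y"
      then obtain p q where pq: "p \<in> B" "q \<in> B" "x = coord c p" "y = coord c q" by blast
      then have "coord c' p = coord c' q" using xy(3) B transition_coord[OF c(1)] by (metis subsetD)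
      then have "p = q" using pq B param_coord[OF c(2)] by (metis subsetD)
      then show "x = y" using pq by simp
    qed
    show "(\<lambda>y. indicator (?\<tau> ` ?S) y * chart_density c' y) \<in> borel_measurable borel"
      unfolding img using S' measurable_chart_density[OF c(2)] by auto
    show "(\<lambda>y. indicator ?S y * (\<bar>det (matrix (frechet_derivative ?\<tau> (at y)))\<bar> * chart_density c' (?\<tau> y)))
        \<in> borel_measurable borel"
      unfolding eq using S measurable_chart_density[OF c(1)] by auto
  qed (rule chart_density_nonneg[OF c(2)])
  also have "\<dots> = chart_volume c B" unfolding eq chart_volume_def ..
  finally show ?thesis ..
qed

section \<open>Existence and uniqueness of the volume\<close>

lemma countable_atlas:
  "\<exists>cs :: nat \<Rightarrow> ('a, 'n) chart. (\<forall>n. cs n \<in> A) \<and> (\<Union>n. cdom (cs n)) = UNIV"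
proof -
  obtain F where F: "F \<subseteq> cdom ` A" "countable F" "\<Union>F = \<Union>(cdom ` A)"
    using Lindelof[of "cdom ` A"] open_cdom by (metis imageE)
  have UN: "\<Union>F = UNIV" using F(3) ex_chart by blast
  then have ne: "F \<noteq> {}" by auto
  have "\<forall>n. \<exists>c. c \<in> A \<and> cdom c = from_nat_into F n"
    using F(1) from_nat_into[OF ne] by (metis imageE subsetD)
  then obtain cs where cs: "\<And>n. cs n \<in> A" "\<And>n. cdom (cs n) = from_nat_into F n" by metis
  have "range (from_nat_into F) = F" using F(2) ne by (simp add: range_from_nat_into)
  then have "(\<Union>n. cdom (cs n)) = UNIV" using UN cs(2) by (metis (no_types, lifting) image_cong)
  then show ?thesis using cs(1) by blast
qed

text \<open>The property characterising \<open>riemannian_volume\<close>, with the density already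
  extended by zero; \<open>is_volume_iff\<close> gives back the form of the definite
  description.\<close>

definition is_volume :: "'a measure \<Rightarrow> bool"
  where "is_volume \<mu> \<longleftrightarrow> sets \<mu> = sets borel \<and>
    (\<forall>c\<in>A. \<forall>B\<in>sets borel. B \<subseteq> cdom c \<longrightarrow> emeasure \<mu> B = chart_volume c B)"

lemma is_volume_iff:
  "is_volume \<mu> \<longleftrightarrow> sets \<mu> = sets borel \<and> (\<forall>c\<in>A. \<forall>B\<in>sets borel. B \<subseteq> cdom c \<longrightarrow>
     emeasure \<mu> B = (\<integral>\<^sup>+y\<in>coord c ` B. ennreal (volume_density g c (param c y)) \<partial>lborel))"
proof -
  have "chart_volume c B = (\<integral>\<^sup>+y\<in>coord c ` B. ennreal (volume_density g c (param c y)) \<partial>lborel)"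
    if "B \<subseteq> cdom c" for c B
    unfolding chart_volume_def using that
    by (intro nn_integral_cong) (auto simp: indicator_def chart_density_def)
  then show ?thesis unfolding is_volume_def by auto
qed

text \<open>Disjointing the domains of countably many charts cuts a Borel set into pieces whose
  measure is prescribed.\<close>

lemma is_volume_unique:
  assumes "is_volume \<mu>" "is_volume \<nu>"
  shows "\<mu> = \<nu>"
proof (rule measure_eqI)
  show "sets \<mu> = sets \<nu>" using assms by (simp add: is_volume_def)
  fix B assume "B \<in> sets \<mu>"
  then have B: "B \<in> sets borel" using assms by (simp add: is_volume_def)
  obtain cs :: "nat \<Rightarrow> ('a, 'n) chart" where cs': "(\<forall>n. cs n \<in> A) \<and> (\<Union>n. cdom (cs n)) = UNIV"
    using countable_atlas ..
  then have cs: "\<And>n. cs n \<in> A" "(\<Union>n. cdom (cs n)) = UNIV" by simp_all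
  define D where "D n = B \<inter> disjointed (\<lambda>n. cdom (cs n)) n" for n
  have D: "D n \<in> sets borel" "D n \<subseteq> cdom (cs n)" for n
  proof -
    have "range (disjointed (\<lambda>n. cdom (cs n))) \<subseteq> sets borel"
      by (rule sets.range_disjointed_sets) (use borel_open[OF open_cdom[OF cs(1)]] in blast)
    then show "D n \<in> sets borel" using B by (auto simp: D_def)
    show "D n \<subseteq> cdom (cs n)" unfolding D_def using disjointed_subset[of "\<lambda>n. cdom (cs n)" n] by blast
  qed
  have dis: "disjoint_family D"
    using disjoint_family_disjointed[of "\<lambda>n. cdom (cs n)"] by (auto simp: disjoint_family_on_def D_def)
  have "(\<Union>n. D n) = B \<inter> (\<Union>n. disjointed (\<lambda>n. cdom (cs n)) n)" by (auto simp: D_def)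
  then have UN: "(\<Union>n. D n) = B" by (simp add: UN_disjointed_eq cs)
  have "emeasure \<rho> B = (\<Sum>n. chart_volume (cs n) (D n))" if "is_volume \<rho>" for \<rho>
  proof -
    have s: "sets \<rho> = sets borel" using that by (simp add: is_volume_def)
    have "emeasure \<rho> B = (\<Sum>n. emeasure \<rho> (D n))"
    proof -
      have "range D \<subseteq> sets \<rho>" using D(1) s by auto
      from suminf_emeasure[OF this dis] show ?thesis by (simp add: UN)
    qed
    moreover have "emeasure \<rho> (D n) = chart_volume (cs n) (D n)" for n
      using that D[of n] cs(1)[of n] unfolding is_volume_def by blast
    ultimately show ?thesis by simp
  qed
  then show "emeasure \<mu> B = emeasure \<nu> B" using assms by simp
qed

text \<open>The chart measures are added up over the disjointed domains of a countable atlas. For a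
  set inside an arbitrary chart, \<open>chart_volume_compatible\<close> allows every piece to be
  measured in that chart, and the pieces add up to the prescribed value.\<close>

lemma ex_volume: "\<exists>\<mu>. is_volume \<mu>"
proof -
  obtain cs :: "nat \<Rightarrow> ('a, 'n) chart" where cs': "(\<forall>n. cs n \<in> A) \<and> (\<Union>n. cdom (cs n)) = UNIV"
    using countable_atlas ..
  then have cs: "\<And>n. cs n \<in> A" "(\<Union>n. cdom (cs n)) = UNIV" by simp_all
  let ?D = "disjointed (\<lambda>n. cdom (cs n))"
  have D: "?D n \<in> sets borel" "?D n \<subseteq> cdom (cs n)" for n
  proof -
    have "range ?D \<subseteq> sets borel"
      by (rule sets.range_disjointed_sets) (use borel_open[OF open_cdom[OF cs(1)]] in blast)
    then show "?D n \<in> sets borel" by auto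
    show "?D n \<subseteq> cdom (cs n)" by (rule disjointed_subset)
  qed
  have dis: "disjoint_family ?D" by (rule disjoint_family_disjointed)
  have UN: "(\<Union>n. ?D n) = UNIV" by (simp add: UN_disjointed_eq cs)
  \<comment> \<open>The series over the charts is written as an integral for the counting measure,
    so that countable additivity is an interchange of sum and integral.\<close>
  define f where "f B = (\<integral>\<^sup>+n. emeasure (chart_measure (cs n)) (B \<inter> ?D n) \<partial>count_space UNIV)" for B
  define \<mu> where "\<mu> = measure_of UNIV (sets borel) f"
  have sets: "sets \<mu> = sets borel" unfolding \<mu>_def
    by (subst sets_measure_of) (auto, metis sets.sigma_sets_eq space_borel)
  have em: "emeasure \<mu> B = f B" if "B \<in> sets borel" for B
  proof (rule emeasure_measure_of[OF \<mu>_def])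
    show "positive (sets \<mu>) f" by (simp add: positive_def f_def)
    show "countably_additive (sets \<mu>) f"
      unfolding countably_additive_def
    proof (intro allI impI)
      fix F :: "nat \<Rightarrow> 'a set"
      assume F: "range F \<subseteq> sets \<mu>" "disjoint_family F" "\<Union>(range F) \<in> sets \<mu>"
      have "(\<Sum>i. f (F i)) = (\<integral>\<^sup>+n. (\<Sum>i. emeasure (chart_measure (cs n)) (F i \<inter> ?D n)) \<partial>count_space UNIV)"
        unfolding f_def by (rule nn_integral_suminf[symmetric]) simp
      also have "\<dots> = f (\<Union>(range F))"
        unfolding f_def
      proof (rule nn_integral_cong)
        fix n
        have "(\<Sum>i. emeasure (chart_measure (cs n)) (F i \<inter> ?D n))
            = emeasure (chart_measure (cs n)) (\<Union>i. F i \<inter> ?D n)"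
          using F D sets by (intro suminf_emeasure) (auto simp: disjoint_family_on_def)
        then show "(\<Sum>i. emeasure (chart_measure (cs n)) (F i \<inter> ?D n))
            = emeasure (chart_measure (cs n)) (\<Union>(range F) \<inter> ?D n)" by simp
      qed
      finally show "(\<Sum>i. f (F i)) = f (\<Union>(range F))" .
    qed
  qed (use that sets in auto)
  have "emeasure \<mu> B = chart_volume c B" if c: "c \<in> A" and B: "B \<in> sets borel" "B \<subseteq> cdom c" for c B
  proof -
    have BD: "B \<inter> ?D n \<in> sets borel" for n using B D by auto
    have "emeasure (chart_measure (cs n)) (B \<inter> ?D n) = emeasure (chart_measure c) (B \<inter> ?D n)" for n
    proof -
      have "emeasure (chart_measure (cs n)) (B \<inter> ?D n) = chart_volume (cs n) (B \<inter> ?D n)"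
        using emeasure_chart_measure[OF cs(1)[of n] BD[of n]] D(2)[of n] by (simp add: Int_absorb1 le_infI2)
      also have "\<dots> = chart_volume c (B \<inter> ?D n)"
        by (rule chart_volume_compatible[OF cs(1) c BD]) (use B D(2)[of n] in auto)
      also have "\<dots> = emeasure (chart_measure c) (B \<inter> ?D n)"
        using emeasure_chart_measure[OF c BD[of n]] B(2) by (simp add: Int_absorb1 le_infI1)
      finally show ?thesis .
    qed
    then have "emeasure \<mu> B = (\<Sum>n. emeasure (chart_measure c) (B \<inter> ?D n))"
      by (simp add: em[OF B(1)] f_def nn_integral_count_space_nat)
    also have "\<dots> = emeasure (chart_measure c) (\<Union>n. B \<inter> ?D n)"
      using BD dis by (intro suminf_emeasure) (auto simp: disjoint_family_on_def)
    also have "(\<Union>n. B \<inter> ?D n) = B" using UN by auto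
    also have "emeasure (chart_measure c) B = chart_volume c B"
      using emeasure_chart_measure[OF c B(1)] B(2) by (simp add: Int_absorb1)
    finally show ?thesis .
  qed
  then show ?thesis using sets unfolding is_volume_def by blast
qed

section \<open>Integration against the volume\<close>

abbreviation "vol \<equiv> riemannian_volume A g"

lemma is_volume_vol: "is_volume vol"
proof -
  obtain \<mu> where \<mu>: "is_volume \<mu>" using ex_volume by blast
  have "vol = (THE \<mu>. is_volume \<mu>)" unfolding riemannian_volume_def is_volume_iff ..
  also have "\<dots> = \<mu>" using \<mu> is_volume_unique by (intro the_equality)
  finally show ?thesis using \<mu> by simp
qed

lemma sets_vol [simp, measurable_cong]: "sets vol = sets borel"
  using is_volume_vol by (simp add: is_volume_def)

lemma space_vol [simp]: "space vol = UNIV"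
  using sets_eq_imp_space_eq[OF sets_vol] by simp

lemma emeasure_vol:
  "c \<in> A \<Longrightarrow> B \<in> sets borel \<Longrightarrow> B \<subseteq> cdom c \<Longrightarrow> emeasure vol B = chart_volume c B"
  using is_volume_vol by (simp add: is_volume_def)

lemma measurable_vol [simp]: "borel_measurable vol = borel_measurable borel"
  by (rule measurable_cong_sets) simp_all

lemma density_vol:
  assumes "c \<in> A"
  shows "density vol (indicator (cdom c)) = chart_measure c"
proof (rule measure_eqI)
  fix B assume "B \<in> sets (density vol (indicator (cdom c)))"
  then have B: "B \<in> sets borel" by simp
  have cd: "cdom c \<in> sets borel" using open_cdom[OF assms] by simp
  have "emeasure (density vol (indicator (cdom c))) B = emeasure vol (cdom c \<inter> B)"
    using B cd by (subst emeasure_density) (auto simp: indicator_inter_arith[symmetric])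
  also have "\<dots> = chart_volume c (cdom c \<inter> B)" using B cd by (intro emeasure_vol assms) auto
  finally show "emeasure (density vol (indicator (cdom c))) B = emeasure (chart_measure c) B"
    by (simp add: emeasure_chart_measure[OF assms B])
qed simp

text \<open>On a chart the volume is the push-forward of a Lebesgue density, so the rules for
  densities and images apply. Measurability is asked of the function cut off to \<open>W\<close>,
  where alone it is controlled in the applications.\<close>

lemma set_integral_chart:
  fixes h :: "'a \<Rightarrow> real"
  assumes c: "c \<in> A" and W: "W \<in> sets borel" "W \<subseteq> cdom c"
    and m: "(\<lambda>p. indicator W p * h p) \<in> borel_measurable borel"
  shows "set_integrable vol W h \<longleftrightarrow>
      set_integrable lborel (coord c ` W) (\<lambda>y. volume_density g c (param c y) * h (param c y))"
    and "(LINT p:W|vol. h p) = (LINT y:coord c ` W|lborel. volume_density g c (param c y) * h (param c y))"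
proof -
  let ?f = "\<lambda>p. indicator W p * h p"
  have cd: "cdom c \<in> sets borel" using open_cdom[OF c] by simp
  have eq: "(\<lambda>p. indicator (cdom c) p * ?f p) = ?f" using W by (auto simp: indicator_def fun_eq_iff)
  have eq2: "chart_density c y *\<^sub>R ?f (chart_param c y)
      = indicator (coord c ` W) y *\<^sub>R (volume_density g c (param c y) * h (param c y))" for y
    using coord_image_eq_vimage[OF c W(2)] W(2)
    by (cases "y \<in> coord c ` cdom c") (auto simp: chart_density_def chart_param_def indicator_def)
  have d: "density vol (\<lambda>p. ennreal (indicator (cdom c) p)) = chart_measure c"
    using density_vol[OF c] by (simp add: ennreal_indicator)
  have "set_integrable vol W h \<longleftrightarrow> integrable (chart_measure c) ?f"
    unfolding d[symmetric] using m cd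
    by (subst integrable_density) (auto simp: set_integrable_def eq)
  also have "\<dots> \<longleftrightarrow> integrable (density lborel (\<lambda>y. ennreal (chart_density c y))) (\<lambda>y. ?f (chart_param c y))"
    unfolding chart_measure_def using m measurable_chart_param[OF c] by (intro integrable_distr_eq) auto
  also have "\<dots> \<longleftrightarrow> integrable lborel (\<lambda>y. chart_density c y *\<^sub>R ?f (chart_param c y))"
    using measurable_compose[OF measurable_chart_param[OF c] m] measurable_chart_density[OF c]
      chart_density_nonneg[OF c] by (intro integrable_density) auto
  finally show "set_integrable vol W h \<longleftrightarrow>
      set_integrable lborel (coord c ` W) (\<lambda>y. volume_density g c (param c y) * h (param c y))"
    unfolding eq2 set_integrable_def .
  have "(LINT p:W|vol. h p) = integral\<^sup>L (chart_measure c) ?f"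
    unfolding d[symmetric] using m cd
    by (subst integral_density) (auto simp: set_lebesgue_integral_def eq)
  also have "\<dots> = integral\<^sup>L (density lborel (\<lambda>y. ennreal (chart_density c y))) (\<lambda>y. ?f (chart_param c y))"
    unfolding chart_measure_def using m measurable_chart_param[OF c] by (intro integral_distr) auto
  also have "\<dots> = integral\<^sup>L lborel (\<lambda>y. chart_density c y *\<^sub>R ?f (chart_param c y))"
    using measurable_compose[OF measurable_chart_param[OF c] m] measurable_chart_density[OF c]
      chart_density_nonneg[OF c] by (intro integral_density) auto
  finally show "(LINT p:W|vol. h p) = (LINT y:coord c ` W|lborel. volume_density g c (param c y) * h (param c y))"
    unfolding eq2 set_lebesgue_integral_def .
qed

lemma null_sets_vol:
  assumes "c \<in> A" "B \<in> sets borel" "B \<subseteq> cdom c" "emeasure lborel (coord c ` B) = 0"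
  shows "emeasure vol B = 0"
proof -
  have "coord c ` B \<in> null_sets lborel"
    using measurable_coord_image[OF assms(1,3,2)] assms(4) by (simp add: null_sets_def)
  then have "AE y in lborel. ennreal (indicator (coord c ` B) y * chart_density c y) = 0"
    by (rule AE_I') (auto simp: indicator_def)
  then have "chart_volume c B = (\<integral>\<^sup>+y. 0 \<partial>(lborel :: (real^'n) measure))"
    unfolding chart_volume_def by (rule nn_integral_cong_AE)
  then show ?thesis using emeasure_vol[OF assms(1-3)] by simp
qed

text \<open>The density is bounded on a closed coordinate ball, so every point has a neighbourhood
  of finite volume, and finitely many of these cover \<open>K\<close>.\<close>

lemma emeasure_vol_compact:
  assumes "compact K"
  shows "emeasure vol K < \<infinity>"
proof -
  have loc: "\<exists>W. open W \<and> p \<in> W \<and> emeasure vol W < \<infinity>" for p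
  proof -
    define c where "c = chart_at A p"
    have c: "c \<in> A" "p \<in> cdom c" using chart_at[of p] by (simp_all add: c_def)
    obtain e where e: "e > 0" "cball (coord c p) e \<subseteq> coord c ` cdom c"
      using open_coord[OF c(1)] c(2) open_contains_cball by blast
    let ?W = "cdom c \<inter> coord c -` ball (coord c p) e"
    have oW: "open ?W" by (rule open_coord_vimage[OF c(1)]) simp
    have img: "coord c ` ?W \<subseteq> cball (coord c p) e" by auto
    have "bounded ((\<lambda>y. volume_density g c (param c y)) ` cball (coord c p) e)"
      by (intro compact_imp_bounded compact_continuous_image
          continuous_on_subset[OF C1_on_continuous[OF C1_on_volume_density[OF c(1)]] e(2)] compact_cball)
    then obtain M where M: "\<forall>z\<in>(\<lambda>y. volume_density g c (param c y)) ` cball (coord c p) e. norm z \<le> M"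
      unfolding bounded_iff by blast
    have "emeasure vol ?W = chart_volume c ?W" by (rule emeasure_vol[OF c(1)]) (use oW in auto)
    also have "\<dots> \<le> (\<integral>\<^sup>+y. ennreal M * indicator (cball (coord c p) e) y \<partial>lborel)"
      unfolding chart_volume_def
    proof (rule nn_integral_mono)
      fix y
      show "ennreal (indicator (coord c ` ?W) y * chart_density c y)
          \<le> ennreal M * indicator (cball (coord c p) e) y"
      proof (cases "y \<in> coord c ` ?W")
        case True
        then have y: "y \<in> cball (coord c p) e" using img by blast
        then have "norm (volume_density g c (param c y)) \<le> M" "y \<in> coord c ` cdom c" using M e(2) by auto
        then have "chart_density c y \<le> M" by (simp add: chart_density_def)
        then show ?thesis using True y by (simp add: ennreal_leI)
      qed simp
    qed
    also have "\<dots> = ennreal M * emeasure lborel (cball (coord c p) e)"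
      by (rule nn_integral_cmult_indicator) simp
    also have "\<dots> < \<infinity>" using emeasure_bounded_finite[OF bounded_cball[of "coord c p" e]]
      by (simp add: ennreal_mult_less_top)
    finally show ?thesis using oW c e(1) by (intro exI[of _ ?W]) auto
  qed
  then obtain W where W: "\<And>p. open (W p)" "\<And>p. p \<in> W p" "\<And>p. emeasure vol (W p) < \<infinity>" by metis
  obtain F where F: "F \<subseteq> K" "finite F" "K \<subseteq> (\<Union>p\<in>F. W p)"
    using compactE_image[OF assms, of K W] W by (metis UN_iff subsetI)
  have "emeasure vol K \<le> emeasure vol (\<Union>p\<in>F. W p)"
    using F(2) W(1) by (intro emeasure_mono F(3)) auto
  also have "\<dots> \<le> (\<Sum>p\<in>F. emeasure vol (W p))"
    using F(2) W(1) by (intro emeasure_subadditive_finite) auto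
  also have "\<dots> < \<infinity>" using W(3) F(2) by simp
  finally show ?thesis .
qed

end

section \<open>Divergence and integration by parts\<close>

context oriented_manifold
begin

lemma continuous_on_coord_comp:
  assumes "c \<in> A" "continuous_on (coord c ` (cdom c \<inter> V)) f"
  shows "continuous_on (cdom c \<inter> V) (\<lambda>p. f (coord c p))"
  by (rule continuous_on_compose2[OF assms(2) continuous_on_subset[OF continuous_on_coord[OF assms(1)]]]) auto

text \<open>\<open>chart_at\<close> may jump from point to point. Continuity of a scalar defined
  through it is read off near each point from the expression in one fixed chart.\<close>

lemma continuous_on_charts:
  assumes V: "open V"
    and cont: "\<And>c. c \<in> A \<Longrightarrow> continuous_on (cdom c \<inter> V) (s c)"
    and eq: "\<And>c p. c \<in> A \<Longrightarrow> p \<in> cdom c \<Longrightarrow> p \<in> V \<Longrightarrow> f p = s c p"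
  shows "continuous_on V f"
proof (rule continuous_at_imp_continuous_on, rule ballI)
  fix p assume p: "p \<in> V"
  let ?c = "chart_at A p" and ?W = "cdom (chart_at A p) \<inter> V"
  have W: "open ?W" "p \<in> ?W" using chart_at[of p] open_Int[OF open_cdom[OF chart_at(1)] V] p by auto
  have "continuous_on ?W f"
    by (rule continuous_on_eq[OF cont[OF chart_at(1)[of p]]]) (use eq[OF chart_at(1)[of p]] in auto)
  then show "isCont f p" using W by (simp add: continuous_on_eq_continuous_at)
qed

lemma differential_cong:
  assumes "c \<in> A" "p \<in> cdom c" "open V" "p \<in> V" "\<And>q. q \<in> V \<Longrightarrow> u q = v q"
  shows "differential u c p = differential v c p"
proof -
  have "partial_deriv i (u \<circ> param c) (coord c p) = partial_deriv i (v \<circ> param c) (coord c p)" for i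
    by (rule partial_deriv_cong[OF open_coord_image[OF assms(1,3)]])
      (use assms coord_image_iff[OF assms(1), of _ V] in auto)
  then show ?thesis by (simp add: vec_eq_iff differential_nth)
qed

lemma differential_add:
  assumes "C1_fun V u" "C1_fun V v" "c \<in> A" "p \<in> cdom c" "p \<in> V"
  shows "differential (\<lambda>p. u p + v p) c p = differential u c p + differential v c p"
  using partial_deriv_add[OF C1_fun_differentiable[OF assms(1,3-5)] C1_fun_differentiable[OF assms(2,3-5)]]
  by (simp add: vec_eq_iff differential_nth comp_def)

lemma differential_chain:
  assumes "C1_fun V u" "c \<in> A" "p \<in> cdom c" "p \<in> V" "(h has_real_derivative h') (at (u p))"
  shows "differential (\<lambda>p. h (u p)) c p = h' *\<^sub>R differential u c p"
  using partial_deriv_chain_real[OF C1_fun_differentiable[OF assms(1-4)], of h h'] assms(5)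
  by (simp add: vec_eq_iff differential_nth comp_def param_coord[OF assms(2,3)])

lemma continuous_on_differential:
  assumes "C1_fun V u" "c \<in> A"
  shows "continuous_on (cdom c \<inter> V) (\<lambda>p. differential u c p $ i)"
  unfolding differential_nth
  by (rule continuous_on_coord_comp[OF assms(2) C1_on_partial_deriv[OF C1_funD[OF assms]]])

lemma continuous_on_vec:
  assumes "C1_vec V X" "c \<in> A"
  shows "continuous_on (cdom c \<inter> V) (\<lambda>p. X c p $ i)"
  by (rule continuous_on_eq[OF continuous_on_coord_comp[OF assms(2) C1_on_continuous[OF C1_vecD[OF assms, of i]]]])
    (simp add: param_coord[OF assms(2)])

definition pairing :: "('a \<Rightarrow> real) \<Rightarrow> ('a, 'n) vec_field \<Rightarrow> 'a \<Rightarrow> real"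
  where "pairing u X p = differential u (chart_at A p) p \<bullet> X (chart_at A p) p"

lemma pairing_chart:
  assumes "C1_fun V u" "C1_vec V X" "c \<in> A" "p \<in> cdom c" "p \<in> V"
  shows "pairing u X p = differential u c p \<bullet> X c p"
  unfolding pairing_def
  by (rule differential_inner_transform[OF assms(1,2) chart_at(1) assms(3) chart_at(2) assms(4,5)])

lemma continuous_on_pairing:
  assumes "C1_fun V u" "C1_vec V X"
  shows "continuous_on V (pairing u X)"
proof (rule continuous_on_charts[OF C1_fun_open[OF assms(1)]])
  show "continuous_on (cdom c \<inter> V) (\<lambda>p. differential u c p \<bullet> X c p)" if "c \<in> A" for c
    unfolding inner_vec_def inner_real_def
    by (intro continuous_intros continuous_on_differential continuous_on_vec assms that)
qed (rule pairing_chart[OF assms])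

end

context oriented_riemannian
begin

lemma measurable_continuous_on_open:
  fixes f :: "'a \<Rightarrow> real"
  assumes "open V" "continuous_on V f"
  shows "(\<lambda>p. indicator V p * f p) \<in> borel_measurable borel"
  using borel_measurable_continuous_on_indicator[OF borel_open[OF assms(1)] assms(2)] by simp

lemma set_integrable_bounded:
  fixes f :: "'a \<Rightarrow> real"
  assumes V: "open V" "continuous_on V f" and S: "S \<in> sets borel" "S \<subseteq> V"
    and fin: "emeasure vol S < \<infinity>" and bd: "\<And>p. p \<in> S \<Longrightarrow> \<bar>f p\<bar> \<le> B"
  shows "set_integrable vol S f"
proof -
  \<comment> \<open>\<open>f\<close> is continuous on \<open>V\<close> only; cutting it off to the
    open set \<open>V\<close> makes it a Borel function.\<close>
  have "integrable vol (\<lambda>p. indicator S p *\<^sub>R (indicator V p * f p))"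
    using measurable_continuous_on_open[OF V] S fin bd
    by (intro integrableI_bounded_set_indicator[where B = B]) (auto simp: subset_iff)
  moreover have "(\<lambda>p. indicator S p *\<^sub>R (indicator V p * f p)) = (\<lambda>p. indicator S p *\<^sub>R f p)"
    using S(2) by (auto simp: fun_eq_iff indicator_def)
  ultimately show ?thesis by (simp add: set_integrable_def)
qed

lemma set_integrable_compact_support:
  fixes f :: "'a \<Rightarrow> real"
  assumes V: "open V" "continuous_on V f" and K: "compact K" "K \<subseteq> V" "\<And>p. p \<in> V \<Longrightarrow> p \<notin> K \<Longrightarrow> f p = 0"
  shows "set_integrable vol V f"
proof -
  have "bounded (f ` K)"
    by (intro compact_imp_bounded compact_continuous_image continuous_on_subset[OF V(2) K(2)] K(1))
  then obtain B where B: "\<forall>z\<in>f ` K. norm z \<le> B" unfolding bounded_iff by blast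
  have "set_integrable vol K f"
    by (rule set_integrable_bounded[OF V _ K(2) emeasure_vol_compact[OF K(1)], of B])
      (use B borel_closed[OF compact_imp_closed[OF K(1)]] in auto)
  moreover have "(\<lambda>p. indicator V p *\<^sub>R f p) = (\<lambda>p. indicator K p *\<^sub>R f p)"
    using K(2,3) by (auto simp: fun_eq_iff indicator_def)
  ultimately show ?thesis by (simp add: set_integrable_def)
qed

text \<open>The expression of \<open>divergence\<close> in a prescribed chart. Integration by parts
  is first carried out chart by chart with it, before its independence of the chart is
  known.\<close>

definition chart_div :: "('a, 'n) vec_field \<Rightarrow> ('a, 'n) chart \<Rightarrow> 'a \<Rightarrow> real"
  where "chart_div X c p =
    (\<Sum>i\<in>UNIV. partial_deriv i ((\<lambda>q. volume_density g c q * X c q $ i) \<circ> param c) (coord c p))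
      / volume_density g c p"

lemma divergence_chart_div: "divergence A g X p = chart_div X (chart_at A p) p"
  by (simp add: divergence_def chart_div_def Let_def)

lemma C1_on_density_vec:
  assumes "C1_vec V X" "c \<in> A"
  shows "C1_on (coord c ` (cdom c \<inter> V)) ((\<lambda>q. volume_density g c q * X c q $ i) \<circ> param c)"
  unfolding comp_def
  by (intro C1_on_mult C1_vecD[OF assms] C1_on_subset[OF C1_on_volume_density[OF assms(2)]]
      open_coord_image[OF assms(2) C1_vec_open[OF assms(1)]]) blast

lemma continuous_on_chart_div:
  assumes "C1_vec V X" "c \<in> A"
  shows "continuous_on (cdom c \<inter> V) (chart_div X c)"
proof -
  have "continuous_on (cdom c \<inter> V) (volume_density g c)"
    by (rule continuous_on_eq[OF continuous_on_subset[OF continuous_on_coord_comp[OF assms(2), of UNIV]]])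
      (use C1_on_continuous[OF C1_on_volume_density[OF assms(2)]] param_coord[OF assms(2)] in auto)
  then show ?thesis
    unfolding chart_div_def
    using volume_density_pos[OF assms(2)]
    by (intro continuous_intros continuous_on_coord_comp assms(2) C1_on_partial_deriv
        C1_on_density_vec[OF assms]) (auto simp: less_imp_neq[THEN not_sym])
qed

text \<open>In coordinates the density times the integrand is the sum over \<open>i\<close> of the
  partial derivatives of \<open>u\<close> times the density times the component \<open>X_i\<close>,
  and these functions have compact support in the image of the chart.\<close>

lemma chart_integration_by_parts:
  assumes c: "c \<in> A" and u: "C1_fun V u" and X: "C1_vec V X"
    and K: "compact K" "K \<subseteq> cdom c \<inter> V" "\<And>p. p \<in> V \<Longrightarrow> p \<notin> K \<Longrightarrow> u p = 0"
  shows "(LINT p:cdom c \<inter> V|vol. u p * chart_div X c p + differential u c p \<bullet> X c p) = 0"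
proof -
  let ?W = "cdom c \<inter> V"
  let ?S = "coord c ` ?W" and ?K = "coord c ` K" and ?u = "u \<circ> param c"
  let ?w = "\<lambda>i. (\<lambda>q. volume_density g c q * X c q $ i) \<circ> param c"
  have V: "open V" by (rule C1_fun_open[OF u])
  have W: "open ?W" using open_cdom[OF c] V by auto
  have S: "open ?S" by (rule open_coord_image[OF c V])
  have Ssub: "param c y \<in> cdom c" "param c y \<in> V" "coord c (param c y) = y" if "y \<in> ?S" for y
    using that coord_image_iff[OF c, of y V] param_in_cdom[OF c] coord_param[OF c] by auto
  have K': "compact ?K"
    by (rule compact_continuous_image[OF continuous_on_subset[OF continuous_on_coord[OF c]] K(1)]) (use K(2) in auto)
  have KS: "?K \<subseteq> ?S" using K(2) by (rule image_mono)
  have oK: "open (- ?K)" using compact_imp_closed[OF K'] by auto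
  have u0: "?u y = 0" if "y \<in> ?S" "y \<notin> ?K" for y
  proof -
    have "param c y \<notin> K" using that Ssub(3)[OF that(1)] by (metis imageI)
    then show ?thesis using K(3) Ssub(2)[OF that(1)] by simp
  qed
  \<comment> \<open>The extension by zero is C1 on the whole space: the image of \<open>K\<close> is
    compact inside \<open>?S\<close>, so the open sets \<open>?S\<close> and \<open>- ?K\<close>
    cover the space.\<close>
  define F where "F i y = (if y \<in> ?S then ?u y * ?w i y else 0)" for i y
  have F1: "C1_on UNIV (F i)" for i
  proof (rule C1_on_local[OF _ open_UNIV])
    fix y :: "real^'n"
    have "C1_on ?S (\<lambda>y. ?u y * ?w i y)"
      by (intro C1_on_mult C1_funD[OF u c] C1_on_density_vec[OF X c])
    then have 1: "C1_on ?S (F i)" by (rule C1_on_cong) (simp add: F_def)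
    have 2: "C1_on (- ?K) (F i)"
      by (rule C1_on_cong[OF C1_on_const[OF oK, of 0]]) (use u0 in \<open>auto simp: F_def\<close>)
    show "\<exists>N. y \<in> N \<and> C1_on N (F i)"
    proof (cases "y \<in> ?S")
      case True
      with 1 show ?thesis by (intro exI[of _ ?S] conjI)
    next
      case False
      then have "y \<in> - ?K" using KS by blast
      with 2 show ?thesis by (intro exI[of _ "- ?K"] conjI)
    qed
  qed
  have F0: "F i y = 0" if "y \<notin> ?K" for i y using u0 that by (auto simp: F_def)
  note int = integral_partial_deriv_zero[OF F1 K' F0]
  let ?I = "\<lambda>p. u p * chart_div X c p + differential u c p \<bullet> X c p"
  have dF: "(\<Sum>i\<in>UNIV. partial_deriv i (F i) y)
      = indicator ?S y *\<^sub>R (volume_density g c (param c y) * ?I (param c y))" for y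
  proof (cases "y \<in> ?S")
    case True
    have "partial_deriv i (F i) y = ?u y * partial_deriv i (?w i) y + partial_deriv i ?u y * ?w i y" for i
    proof -
      have "partial_deriv i (F i) y = partial_deriv i (\<lambda>y. ?u y * ?w i y) y"
        by (rule partial_deriv_cong[OF S True]) (simp add: F_def)
      also have "\<dots> = ?u y * partial_deriv i (?w i) y + partial_deriv i ?u y * ?w i y"
        by (rule partial_deriv_mult[OF C1_on_differentiable[OF C1_funD[OF u c] True]
              C1_on_differentiable[OF C1_on_density_vec[OF X c] True]])
      finally show ?thesis .
    qed
    moreover have "volume_density g c (param c y) \<noteq> 0"
      using volume_density_pos[OF c Ssub(1)[OF True]] by simp
    moreover have "(\<Sum>i\<in>UNIV. ?u y * partial_deriv i (?w i) y + partial_deriv i ?u y * ?w i y)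
        = ?u y * (\<Sum>i\<in>UNIV. partial_deriv i (?w i) y)
          + volume_density g c (param c y) * (\<Sum>i\<in>UNIV. partial_deriv i ?u y * X c (param c y) $ i)"
      by (simp add: sum.distrib sum_distrib_left mult.left_commute)
    ultimately show ?thesis
      using True Ssub(3)[OF True]
      by (simp add: chart_div_def inner_vec_def differential_nth field_simps)
  next
    case False
    then have "y \<in> - ?K" using KS by blast
    then have "partial_deriv i (F i) y = 0" for i
      using partial_deriv_cong[OF oK, of y "F i" "\<lambda>_. 0" i] F0 by simp
    then show ?thesis using False by simp
  qed
  have contI: "continuous_on ?W ?I"
    unfolding inner_vec_def inner_real_def
    by (intro continuous_intros continuous_on_chart_div[OF X c] continuous_on_differential[OF u c]
        continuous_on_vec[OF X c] continuous_on_subset[OF C1_fun_continuous[OF u]]) auto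
  have "(LINT p:?W|vol. ?I p) = (LINT y:?S|lborel. volume_density g c (param c y) * ?I (param c y))"
    using W by (intro set_integral_chart(2)[OF c _ _ measurable_continuous_on_open[OF W contI]]) auto
  also have "\<dots> = (LINT y|lborel. (\<Sum>i\<in>UNIV. partial_deriv i (F i) y))"
    unfolding set_lebesgue_integral_def dF ..
  also have "\<dots> = 0" using int by (subst Bochner_Integration.integral_sum) auto
  finally show ?thesis .
qed

lemma vol_open_pos:
  assumes "open W" "W \<noteq> {}"
  shows "emeasure vol W \<noteq> 0"
proof
  assume 0: "emeasure vol W = 0"
  obtain p where p: "p \<in> W" using assms(2) by blast
  let ?c = "chart_at A p" and ?B = "cdom (chart_at A p) \<inter> W"
  have c: "?c \<in> A" "p \<in> cdom ?c" by (rule chart_at)+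
  have oB: "open ?B" using open_cdom[OF c(1)] assms(1) by auto
  have "emeasure vol ?B \<le> emeasure vol W" using assms(1) by (intro emeasure_mono) auto
  then have "chart_volume ?c ?B = 0" using 0 emeasure_vol[OF c(1), of ?B] oB by simp
  then have "AE y in lborel. ennreal (indicator (coord ?c ` ?B) y * chart_density ?c y) = 0"
    unfolding chart_volume_def
    using measurable_chart_density[OF c(1)] borel_open[OF open_coord_image[OF c(1) assms(1)]]
    by (subst (asm) nn_integral_0_iff_AE) auto
  then have "AE y in lborel. y \<notin> coord ?c ` ?B"
  proof (rule AE_mp, intro AE_I2 impI notI)
    fix y assume z: "ennreal (indicator (coord ?c ` ?B) y * chart_density ?c y) = 0" and y: "y \<in> coord ?c ` ?B"
    then obtain q where "q \<in> ?B" "y = coord ?c q" by blast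
    then have "chart_density ?c y > 0"
      using volume_density_pos[OF c(1)] param_coord[OF c(1)] by (auto simp: chart_density_def)
    then show False using z y by simp
  qed
  then have "coord ?c ` ?B \<in> null_sets lborel"
    using borel_open[OF open_coord_image[OF c(1) assms(1)]] by (subst (asm) AE_iff_null_sets[symmetric]) auto
  then have "negligible (coord ?c ` ?B)" by (simp add: negligible_iff_null_sets null_sets_completionI)
  then show False
    using open_not_negligible[OF open_coord_image[OF c(1) assms(1)]] c(2) p by auto
qed

text \<open>
  The coordinate expressions for the divergence agree since they have the same integrals against
  all test functions.
\<close>

lemma chart_div_invariant:
  assumes X: "C1_vec V X" and c: "c \<in> A" "c' \<in> A" and p: "p \<in> cdom c" "p \<in> cdom c'" "p \<in> V"
  shows "chart_div X c p = chart_div X c' p"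
proof (rule ccontr)
  let ?W = "cdom c \<inter> cdom c' \<inter> V"
  let ?d = "\<lambda>q. chart_div X c q - chart_div X c' q"
  assume "chart_div X c p \<noteq> chart_div X c' p"
  then have dp: "?d p \<noteq> 0" by simp
  have W: "open ?W" using open_cdom[OF c(1)] open_cdom[OF c(2)] C1_vec_open[OF X] by auto
  have XW: "C1_vec ?W X" by (rule C1_vec_subset[OF X W]) auto
  have Wsub: "?W \<subseteq> cdom c" "?W \<subseteq> cdom c'" by auto
  have Wc: "cdom c \<inter> ?W = ?W" "cdom c' \<inter> ?W = ?W" by auto
  have contc: "continuous_on ?W (chart_div X c)" and contc': "continuous_on ?W (chart_div X c')"
    using continuous_on_chart_div[OF XW c(1)] continuous_on_chart_div[OF XW c(2)] unfolding Wc .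
  have contd: "continuous_on ?W (\<lambda>q. ?d q * ?d p)"
    by (intro continuous_intros contc contc')
  \<comment> \<open>On \<open>W'\<close> the difference has the sign it has at \<open>p\<close>, so
    a bump supported there makes the integrand below nonnegative.\<close>
  define W' where "W' = ?W \<inter> (\<lambda>q. ?d q * ?d p) -` {0<..}"
  have W': "open W'" unfolding W'_def by (rule continuous_open_preimage[OF contd W]) simp
  have pW': "p \<in> W'" using p dp by (simp add: W'_def) (metis not_real_square_gt_zero eq_iff_diff_eq_0)
  obtain b d K N where "is_bump W' p b d K N" using ex_bump[OF W' pW'] by blast
  note b = is_bumpD[OF this]
  have bW: "C1_fun ?W b" by (rule C1_fun_subset[OF b(1) W]) simp
  have KW: "K \<subseteq> ?W" using b(7) by (auto simp: W'_def)
  have contb: "continuous_on ?W b" by (rule C1_fun_continuous[OF bW])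
  \<comment> \<open>Both charts contain \<open>?W\<close>, so integration by parts can be done in
    either. The \<open>pairing\<close> terms coincide and cancel in the difference.\<close>
  have i0: "(LINT q:?W|vol. b q * chart_div X e q + pairing b X q) = 0"
    if e: "e \<in> A" "?W \<subseteq> cdom e" for e
  proof -
    have We: "cdom e \<inter> ?W = ?W" using e(2) by blast
    have "(LINT q:cdom e \<inter> ?W|vol. b q * chart_div X e q + differential b e q \<bullet> X e q) = 0"
      by (rule chart_integration_by_parts[OF e(1) bW XW b(6)]) (use KW e(2) b(8) in auto)
    moreover have "(LINT q:?W|vol. b q * chart_div X e q + pairing b X q)
        = (LINT q:?W|vol. b q * chart_div X e q + differential b e q \<bullet> X e q)"
      by (rule set_lebesgue_integral_cong) (use W e pairing_chart[OF bW XW e(1)] in auto)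
    ultimately show ?thesis unfolding We by simp
  qed
  have dK: "pairing b X q = 0" if "q \<in> ?W" "q \<notin> K" for q
  proof -
    have op: "open (?W - K)" using W compact_imp_closed[OF b(6)] by (rule open_Diff)
    have "differential b c q = differential (\<lambda>q. 0) c q"
      by (rule differential_cong[OF c(1) _ op]) (use that b(8) in auto)
    also have "\<dots> = 0" by (simp add: vec_eq_iff differential_nth comp_def)
    finally show ?thesis using pairing_chart[OF bW XW c(1)] that by simp
  qed
  have int: "set_integrable vol ?W (\<lambda>q. b q * chart_div X e q + pairing b X q)"
    if "continuous_on ?W (chart_div X e)" for e
    by (rule set_integrable_compact_support[OF W _ b(6) KW])
      (auto intro!: continuous_intros contb that continuous_on_pairing[OF bW XW] simp: b(8) dK)
  have "(LINT q:?W|vol. (b q * chart_div X c q + pairing b X q) - (b q * chart_div X c' q + pairing b X q)) = 0"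
    using i0[OF c(1) Wsub(1)] i0[OF c(2) Wsub(2)] by (subst set_integral_diff(2)[OF int[OF contc] int[OF contc']]) auto
  then have "(LINT q:?W|vol. b q * ?d q) = 0"
    by (simp add: right_diff_distrib)
  then have "(LINT q:?W|vol. (b q * ?d q) * ?d p) = 0"
    unfolding set_integral_mult_left by simp
  moreover have "set_integrable vol ?W (\<lambda>q. (b q * ?d q) * ?d p)"
    by (rule set_integrable_compact_support[OF W _ b(6) KW])
      (auto intro!: continuous_intros contb contc contc' simp: b(8))
  moreover have nonneg: "0 \<le> indicator ?W q * ((b q * ?d q) * ?d p)" for q
  proof (cases "q \<in> K")
    case True
    then have "?d q * ?d p > 0" using b(7) by (auto simp: W'_def)
    then have "0 \<le> b q * (?d q * ?d p)" by (rule mult_nonneg_nonneg[OF b(9) less_imp_le])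
    then have "0 \<le> (b q * ?d q) * ?d p" by (simp only: mult.assoc)
    then show ?thesis by (rule mult_nonneg_nonneg[OF indicator_pos_le])
  qed (simp add: b(8))
  ultimately have "AE q in vol. indicator ?W q * ((b q * ?d q) * ?d p) = 0"
    unfolding set_lebesgue_integral_def set_integrable_def
    using integral_nonneg_eq_0_iff_AE[of vol "\<lambda>q. indicator ?W q * ((b q * ?d q) * ?d p)"] by simp
  then have "AE q in vol. q \<notin> N"
  proof (rule AE_mp, intro AE_I2 impI notI)
    fix q assume z: "indicator ?W q * ((b q * ?d q) * ?d p) = 0" and q: "q \<in> N"
    then have "q \<in> W'" using b(7,10) by blast
    then have "q \<in> ?W" "?d q * ?d p > 0" by (auto simp: W'_def)
    then show False using z b(4)[OF q] by auto
  qed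
  then have "emeasure vol N = 0"
    using b(2) by (subst (asm) AE_iff_measurable[where N = N]) auto
  then show False using vol_open_pos[OF b(2)] b(3) by blast
qed

lemma divergence_chart:
  assumes "C1_vec V X" "c \<in> A" "p \<in> cdom c" "p \<in> V"
  shows "divergence A g X p = chart_div X c p"
  unfolding divergence_chart_div
  by (rule chart_div_invariant[OF assms(1) chart_at(1) assms(2) chart_at(2) assms(3,4)])

lemma continuous_on_divergence:
  assumes "C1_vec V X"
  shows "continuous_on V (divergence A g X)"
  by (rule continuous_on_charts[OF C1_vec_open[OF assms] continuous_on_chart_div[OF assms] divergence_chart[OF assms]])

text \<open>In place of a partition of unity, bumps are split off one at a time:
  \<open>u = b u + (1 - b) u\<close>, where the first part lives in a single chart. The induction is
  on the number of neighbourhoods covering the support.\<close>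

lemma integration_by_parts_compact_support:
  assumes u: "C1_fun V u" and X: "C1_vec V X"
    and K: "compact K" "K \<subseteq> V" "\<And>p. p \<in> V \<Longrightarrow> p \<notin> K \<Longrightarrow> u p = 0"
  shows "(LINT p:V|vol. u p * divergence A g X p + pairing u X p) = 0"
proof -
  let ?I = "\<lambda>u p. u p * divergence A g X p + pairing u X p"
  have V: "open V" by (rule C1_fun_open[OF u])
  have contI: "continuous_on V (?I u)" if "C1_fun V u" for u
    by (intro continuous_intros C1_fun_continuous continuous_on_divergence continuous_on_pairing X that)
  have I0: "?I u q = 0" if "C1_fun V u" "compact K" "\<And>p. p \<in> V \<Longrightarrow> p \<notin> K \<Longrightarrow> u p = 0" "q \<in> V" "q \<notin> K" for u K q
  proof -
    have op: "open (V - K)" using V compact_imp_closed[OF that(2)] by (rule open_Diff)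
    have "differential u (chart_at A q) q = differential (\<lambda>q. 0) (chart_at A q) q"
      by (rule differential_cong[OF chart_at op]) (use that in auto)
    also have "\<dots> = 0" by (simp add: vec_eq_iff differential_nth comp_def)
    finally show ?thesis using that by (simp add: pairing_def)
  qed
  have int: "set_integrable vol V (?I u)" if "C1_fun V u" "compact K" "K \<subseteq> V" "\<And>p. p \<in> V \<Longrightarrow> p \<notin> K \<Longrightarrow> u p = 0" for u K
    by (rule set_integrable_compact_support[OF V contI[OF that(1)] that(2,3)]) (rule I0[OF that(1,2,4)])
  obtain b C KK N where "\<And>p. p \<in> V \<Longrightarrow> is_bump V p (b p) (C p) (KK p) (N p)"
    using ex_bump[OF V] by metis
  note zp = is_bumpD[OF this]
  have main: "(LINT p:V|vol. ?I u p) = 0"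
    if "finite F" "F \<subseteq> V" "C1_fun V u" "compact K" "K \<subseteq> V" "\<And>p. p \<in> V \<Longrightarrow> p \<notin> K \<Longrightarrow> u p = 0"
      "K \<subseteq> (\<Union>p\<in>F. N p)" for F u K
    using that
  proof (induction F arbitrary: u K rule: finite_induct)
    case empty
    have "?I u p = 0" if "p \<in> V" for p
      by (rule I0[OF empty(2,3,5) that]) (use empty in auto)
    then have "(LINT p:V|vol. ?I u p) = (LINT p:V|vol. 0)"
      using V by (intro set_lebesgue_integral_cong) auto
    then show ?case by (simp add: set_lebesgue_integral_def)
  next
    case (insert p F)
    have p: "p \<in> V" using insert.prems(1) by simp
    let ?b = "b p" and ?c = "C p"
    let ?u1 = "\<lambda>q. ?b q * u q" and ?u2 = "\<lambda>q. (1 - ?b q) * u q"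
    have bV: "C1_fun V ?b" by (rule C1_fun_subset[OF zp(1)[OF p] V]) simp
    have u1: "C1_fun V ?u1" by (rule C1_fun_mult[OF bV insert.prems(2)])
    have u2: "C1_fun V ?u2" by (intro C1_fun_mult C1_fun_diff C1_fun_const bV V insert.prems(2))
    have K1: "?u1 q = 0" if "q \<in> V" "q \<notin> KK p" for q using zp(8)[OF p that(2)] by simp
    have K2: "?u2 q = 0" if "q \<in> V" "q \<notin> K - N p" for q
      using insert.prems(5)[OF that(1)] zp(4)[OF p, of q] that(2) by auto
    \<comment> \<open>The bump equals 1 on the open set \<open>N p\<close>, so the remainder
      vanishes there, and its support is covered with \<open>N p\<close> left out.\<close>
    have cK2: "compact (K - N p)" by (rule compact_diff[OF insert.prems(3) zp(2)[OF p]])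
    have sK1: "KK p \<subseteq> V" using zp(7)[OF p] by blast
    have i1: "(LINT q:V|vol. ?I ?u1 q) = 0"
    proof -
      let ?W = "cdom ?c \<inter> V"
      have "(LINT q:V|vol. ?I ?u1 q) = (LINT q:?W|vol. ?u1 q * chart_div X ?c q + differential ?u1 ?c q \<bullet> X ?c q)"
        unfolding set_lebesgue_integral_def
      proof (rule Bochner_Integration.integral_cong[OF refl])
        fix q
        show "indicator V q *\<^sub>R ?I ?u1 q = indicator ?W q *\<^sub>R (?u1 q * chart_div X ?c q + differential ?u1 ?c q \<bullet> X ?c q)"
        proof (cases "q \<in> ?W")
          case True
          then show ?thesis
            using divergence_chart[OF X zp(5)[OF p]] pairing_chart[OF u1 X zp(5)[OF p]] by simp
        next
          case False
          then have "q \<in> V \<Longrightarrow> ?I ?u1 q = 0"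
            by (intro I0[OF u1 zp(6)[OF p] K1]) (use zp(7)[OF p] in auto)
          then show ?thesis using False by (auto simp: indicator_def)
        qed
      qed
      also have "\<dots> = 0"
        by (rule chart_integration_by_parts[OF zp(5)[OF p] u1 X zp(6,7)[OF p] K1])
      finally show ?thesis .
    qed
    have i2: "(LINT q:V|vol. ?I ?u2 q) = 0"
      by (rule insert.IH[OF _ u2 cK2]) (use insert.prems K2 in auto)
    have "?I u q = ?I ?u1 q + ?I ?u2 q" if "q \<in> V" for q
    proof -
      have "differential (\<lambda>q. ?u1 q + ?u2 q) (chart_at A q) q
          = differential ?u1 (chart_at A q) q + differential ?u2 (chart_at A q) q"
        by (rule differential_add[OF u1 u2 chart_at that])
      moreover have "(\<lambda>q. ?u1 q + ?u2 q) = u" by (auto simp: algebra_simps)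
      ultimately have "pairing u X q = pairing ?u1 X q + pairing ?u2 X q"
        by (simp add: pairing_def inner_add_left)
      then show ?thesis by (simp add: algebra_simps)
    qed
    then have "(LINT q:V|vol. ?I u q) = (LINT q:V|vol. ?I ?u1 q + ?I ?u2 q)"
      using V by (intro set_lebesgue_integral_cong) auto
    also have "\<dots> = (LINT q:V|vol. ?I ?u1 q) + (LINT q:V|vol. ?I ?u2 q)"
      by (rule set_integral_add(2)[OF int[OF u1 zp(6)[OF p] sK1 K1] int[OF u2 cK2 _ K2]])
        (use insert.prems(4) in auto)
    finally show ?case using i1 i2 by simp
  qed
  have op: "open (N p)" if "p \<in> K" for p using zp(2) K(2) that by blast
  have cov: "K \<subseteq> (\<Union>p\<in>K. N p)" using zp(3) K(2) by blast
  obtain F where F: "F \<subseteq> K" "finite F" "K \<subseteq> (\<Union>p\<in>F. N p)"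
    using compactE_image[OF K(1) op cov] by metis
  show ?thesis
    by (rule main[OF F(2) _ u K F(3)]) (use F(1) K(2) in auto)
qed

text \<open>In each chart, \<open>negligible_regular_zero_set\<close> discards the zeros of
  \<open>u\<close> at which a given partial derivative is nonzero. There are countably many charts
  and finitely many directions, and vanishing of the differential does not depend on the
  chart.\<close>

lemma AE_zero_differential:
  assumes u: "C1_fun V u"
  shows "AE p in vol. p \<in> V \<longrightarrow> u p = 0 \<longrightarrow> differential u (chart_at A p) p = 0"
proof -
  obtain cs :: "nat \<Rightarrow> ('a, 'n) chart" where cs': "(\<forall>n. cs n \<in> A) \<and> (\<Union>n. cdom (cs n)) = UNIV"
    using countable_atlas ..
  then have cs: "\<And>n. cs n \<in> A" "(\<Union>n. cdom (cs n)) = UNIV" by simp_all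
  define B where "B n i = {p \<in> cdom (cs n) \<inter> V. u p = 0 \<and> differential u (cs n) p $ i \<noteq> 0}" for n i
  have B: "B n i \<in> null_sets vol" for n i
  proof (rule null_setsI)
    let ?W = "cdom (cs n) \<inter> V"
    have W: "open ?W" using open_cdom[OF cs(1)] C1_fun_open[OF u] by auto
    have m1: "(\<lambda>p. indicator ?W p * u p) \<in> borel_measurable borel"
      by (rule measurable_continuous_on_open[OF W continuous_on_subset[OF C1_fun_continuous[OF u]]]) auto
    have m2: "(\<lambda>p. indicator ?W p * differential u (cs n) p $ i) \<in> borel_measurable borel"
      by (rule measurable_continuous_on_open[OF W continuous_on_differential[OF u cs(1)]])
    have "B n i = ?W \<inter> {p. indicator ?W p * u p = 0} \<inter> {p. indicator ?W p * differential u (cs n) p $ i \<noteq> 0}"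
      by (auto simp: B_def indicator_def)
    moreover have "{p. indicator ?W p * u p = 0} \<in> sets borel"
      using measurable_sets[OF m1, of "{0}"] by (simp add: vimage_def)
    moreover have "{p. indicator ?W p * differential u (cs n) p $ i \<noteq> 0} \<in> sets borel"
      using measurable_sets[OF m2, of "- {0}"] by (simp add: vimage_def)
    ultimately have sB: "B n i \<in> sets borel" using W by auto
    then show "B n i \<in> sets vol" by simp
    have Bsub: "B n i \<subseteq> cdom (cs n)" by (auto simp: B_def)
    have "coord (cs n) ` B n i \<subseteq> {y \<in> coord (cs n) ` ?W.
        (u \<circ> param (cs n)) y = 0 \<and> partial_deriv i (u \<circ> param (cs n)) y \<noteq> 0}"
      by (auto simp: B_def param_coord[OF cs(1)] differential_nth)
    then have "negligible (coord (cs n) ` B n i)"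
      by (rule negligible_subset[OF negligible_regular_zero_set[OF C1_funD[OF u cs(1)]]])
    then have "coord (cs n) ` B n i \<in> null_sets lebesgue"
      by (simp add: negligible_iff_null_sets)
    then have "emeasure lborel (coord (cs n) ` B n i) = 0"
      using measurable_coord_image[OF cs(1) Bsub sB] by (simp add: null_sets_def)
    then show "emeasure vol (B n i) = 0"
      by (rule null_sets_vol[OF cs(1) sB Bsub])
  qed
  have "AE p in vol. \<forall>n. \<forall>i\<in>UNIV. p \<notin> B n i"
    unfolding AE_all_countable
    by (intro allI AE_finite_allI AE_not_in B) simp
  then show ?thesis
  proof (rule AE_mp, intro AE_I2 impI)
    fix p assume p: "\<forall>n. \<forall>i\<in>UNIV. p \<notin> B n i" "p \<in> V" "u p = 0"
    obtain n where n: "p \<in> cdom (cs n)" using cs(2) by blast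
    have "differential u (cs n) p = 0" using p n by (auto simp: B_def vec_eq_iff)
    then show "differential u (chart_at A p) p = 0"
      using differential_transform[OF u chart_at(1) cs(1) chart_at(2) n p(2)] by simp
  qed
qed

end


subsection \<open>Functions vanishing on the boundary\<close>

lemma quartic_add_pos:
  fixes s \<delta> :: real
  assumes "\<delta> > 0"
  shows "0 < s ^ 4 + \<delta>"
proof -
  have "0 \<le> s ^ 4" by (rule zero_le_even_power) simp
  then show ?thesis using assms by linarith
qed

text \<open>
  A smoothed identity that vanishes near zero: composing a function which vanishes on the boundary
  with it gives a function of compact support.
\<close>

definition cutoff :: "real \<Rightarrow> real \<Rightarrow> real"
  where "cutoff \<delta> s = s * (max 0 (s\<^sup>2 - \<delta>\<^sup>2))\<^sup>2 / (s ^ 4 + \<delta>)"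

definition cutoff' :: "real \<Rightarrow> real \<Rightarrow> real"
  where "cutoff' \<delta> s = ((max 0 (s\<^sup>2 - \<delta>\<^sup>2))\<^sup>2 + 4 * s\<^sup>2 * max 0 (s\<^sup>2 - \<delta>\<^sup>2)) / (s ^ 4 + \<delta>)
    - 4 * s ^ 4 * (max 0 (s\<^sup>2 - \<delta>\<^sup>2))\<^sup>2 / (s ^ 4 + \<delta>)\<^sup>2"

lemma DERIV_cutoff:
  assumes "\<delta> > 0"
  shows "(cutoff \<delta> has_real_derivative cutoff' \<delta> s) (at s)"
proof -
  let ?m = "max 0 (s\<^sup>2 - \<delta>\<^sup>2)"
  have D: "s ^ 4 + \<delta> \<noteq> 0" using quartic_add_pos[OF assms, of s] by simp
  have "((\<lambda>s. s\<^sup>2 - \<delta>\<^sup>2) has_real_derivative 2 * s) (at s)"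
    by (auto intro!: derivative_eq_intros)
  from DERIV_chain2[OF DERIV_max_zero_square this]
  have "((\<lambda>s. (max 0 (s\<^sup>2 - \<delta>\<^sup>2))\<^sup>2) has_real_derivative 2 * ?m * (2 * s)) (at s)" .
  from DERIV_mult[OF DERIV_ident this]
  have 1: "((\<lambda>s. s * (max 0 (s\<^sup>2 - \<delta>\<^sup>2))\<^sup>2) has_real_derivative 1 * ?m\<^sup>2 + 2 * ?m * (2 * s) * s) (at s)" .
  have 2: "((\<lambda>s. s ^ 4 + \<delta>) has_real_derivative 4 * s ^ 3) (at s)"
    by (auto intro!: derivative_eq_intros)
  have e: "((1 * ?m\<^sup>2 + 2 * ?m * (2 * s) * s) * (s ^ 4 + \<delta>) - s * ?m\<^sup>2 * (4 * s ^ 3)) / ((s ^ 4 + \<delta>) * (s ^ 4 + \<delta>))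
      = cutoff' \<delta> s"
  proof -
    have "(a * (s ^ 4 + \<delta>) - b) / ((s ^ 4 + \<delta>) * (s ^ 4 + \<delta>)) = a / (s ^ 4 + \<delta>) - b / (s ^ 4 + \<delta>)\<^sup>2" for a b
      using D by (simp add: diff_divide_distrib power2_eq_square)
    moreover have "1 * ?m\<^sup>2 + 2 * ?m * (2 * s) * s = ?m\<^sup>2 + 4 * s\<^sup>2 * ?m" "s * ?m\<^sup>2 * (4 * s ^ 3) = 4 * s ^ 4 * ?m\<^sup>2"
      by (simp_all add: power2_eq_square power3_eq_cube power4_eq_xxxx)
    ultimately show ?thesis unfolding cutoff'_def by (simp only:)
  qed
  show ?thesis
    using DERIV_divide[OF 1 2 D] unfolding e cutoff_def[abs_def] .
qed

lemma C1_on_cutoff: "\<delta> > 0 \<Longrightarrow> C1_on UNIV (cutoff \<delta>)"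
proof (rule C1_on_real[OF open_UNIV DERIV_cutoff])
  assume "\<delta> > 0"
  then have "s ^ 4 + \<delta> \<noteq> 0" for s :: real using quartic_add_pos[of \<delta> s] by simp
  then show "continuous_on UNIV (cutoff' \<delta>)"
    unfolding cutoff'_def[abs_def] by (intro continuous_intros) auto
qed

lemma cutoff_eq_0:
  assumes "\<bar>s\<bar> \<le> \<delta>"
  shows "cutoff \<delta> s = 0"
proof -
  have "s\<^sup>2 \<le> \<delta>\<^sup>2" using assms by (metis abs_ge_zero power2_abs power_mono)
  then show ?thesis by (simp add: cutoff_def)
qed

text \<open>The bounds are uniform in \<open>\<delta>\<close>, as domination requires. In
  \<open>cutoff'\<close> the first fraction lies between 0 and \<open>1 + 4\<close> and the second
  between 0 and 4, hence the constant 9.\<close>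

lemma cutoff_bounds:
  assumes "\<delta> > 0"
  shows "\<bar>cutoff \<delta> s\<bar> \<le> \<bar>s\<bar>" "\<bar>cutoff' \<delta> s\<bar> \<le> 9"
proof -
  let ?m = "max 0 (s\<^sup>2 - \<delta>\<^sup>2)" and ?D = "s ^ 4 + \<delta>"
  have s4: "s ^ 4 = (s\<^sup>2)\<^sup>2" using power_mult[of s 2 2] by simp
  have s4_nonneg: "0 \<le> s ^ 4" unfolding s4 by simp
  have D: "?D > 0" "s ^ 4 \<le> ?D" using s4_nonneg assms by linarith+
  have m: "0 \<le> ?m" "?m \<le> s\<^sup>2" by auto
  have m2: "?m\<^sup>2 \<le> s ^ 4" unfolding s4 using m by (intro power_mono)
  have m3: "4 * s\<^sup>2 * ?m \<le> 4 * s ^ 4"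
    unfolding s4 power2_eq_square[of "s\<^sup>2"] using mult_left_mono[OF m(2), of "s\<^sup>2"] by simp
  have q: "0 \<le> ?m\<^sup>2 / ?D" "?m\<^sup>2 / ?D \<le> 1" using m2 D by (auto simp: divide_le_eq)
  have "\<bar>cutoff \<delta> s\<bar> = \<bar>s\<bar> * (?m\<^sup>2 / ?D)"
    using D by (simp add: cutoff_def abs_mult)
  also have "\<dots> \<le> \<bar>s\<bar> * 1" by (rule mult_left_mono[OF q(2)]) simp
  finally show "\<bar>cutoff \<delta> s\<bar> \<le> \<bar>s\<bar>" by simp
  have a: "0 \<le> (?m\<^sup>2 + 4 * s\<^sup>2 * ?m) / ?D" "(?m\<^sup>2 + 4 * s\<^sup>2 * ?m) / ?D \<le> 5"
    using m2 m3 m D by (auto simp: divide_le_eq)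
  have r: "0 \<le> s ^ 4 / ?D" "s ^ 4 / ?D \<le> 1" using s4_nonneg D by (auto simp: divide_le_eq)
  have "4 * s ^ 4 * ?m\<^sup>2 / ?D\<^sup>2 = 4 * ((s ^ 4 / ?D) * (?m\<^sup>2 / ?D))" by (simp add: power2_eq_square[of ?D])
  moreover have "(s ^ 4 / ?D) * (?m\<^sup>2 / ?D) \<le> 1 * 1" using q r by (intro mult_mono) auto
  moreover have "0 \<le> (s ^ 4 / ?D) * (?m\<^sup>2 / ?D)" using q r by (intro mult_nonneg_nonneg)
  ultimately show "\<bar>cutoff' \<delta> s\<bar> \<le> 9" using a unfolding cutoff'_def by linarith
qed

text \<open>At \<open>s = 0\<close> every \<open>cutoff' \<delta> s\<close> is zero and the limit 1
  fails; this is the exception that \<open>AE_zero_differential\<close> takes care of.\<close>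

lemma cutoff_tendsto:
  assumes "\<delta> \<longlonglongrightarrow> 0"
  shows "(\<lambda>k. cutoff (\<delta> k) s) \<longlonglongrightarrow> s" "s \<noteq> 0 \<Longrightarrow> (\<lambda>k. cutoff' (\<delta> k) s) \<longlonglongrightarrow> 1"
proof -
  let ?m = "\<lambda>k. max 0 (s\<^sup>2 - (\<delta> k)\<^sup>2)" and ?D = "\<lambda>k. s ^ 4 + \<delta> k"
  have m: "?m \<longlonglongrightarrow> s\<^sup>2"
  proof -
    have "?m \<longlonglongrightarrow> max 0 (s\<^sup>2 - 0\<^sup>2)" by (intro tendsto_intros assms)
    then show ?thesis by simp
  qed
  have D: "?D \<longlonglongrightarrow> s ^ 4"
  proof -
    have "?D \<longlonglongrightarrow> s ^ 4 + 0" by (intro tendsto_intros assms)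
    then show ?thesis by simp
  qed
  show "(\<lambda>k. cutoff (\<delta> k) s) \<longlonglongrightarrow> s"
  proof (cases "s = 0")
    case False
    have "(\<lambda>k. cutoff (\<delta> k) s) \<longlonglongrightarrow> s * (s\<^sup>2)\<^sup>2 / s ^ 4"
      unfolding cutoff_def using False by (intro tendsto_intros m D) auto
    then show ?thesis using False by (simp add: power4_eq_xxxx power2_eq_square)
  qed (simp add: cutoff_def)
  assume s: "s \<noteq> 0"
  have "(\<lambda>k. cutoff' (\<delta> k) s) \<longlonglongrightarrow> ((s\<^sup>2)\<^sup>2 + 4 * s\<^sup>2 * s\<^sup>2) / s ^ 4 - 4 * s ^ 4 * (s\<^sup>2)\<^sup>2 / (s ^ 4)\<^sup>2"
    unfolding cutoff'_def using s by (intro tendsto_intros m D) auto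
  moreover have "((s\<^sup>2)\<^sup>2 + 4 * s\<^sup>2 * s\<^sup>2) / s ^ 4 - 4 * s ^ 4 * (s\<^sup>2)\<^sup>2 / (s ^ 4)\<^sup>2 = 1"
    using s by (simp add: field_simps power4_eq_xxxx power2_eq_square)
  ultimately show "(\<lambda>k. cutoff' (\<delta> k) s) \<longlonglongrightarrow> 1" by simp
qed

context oriented_riemannian
begin

lemma set_integrable_domain:
  fixes f :: "'a \<Rightarrow> real"
  assumes "open \<Omega>" "compact (closure \<Omega>)" "open V" "continuous_on V f" "closure \<Omega> \<subseteq> V"
  shows "set_integrable vol \<Omega> f"
proof -
  have "bounded (f ` closure \<Omega>)"
    by (intro compact_imp_bounded compact_continuous_image continuous_on_subset[OF assms(4,5)] assms(2))
  then obtain B where B: "\<forall>z\<in>f ` closure \<Omega>. norm z \<le> B" unfolding bounded_iff by blast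
  have "emeasure vol \<Omega> \<le> emeasure vol (closure \<Omega>)"
    by (intro emeasure_mono closure_subset) simp
  then have fin: "emeasure vol \<Omega> < \<infinity>" using emeasure_vol_compact[OF assms(2)] by (rule le_less_trans)
  have sub: "\<Omega> \<subseteq> closure \<Omega>" by (rule closure_subset)
  show ?thesis
    by (rule set_integrable_bounded[OF assms(3,4) _ _ fin, of B]) (use assms(1,5) B sub in auto)
qed

lemma integration_by_parts:
  assumes \<Omega>: "open \<Omega>" "compact (closure \<Omega>)" and V: "closure \<Omega> \<subseteq> V"
    and u: "C1_fun V u" and X: "C1_vec V X" and u0: "\<And>p. p \<in> frontier \<Omega> \<Longrightarrow> u p = 0"
  shows "(LINT p:\<Omega>|vol. u p * divergence A g X p) = - (LINT p:\<Omega>|vol. pairing u X p)"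
proof -
  let ?div = "divergence A g X" and ?P = "pairing u X"
  have oV: "open V" by (rule C1_fun_open[OF u])
  have sub: "\<Omega> \<subseteq> closure \<Omega>" by (rule closure_subset)
  have \<Omega>V: "\<Omega> \<subseteq> V" using sub V by blast
  have u\<Omega>: "C1_fun \<Omega> u" and X\<Omega>: "C1_vec \<Omega> X"
    by (rule C1_fun_subset[OF u \<Omega>(1) \<Omega>V], rule C1_vec_subset[OF X \<Omega>(1) \<Omega>V])
  have contu: "continuous_on V u" and contd: "continuous_on V ?div" and contP: "continuous_on V ?P"
    by (rule C1_fun_continuous[OF u], rule continuous_on_divergence[OF X], rule continuous_on_pairing[OF u X])
  have i1: "set_integrable vol \<Omega> (\<lambda>p. u p * ?div p)" and i2: "set_integrable vol \<Omega> ?P"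
    by (rule set_integrable_domain[OF \<Omega> oV _ V], intro continuous_intros contu contd)
      (rule set_integrable_domain[OF \<Omega> oV contP V])
  define \<delta> where "\<delta> k = inverse (real (Suc k))" for k
  have \<delta>: "\<delta> k > 0" for k by (simp add: \<delta>_def)
  have \<delta>0: "\<delta> \<longlonglongrightarrow> 0" unfolding \<delta>_def by (rule LIMSEQ_inverse_real_of_nat)
  define I where "I k p = cutoff (\<delta> k) (u p) * ?div p + cutoff' (\<delta> k) (u p) * ?P p" for k p
  have zero: "(LINT p:\<Omega>|vol. I k p) = 0" for k
  proof -
    let ?uk = "\<lambda>p. cutoff (\<delta> k) (u p)"
    \<comment> \<open>The truncation is zero wherever \<open>u\<close> is at most
      \<open>\<delta> k\<close> in absolute value. The set kept here is closed in the compact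
      closure and misses the frontier, where \<open>u = 0\<close>, so it is a compact subset of
      \<open>\<Omega>\<close>.\<close>
    let ?K = "closure \<Omega> \<inter> {p \<in> closure \<Omega>. \<delta> k \<le> \<bar>u p\<bar>}"
    have uk: "C1_fun \<Omega> ?uk" by (rule C1_fun_compose[OF C1_on_cutoff[OF \<delta>] u\<Omega>])
    have "closed (closure \<Omega> \<inter> (\<lambda>p. \<bar>u p\<bar>) -` {\<delta> k..})"
      by (intro continuous_closed_preimage continuous_intros continuous_on_subset[OF contu V]) auto
    moreover have "closure \<Omega> \<inter> (\<lambda>p. \<bar>u p\<bar>) -` {\<delta> k..} = {p \<in> closure \<Omega>. \<delta> k \<le> \<bar>u p\<bar>}" by auto
    ultimately have K: "compact ?K" by (intro compact_Int_closed \<Omega>(2)) simp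
    have K\<Omega>: "?K \<subseteq> \<Omega>"
    proof
      fix p assume p: "p \<in> ?K"
      then have "p \<notin> frontier \<Omega>" using u0[of p] \<delta>[of k] by auto
      then show "p \<in> \<Omega>" using p interior_subset by (auto simp: frontier_def)
    qed
    have "(LINT p:\<Omega>|vol. ?uk p * ?div p + pairing ?uk X p) = 0"
      by (rule integration_by_parts_compact_support[OF uk X\<Omega> K K\<Omega>])
        (use sub in \<open>auto intro!: cutoff_eq_0\<close>)
    moreover have "pairing ?uk X p = cutoff' (\<delta> k) (u p) * ?P p" if "p \<in> \<Omega>" for p
      using differential_chain[OF u\<Omega> chart_at that DERIV_cutoff[OF \<delta>]] by (simp add: pairing_def)
    then have "(LINT p:\<Omega>|vol. ?uk p * ?div p + pairing ?uk X p) = (LINT p:\<Omega>|vol. I k p)"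
      using \<Omega>(1) by (intro set_lebesgue_integral_cong) (auto simp: I_def)
    ultimately show ?thesis by simp
  qed
  have "(\<lambda>k. LINT p|vol. indicator \<Omega> p *\<^sub>R I k p) \<longlonglongrightarrow> (LINT p|vol. indicator \<Omega> p *\<^sub>R (u p * ?div p + ?P p))"
  \<comment> \<open>The weights 1 and 9 of the dominating function are the constants of
    \<open>cutoff_bounds\<close>.\<close>
  proof (rule integral_dominated_convergence[where w = "\<lambda>p. \<bar>indicator \<Omega> p *\<^sub>R (u p * ?div p)\<bar> + 9 * \<bar>indicator \<Omega> p *\<^sub>R ?P p\<bar>"])
    have c1: "continuous_on \<Omega> (\<lambda>p. u p * ?div p + ?P p)"
      by (intro continuous_intros continuous_on_subset[OF contu \<Omega>V] continuous_on_subset[OF contd \<Omega>V]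
          continuous_on_subset[OF contP \<Omega>V])
    show "(\<lambda>p. indicator \<Omega> p *\<^sub>R (u p * ?div p + ?P p)) \<in> borel_measurable vol"
      using measurable_continuous_on_open[OF \<Omega>(1) c1] by simp
    have c2: "continuous_on \<Omega> (I k)" for k
    proof -
      have "continuous_on UNIV (cutoff' (\<delta> k))"
      proof -
        have "s ^ 4 + \<delta> k \<noteq> 0" for s :: real using quartic_add_pos[OF \<delta>[of k], of s] by simp
        then show ?thesis unfolding cutoff'_def[abs_def] by (intro continuous_intros) auto
      qed
      moreover have "continuous_on UNIV (cutoff (\<delta> k))" by (rule C1_on_continuous[OF C1_on_cutoff[OF \<delta>]])
      ultimately show ?thesis
        unfolding I_def[abs_def] using continuous_on_subset[OF contu \<Omega>V]
        by (intro continuous_intros continuous_on_subset[OF contd \<Omega>V]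
            continuous_on_subset[OF contP \<Omega>V]) (auto intro: continuous_on_compose2)
    qed
    show "(\<lambda>p. indicator \<Omega> p *\<^sub>R I k p) \<in> borel_measurable vol" for k
      using measurable_continuous_on_open[OF \<Omega>(1) c2] by simp
    show "integrable vol (\<lambda>p. \<bar>indicator \<Omega> p *\<^sub>R (u p * ?div p)\<bar> + 9 * \<bar>indicator \<Omega> p *\<^sub>R ?P p\<bar>)"
      using i1 i2 unfolding set_integrable_def
      by (intro Bochner_Integration.integrable_add integrable_mult_right integrable_abs)
    show "AE p in vol. (\<lambda>k. indicator \<Omega> p *\<^sub>R I k p) \<longlonglongrightarrow> indicator \<Omega> p *\<^sub>R (u p * ?div p + ?P p)"
      using AE_zero_differential[OF u\<Omega>]
    proof (rule AE_mp, intro AE_I2 impI)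
      fix p assume p: "p \<in> \<Omega> \<longrightarrow> u p = 0 \<longrightarrow> differential u (chart_at A p) p = 0"
      show "(\<lambda>k. indicator \<Omega> p *\<^sub>R I k p) \<longlonglongrightarrow> indicator \<Omega> p *\<^sub>R (u p * ?div p + ?P p)"
      proof (cases "p \<in> \<Omega>")
        case True
        have "(\<lambda>k. cutoff' (\<delta> k) (u p) * ?P p) \<longlonglongrightarrow> ?P p"
        proof (cases "u p = 0")
          case False
          show ?thesis
            using tendsto_mult_right[OF cutoff_tendsto(2)[OF \<delta>0 False], of "?P p"] by simp
        qed (use p True in \<open>simp add: pairing_def\<close>)
        then have "(\<lambda>k. I k p) \<longlonglongrightarrow> u p * ?div p + ?P p"
          unfolding I_def by (intro tendsto_intros cutoff_tendsto(1)[OF \<delta>0])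
        then show ?thesis using True by simp
      qed simp
    qed
    show "AE p in vol. norm (indicator \<Omega> p *\<^sub>R I k p)
        \<le> \<bar>indicator \<Omega> p *\<^sub>R (u p * ?div p)\<bar> + 9 * \<bar>indicator \<Omega> p *\<^sub>R ?P p\<bar>" for k
    proof (rule AE_I2)
      fix p
      have "\<bar>I k p\<bar> \<le> \<bar>cutoff (\<delta> k) (u p)\<bar> * \<bar>?div p\<bar> + \<bar>cutoff' (\<delta> k) (u p)\<bar> * \<bar>?P p\<bar>"
        unfolding I_def abs_mult[symmetric] by (rule abs_triangle_ineq)
      also have "\<dots> \<le> \<bar>u p\<bar> * \<bar>?div p\<bar> + 9 * \<bar>?P p\<bar>"
        by (intro add_mono mult_right_mono cutoff_bounds[OF \<delta>]) auto
      finally show "norm (indicator \<Omega> p *\<^sub>R I k p)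
        \<le> \<bar>indicator \<Omega> p *\<^sub>R (u p * ?div p)\<bar> + 9 * \<bar>indicator \<Omega> p *\<^sub>R ?P p\<bar>"
        by (cases "p \<in> \<Omega>") (auto simp: abs_mult)
    qed
  qed
  then have "(LINT p:\<Omega>|vol. u p * ?div p + ?P p) = 0"
    using zero LIMSEQ_unique[OF _ tendsto_const] by (simp add: set_lebesgue_integral_def)
  then show ?thesis using set_integral_add(2)[OF i1 i2] by simp
qed

end

section \<open>Derivatives of determinants and inverse matrices\<close>

lemma DERIV_det:
  fixes M :: "real \<Rightarrow> real^'n^'n"
  assumes "\<And>i j. ((\<lambda>t. M t $ i $ j) has_real_derivative H $ i $ j) (at t)"
  shows "((\<lambda>t. det (M t)) has_real_derivative (\<Sum>k\<in>UNIV. det (\<chi> i. if i = k then H $ i else M t $ i))) (at t)"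
proof -
  have "((\<lambda>t. det (M t)) has_real_derivative (\<Sum>p | p permutes UNIV. of_int (sign p) *
      (\<Sum>k\<in>UNIV. H $ k $ p k * (\<Prod>i\<in>UNIV - {k}. M t $ i $ p i)))) (at t)"
    unfolding det_def by (intro DERIV_sum DERIV_cmult has_field_derivative_prod assms)
  also have "(\<Sum>p | p permutes UNIV. of_int (sign p) *
      (\<Sum>k\<in>UNIV. H $ k $ p k * (\<Prod>i\<in>UNIV - {k}. M t $ i $ p i)))
    = (\<Sum>k\<in>UNIV. \<Sum>p | p permutes UNIV. of_int (sign p) * (H $ k $ p k * (\<Prod>i\<in>UNIV - {k}. M t $ i $ p i)))"
    unfolding sum_distrib_left by (rule sum.swap)
  also have "\<dots> = (\<Sum>k\<in>UNIV. det (\<chi> i. if i = k then H $ i else M t $ i))"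
  proof (rule sum.cong[OF refl])
    fix k :: 'n
    have "(\<Prod>i\<in>UNIV. (\<chi> i. if i = k then H $ i else M t $ i) $ i $ p i)
        = H $ k $ p k * (\<Prod>i\<in>UNIV - {k}. M t $ i $ p i)" for p
      by (subst prod.remove[of _ k]) (auto intro!: prod.cong)
    then show "(\<Sum>p | p permutes UNIV. of_int (sign p) * (H $ k $ p k * (\<Prod>i\<in>UNIV - {k}. M t $ i $ p i)))
        = det (\<chi> i. if i = k then H $ i else M t $ i)"
      unfolding det_def by simp
  qed
  finally show ?thesis .
qed

text \<open>Jacobi's formula. Writing \<open>H = (H ** ?N) ** M t\<close> expresses row
  \<open>k\<close> of \<open>H\<close> through the rows of \<open>M t\<close>; in the determinant
  with row \<open>k\<close> replaced, only the coefficient of row \<open>k\<close> itself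
  survives.\<close>

lemma DERIV_det_trace:
  fixes M :: "real \<Rightarrow> real^'n^'n"
  assumes M: "\<And>i j. ((\<lambda>t. M t $ i $ j) has_real_derivative H $ i $ j) (at t)" and "det (M t) \<noteq> 0"
  shows "((\<lambda>t. det (M t)) has_real_derivative det (M t) * trace (matrix_inv (M t) ** H)) (at t)"
proof -
  let ?N = "matrix_inv (M t)"
  have "det (\<chi> i. if i = k then H $ i else M t $ i) = (H ** ?N) $ k $ k * det (M t)" for k
  proof -
    have eq: "H ** ?N ** M t = H"
      by (simp add: matrix_mul_assoc[symmetric] matrix_inv_inverse(2)[OF assms(2)])
    have "(H ** ?N ** M t) $ k $ j = (\<Sum>i\<in>UNIV. (H ** ?N) $ k $ i * M t $ i $ j)" for j
      by (subst matrix_matrix_mult_def) simp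
    then have "H $ k $ j = (\<Sum>i\<in>UNIV. (H ** ?N) $ k $ i * M t $ i $ j)" for j
      by (simp only: eq)
    then have "H $ k = (\<Sum>i\<in>UNIV. (H ** ?N) $ k $ i *s row i (M t))"
      by (simp add: vec_eq_iff row_def)
    then have "(\<chi> i. if i = k then H $ i else M t $ i)
        = (\<chi> i. if i = k then (\<Sum>i\<in>UNIV. (H ** ?N) $ k $ i *s row i (M t)) else row i (M t))"
      by (simp add: vec_eq_iff row_def)
    then show ?thesis using cramer_lemma_transpose[of k "(H ** ?N) $ k" "M t"] by simp
  qed
  then have "(\<Sum>k\<in>UNIV. det (\<chi> i. if i = k then H $ i else M t $ i)) = det (M t) * trace (?N ** H)"
    by (subst trace_mul_sym) (simp add: trace_def sum_distrib_left mult.commute)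
  then show ?thesis using DERIV_det[OF M] by simp
qed

lemma eventually_det_nonzero:
  fixes M :: "real \<Rightarrow> real^'n^'n"
  assumes M: "\<And>i j. ((\<lambda>t. M t $ i $ j) has_real_derivative H $ i $ j) (at t)" and "det (M t) \<noteq> 0"
  shows "\<forall>\<^sub>F s in nhds t. det (M s) \<noteq> 0"
proof -
  have "isCont (\<lambda>t. det (M t)) t" by (rule DERIV_isCont[OF DERIV_det[OF M]])
  then have "\<forall>\<^sub>F s in at t. det (M s) \<noteq> 0"
    using assms(2) by (simp add: continuous_at tendsto_imp_eventually_ne)
  then show ?thesis using assms(2) by (simp add: eventually_nhds_conv_at)
qed

text \<open>Cramer's rule shows that a derivative exists; its value then follows by differentiating
  \<open>M ** matrix_inv M = mat 1\<close>.\<close>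

lemma DERIV_matrix_inv:
  fixes M :: "real \<Rightarrow> real^'n^'n"
  assumes M: "\<And>i j. ((\<lambda>t. M t $ i $ j) has_real_derivative H $ i $ j) (at t)" and d: "det (M t) \<noteq> 0"
  shows "((\<lambda>t. matrix_inv (M t) $ k $ l) has_real_derivative
    - (matrix_inv (M t) ** H ** matrix_inv (M t)) $ k $ l) (at t)"
proof -
  let ?N = "matrix_inv (M t)"
  have ev: "\<forall>\<^sub>F s in nhds t. det (M s) \<noteq> 0" by (rule eventually_det_nonzero[OF M d])
  have "\<exists>D. ((\<lambda>t. matrix_inv (M t) $ k $ l) has_real_derivative D) (at t)" for k l
  proof -
    let ?C = "\<lambda>t. (\<chi> i j. if j = k then axis l 1 $ i else M t $ i $ j) :: real^'n^'n"
    have C: "((\<lambda>t. ?C t $ i $ j) has_real_derivative (\<chi> i j. if j = k then 0 else H $ i $ j) $ i $ j) (at t)" for i j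
      using M[of i j] by auto
    have ev': "\<forall>\<^sub>F s in nhds t. matrix_inv (M s) $ k $ l = det (?C s) / det (M s)"
      using ev by eventually_elim (rule matrix_inv_cramer)
    from DERIV_divide[OF DERIV_det[OF C] DERIV_det[OF M] d]
    show ?thesis by (subst DERIV_cong_ev[OF refl ev' refl]) blast
  qed
  then obtain D where D: "\<And>k l. ((\<lambda>t. matrix_inv (M t) $ k $ l) has_real_derivative D k l) (at t)"
    by metis
  define N' where "N' = (\<chi> k l. D k l)"
  have "(\<Sum>j\<in>UNIV. M t $ i $ j * D j l + H $ i $ j * ?N $ j $ l) = 0" for i l
  proof (rule DERIV_unique)
    show "((\<lambda>s. \<Sum>j\<in>UNIV. M s $ i $ j * matrix_inv (M s) $ j $ l) has_real_derivative
        (\<Sum>j\<in>UNIV. M t $ i $ j * D j l + H $ i $ j * ?N $ j $ l)) (at t)"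
      by (intro DERIV_sum DERIV_mult' M D)
    have "\<forall>\<^sub>F s in nhds t. (\<Sum>j\<in>UNIV. M s $ i $ j * matrix_inv (M s) $ j $ l) = mat 1 $ i $ l"
      using ev
    proof eventually_elim
      case (elim s)
      then have "(M s ** matrix_inv (M s)) $ i $ l = mat 1 $ i $ l" by (simp add: matrix_inv_inverse)
      then show ?case by (simp add: matrix_matrix_mult_def)
    qed
    then show "((\<lambda>s. \<Sum>j\<in>UNIV. M s $ i $ j * matrix_inv (M s) $ j $ l) has_real_derivative 0) (at t)"
      by (subst DERIV_cong_ev[OF refl _ refl]) auto
  qed
  then have "M t ** N' + H ** ?N = 0"
    by (simp add: vec_eq_iff matrix_matrix_mult_def N'_def sum.distrib)
  then have "?N ** (M t ** N' + H ** ?N) = 0" by simp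
  then have "N' + ?N ** H ** ?N = 0"
    by (simp add: matrix_add_ldistrib matrix_mul_assoc matrix_inv_inverse[OF d])
  then have "N' = - (?N ** H ** ?N)" by (simp add: add_eq_0_iff2)
  then have "D k l = (- (?N ** H ** ?N)) $ k $ l" by (simp add: N'_def vec_eq_iff)
  then show ?thesis using D[of k l] by simp
qed

lemma matrix_inv_unique:
  fixes M N :: "real^'n^'n"
  assumes "M ** N = mat 1"
  shows "matrix_inv M = N"
proof -
  have "det M \<noteq> 0" using assms by (metis det_I det_mul mult_zero_left zero_neq_one)
  then have "matrix_inv M ** (M ** N) = N"
    by (simp add: matrix_mul_assoc matrix_inv_inverse)
  then show ?thesis by (simp add: assms)
qed

lemma matrix_inv_congruence:
  fixes M J :: "real^'n^'n"
  assumes M: "M = transpose J ** M' ** J" and "det M \<noteq> 0"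
  shows "J ** matrix_inv M ** transpose J = matrix_inv M'"
proof -
  have "transpose J ** (M' ** J ** matrix_inv M) = mat 1"
    using matrix_inv_inverse(1)[OF assms(2)] M by (simp add: matrix_mul_assoc)
  \<comment> \<open>A one-sided inverse of a square matrix is two-sided, so the factor
    \<open>transpose J\<close> may move to the right end.\<close>
  then have "M' ** J ** matrix_inv M ** transpose J = mat 1"
    by (rule iffD1[OF matrix_left_right_inverse])
  then have "M' ** (J ** matrix_inv M ** transpose J) = mat 1" by (simp add: matrix_mul_assoc)
  then show ?thesis by (rule matrix_inv_unique[symmetric])
qed

lemma transpose_matrix_inv:
  fixes M :: "real^'n^'n"
  assumes "det M \<noteq> 0" "transpose M = M"
  shows "transpose (matrix_inv M) = matrix_inv M"
proof -
  have "transpose (matrix_inv M ** M) = mat 1" by (simp add: matrix_inv_inverse[OF assms(1)])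
  then have "M ** transpose (matrix_inv M) = mat 1" by (simp add: matrix_transpose_mul assms(2))
  then show ?thesis by (rule matrix_inv_unique[symmetric])
qed


lemma trace_nth: "trace (M ** N) = (\<Sum>i\<in>UNIV. \<Sum>j\<in>UNIV. M $ i $ j * N $ j $ i)" for M N :: "real^'n^'n"
  by (simp add: trace_def matrix_matrix_mult_def)

lemma bounded_linear_nth_nth: "bounded_linear (\<lambda>M :: real^'m^'k. M $ i $ j)"
  by (rule bounded_linear_compose[OF bounded_linear_vec_nth bounded_linear_vec_nth])

lemma has_vector_derivative_nth:
  fixes f :: "real \<Rightarrow> real^'m^'k"
  assumes "(f has_vector_derivative f') F"
  shows "((\<lambda>t. f t $ i $ j) has_real_derivative f' $ i $ j) F"
  unfolding has_real_derivative_iff_has_vector_derivative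
  by (rule bounded_linear.has_vector_derivative[OF bounded_linear_nth_nth assms])

text \<open>These functions of the matrix of the metric are the coefficients of the energy and the
  volume density. Being C1 they are locally Lipschitz, which bounds their difference quotients along
  the family.\<close>

lemma C1_on_density_inverse: "C1_on {M :: real^'n^'n. 0 < det M} (\<lambda>M. sqrt (det M) * matrix_inv M $ k $ l)"
  "C1_on {M :: real^'n^'n. 0 < det M} (\<lambda>M. sqrt (det M))"
proof -
  have "continuous_on UNIV (\<lambda>M :: real^'n^'n. det M)"
    unfolding det_def by (intro continuous_intros)
  then have o: "open {M :: real^'n^'n. 0 < det M}" by (intro open_Collect_less continuous_intros)
  have e: "C1_on {M :: real^'n^'n. 0 < det M} (\<lambda>M. M $ i $ j)" for i j
    by (rule C1_on_linear[OF bounded_linear_nth_nth o])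
  show "C1_on {M :: real^'n^'n. 0 < det M} (\<lambda>M. sqrt (det M))"
    by (intro C1_on_sqrt C1_on_det o e) simp
  then show "C1_on {M :: real^'n^'n. 0 < det M} (\<lambda>M. sqrt (det M) * matrix_inv M $ k $ l)"
    by (intro C1_on_mult C1_on_matrix_inv o e) auto
qed

lemma sum4_swap:
  fixes F :: "'i::finite \<Rightarrow> 'j::finite \<Rightarrow> 'k::finite \<Rightarrow> 'l::finite \<Rightarrow> real"
  shows "(\<Sum>i\<in>UNIV. \<Sum>j\<in>UNIV. \<Sum>k\<in>UNIV. \<Sum>l\<in>UNIV. F i j k l)
    = (\<Sum>k\<in>UNIV. \<Sum>l\<in>UNIV. \<Sum>i\<in>UNIV. \<Sum>j\<in>UNIV. F i j k l)"
proof -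
  have "(\<Sum>i\<in>UNIV. \<Sum>j\<in>UNIV. \<Sum>k\<in>UNIV. \<Sum>l\<in>UNIV. F i j k l)
      = (\<Sum>i\<in>UNIV. \<Sum>k\<in>UNIV. \<Sum>j\<in>UNIV. \<Sum>l\<in>UNIV. F i j k l)"
    by (intro sum.cong refl sum.swap)
  also have "\<dots> = (\<Sum>k\<in>UNIV. \<Sum>i\<in>UNIV. \<Sum>j\<in>UNIV. \<Sum>l\<in>UNIV. F i j k l)"
    by (rule sum.swap)
  also have "\<dots> = (\<Sum>k\<in>UNIV. \<Sum>i\<in>UNIV. \<Sum>l\<in>UNIV. \<Sum>j\<in>UNIV. F i j k l)"
    by (intro sum.cong refl sum.swap)
  also have "\<dots> = (\<Sum>k\<in>UNIV. \<Sum>l\<in>UNIV. \<Sum>i\<in>UNIV. \<Sum>j\<in>UNIV. F i j k l)"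
    by (intro sum.cong refl sum.swap)
  finally show ?thesis .
qed

text \<open>Here \<open>M\<close> is the metric and \<open>N\<close> its inverse. Contracting the
  product of \<open>d\<close> with itself evaluates \<open>H\<close> twice on the gradient
  \<open>N *v d\<close>; contracting the metric leaves \<open>N ** M ** N = N\<close>, hence the
  trace of \<open>H\<close>.\<close>

lemma tensor2_inner_eq:
  fixes N M H :: "real^'n^'n" and d :: "real^'n"
  assumes sym: "transpose N = N" and inv: "N ** M = mat 1"
  shows "(\<Sum>i\<in>UNIV. \<Sum>j\<in>UNIV. \<Sum>k\<in>UNIV. \<Sum>l\<in>UNIV.
      N $ i $ k * N $ j $ l * (d $ i * d $ j + \<kappa> * M $ i $ j) * H $ k $ l)
    = (N *v d) \<bullet> (H *v (N *v d)) + \<kappa> * trace (N ** H)"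
proof -
  have s: "N $ i $ k = N $ k $ i" for i k
    using arg_cong[OF sym, of "\<lambda>M. M $ k $ i"] by (simp add: transpose_def)
  have Nd: "(\<Sum>i\<in>UNIV. N $ i $ k * d $ i) = (N *v d) $ k" for k
    using s by (simp add: matrix_vector_mult_def)
  have NMN: "(\<Sum>i\<in>UNIV. \<Sum>j\<in>UNIV. N $ i $ k * N $ j $ l * M $ i $ j) = N $ k $ l" for k l
  proof -
    have "(\<Sum>i\<in>UNIV. \<Sum>j\<in>UNIV. N $ i $ k * N $ j $ l * M $ i $ j)
        = (\<Sum>j\<in>UNIV. (\<Sum>i\<in>UNIV. N $ k $ i * M $ i $ j) * N $ j $ l)"
      by (subst sum.swap) (simp add: sum_distrib_left sum_distrib_right s[of _ k] ac_simps)
    also have "\<dots> = (N ** M ** N) $ k $ l"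
      by (simp add: matrix_matrix_mult_def)
    also have "\<dots> = N $ k $ l" by (simp add: inv)
    finally show ?thesis .
  qed
  have inner: "(\<Sum>i\<in>UNIV. \<Sum>j\<in>UNIV. N $ i $ k * N $ j $ l * (d $ i * d $ j + \<kappa> * M $ i $ j) * H $ k $ l)
      = ((N *v d) $ k * (N *v d) $ l + \<kappa> * N $ k $ l) * H $ k $ l" for k l
  proof -
    have "(\<Sum>i\<in>UNIV. \<Sum>j\<in>UNIV. N $ i $ k * N $ j $ l * (d $ i * d $ j + \<kappa> * M $ i $ j) * H $ k $ l)
        = ((\<Sum>i\<in>UNIV. N $ i $ k * d $ i) * (\<Sum>j\<in>UNIV. N $ j $ l * d $ j)
          + \<kappa> * (\<Sum>i\<in>UNIV. \<Sum>j\<in>UNIV. N $ i $ k * N $ j $ l * M $ i $ j)) * H $ k $ l"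
      unfolding sum_product
      by (simp add: sum_distrib_left sum_distrib_right sum.distrib[symmetric] algebra_simps)
    then show ?thesis by (simp only: Nd NMN)
  qed
  have "(\<Sum>k\<in>UNIV. \<Sum>l\<in>UNIV. ((N *v d) $ k * (N *v d) $ l + \<kappa> * N $ k $ l) * H $ k $ l)
      = (\<Sum>k\<in>UNIV. \<Sum>l\<in>UNIV. (N *v d) $ k * (H $ k $ l * (N *v d) $ l))
        + \<kappa> * (\<Sum>k\<in>UNIV. \<Sum>l\<in>UNIV. N $ k $ l * H $ k $ l)"
    by (simp add: sum_distrib_left sum.distrib[symmetric] algebra_simps)
  also have "(\<Sum>k\<in>UNIV. \<Sum>l\<in>UNIV. (N *v d) $ k * (H $ k $ l * (N *v d) $ l)) = (N *v d) \<bullet> (H *v (N *v d))"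
    by (simp add: inner_vec_def matrix_vector_mult_def[of H] sum_distrib_left)
  also have "(\<Sum>k\<in>UNIV. \<Sum>l\<in>UNIV. N $ k $ l * H $ k $ l) = trace (N ** H)"
    unfolding trace_nth by (subst sum.swap) (simp add: s)
  finally show ?thesis by (subst sum4_swap) (simp only: inner)
qed


section \<open>Differentiable families\<close>

lemma has_vector_derivative_quotient:
  fixes f :: "real \<Rightarrow> 'b::real_normed_vector"
  assumes "((\<lambda>t. (f t - f 0) /\<^sub>R t) \<longlongrightarrow> f') (at 0)"
  shows "(f has_vector_derivative f') (at 0)"
  unfolding has_vector_derivative_def has_derivative_at
proof (intro conjI)
  have "((\<lambda>t. norm ((f t - f 0) /\<^sub>R t - f')) \<longlongrightarrow> 0) (at 0)"
    using assms by (simp add: LIM_zero_iff tendsto_norm_zero_iff)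
  moreover have "\<forall>\<^sub>F t in at 0. norm ((f t - f 0) /\<^sub>R t - f') = norm (f (0 + t) - f 0 - t *\<^sub>R f') / norm t"
  proof (rule eventually_at_topological[THEN iffD2], intro exI[of _ UNIV] conjI ballI impI)
    fix t :: real assume t: "t \<noteq> 0"
    have "(f t - f 0) /\<^sub>R t - f' = (f (0 + t) - f 0 - t *\<^sub>R f') /\<^sub>R t"
      using t by (simp add: scaleR_diff_right)
    then show "norm ((f t - f 0) /\<^sub>R t - f') = norm (f (0 + t) - f 0 - t *\<^sub>R f') / norm t"
      by (simp add: divide_inverse mult.commute)
  qed auto
  ultimately show "(\<lambda>t. norm (f (0 + t) - f 0 - t *\<^sub>R f') / norm t) \<midarrow>0\<rightarrow> 0"
    by (rule Lim_transform_eventually)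
qed (rule bounded_linear_scaleR_left)

lemma Cinf_has_derivD:
  fixes F :: "real \<Rightarrow> real^'n \<Rightarrow> 'b::real_normed_vector"
  shows "Cinf_has_deriv V S F F' e \<Longrightarrow> compact K \<Longrightarrow> K \<subseteq> V \<Longrightarrow>
    uniform_limit (K \<inter> S) (\<lambda>t. partial_derivs is (\<lambda>y. (F (e + t) y - F e y) /\<^sub>R t)) (partial_derivs is F') (at 0)"
  by (simp add: Cinf_has_deriv_def)

lemma Cinf_has_deriv_pointwise:
  fixes F :: "real \<Rightarrow> real^'n \<Rightarrow> 'b::real_normed_vector"
  assumes C: "Cinf_has_deriv V S F F' 0" and y: "y \<in> S" "y \<in> V"
  shows "((\<lambda>t. F t y) has_vector_derivative F' y) (at 0)"
proof (rule has_vector_derivative_quotient)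
  have "uniform_limit ({y} \<inter> S) (\<lambda>t. partial_derivs [] (\<lambda>y. (F (0 + t) y - F 0 y) /\<^sub>R t)) (partial_derivs [] F') (at 0)"
    by (rule Cinf_has_derivD[OF C]) (use y in auto)
  from tendsto_uniform_limitI[OF this, of y] y
  show "((\<lambda>t. (F t y - F 0 y) /\<^sub>R t) \<longlongrightarrow> F' y) (at 0)" by simp
qed

lemma partial_deriv_quotient:
  fixes f g :: "real^'n \<Rightarrow> 'b::real_normed_vector"
  assumes "f differentiable (at y)" "g differentiable (at y)"
  shows "partial_deriv i (\<lambda>y. (f y - g y) /\<^sub>R t) y = (partial_deriv i f y - partial_deriv i g y) /\<^sub>R t"
proof -
  have d: "(\<lambda>y. f y - g y) differentiable (at y)" by (rule differentiable_diff[OF assms])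
  show ?thesis
    using partial_deriv_bounded_linear[OF bounded_linear_scaleR_right d, of i "inverse t"]
    by (simp only: partial_deriv_diff[OF assms])
qed

text \<open>\<open>Cinf_has_deriv\<close> differentiates the difference quotient as a whole;
  differentiability of every \<open>F t\<close> with \<open>t \<in> I\<close> allows its partial
  derivative to be split.\<close>

lemma Cinf_has_deriv_partial_pointwise:
  fixes F :: "real \<Rightarrow> real^'n \<Rightarrow> 'b::real_normed_vector"
  assumes C: "Cinf_has_deriv V S F F' 0" and y: "y \<in> S" "y \<in> V"
    and I: "open I" "0 \<in> I" "\<And>t. t \<in> I \<Longrightarrow> F t differentiable (at y)"
  shows "((\<lambda>t. partial_deriv i (F t) y) has_vector_derivative partial_deriv i F' y) (at 0)"
proof (rule has_vector_derivative_quotient)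
  have "uniform_limit ({y} \<inter> S) (\<lambda>t. partial_derivs [i] (\<lambda>y. (F (0 + t) y - F 0 y) /\<^sub>R t)) (partial_derivs [i] F') (at 0)"
    by (rule Cinf_has_derivD[OF C]) (use y in auto)
  from tendsto_uniform_limitI[OF this, of y] y
  have "((\<lambda>t. partial_deriv i (\<lambda>y. (F t y - F 0 y) /\<^sub>R t) y) \<longlongrightarrow> partial_deriv i F' y) (at 0)" by simp
  moreover have "\<forall>\<^sub>F t in at 0. t \<in> I" using I by (simp add: eventually_at_in_open')
  then have "\<forall>\<^sub>F t in at 0. partial_deriv i (\<lambda>y. (F t y - F 0 y) /\<^sub>R t) y
      = (partial_deriv i (F t) y - partial_deriv i (F 0) y) /\<^sub>R t"
    by eventually_elim (rule partial_deriv_quotient[OF I(3) I(3)[OF I(2)]])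
  ultimately show "((\<lambda>t. (partial_deriv i (F t) y - partial_deriv i (F 0) y) /\<^sub>R t) \<longlongrightarrow> partial_deriv i F' y) (at 0)"
    by (rule Lim_transform_eventually)
qed

lemma norm_le_of_quotient:
  fixes a :: "'b::real_normed_vector"
  assumes "dist (a /\<^sub>R t) b < 1" "t \<noteq> 0"
  shows "norm a \<le> \<bar>t\<bar> * (norm b + 1)"
proof -
  have "norm (a /\<^sub>R t) \<le> norm b + 1"
    using assms(1) norm_triangle_ineq2[of "a /\<^sub>R t" b] by (simp add: dist_norm)
  then have "\<bar>t\<bar> * norm (a /\<^sub>R t) \<le> \<bar>t\<bar> * (norm b + 1)" by (rule mult_left_mono) simp
  moreover have "\<bar>t\<bar> * norm (a /\<^sub>R t) = norm a" using assms(2) by simp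
  ultimately show ?thesis by (simp only:)
qed

text \<open>Uniform convergence with tolerance 1 already gives a bound of order \<open>t\<close> on
  \<open>K \<inter> S\<close>, whose constant depends on the point through \<open>F'\<close>
  only.\<close>

lemma Cinf_has_deriv_bound:
  fixes F :: "real \<Rightarrow> real^'n \<Rightarrow> 'b::real_normed_vector"
  assumes C: "Cinf_has_deriv V S F F' 0" and K: "compact K" "K \<subseteq> V"
  shows "\<forall>\<^sub>F t in at 0. \<forall>y\<in>K \<inter> S. norm (F t y - F 0 y) \<le> \<bar>t\<bar> * (norm (F' y) + 1)"
proof -
  have "uniform_limit (K \<inter> S) (\<lambda>t. partial_derivs [] (\<lambda>y. (F (0 + t) y - F 0 y) /\<^sub>R t)) (partial_derivs [] F') (at 0)"
    by (rule Cinf_has_derivD[OF C K])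
  from uniform_limitD[OF this, of 1]
  have "\<forall>\<^sub>F t in at 0. \<forall>y\<in>K \<inter> S. dist ((F t y - F 0 y) /\<^sub>R t) (F' y) < 1" by simp
  moreover have "\<forall>\<^sub>F t in at (0::real). t \<noteq> 0" by (simp add: eventually_at_filter)
  ultimately show ?thesis
    by eventually_elim (use norm_le_of_quotient in blast)
qed

lemma Cinf_has_deriv_partial_bound:
  fixes F :: "real \<Rightarrow> real^'n \<Rightarrow> 'b::real_normed_vector"
  assumes C: "Cinf_has_deriv V S F F' 0" and K: "compact K" "K \<subseteq> V"
    and I: "open I" "0 \<in> I" "\<And>t y. t \<in> I \<Longrightarrow> y \<in> S \<Longrightarrow> F t differentiable (at y)"
  shows "\<forall>\<^sub>F t in at 0. \<forall>y\<in>K \<inter> S. norm (partial_deriv i (F t) y - partial_deriv i (F 0) y)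
    \<le> \<bar>t\<bar> * (norm (partial_deriv i F' y) + 1)"
proof -
  have "uniform_limit (K \<inter> S) (\<lambda>t. partial_derivs [i] (\<lambda>y. (F (0 + t) y - F 0 y) /\<^sub>R t)) (partial_derivs [i] F') (at 0)"
    by (rule Cinf_has_derivD[OF C K])
  from uniform_limitD[OF this, of 1]
  have "\<forall>\<^sub>F t in at 0. \<forall>y\<in>K \<inter> S. dist (partial_deriv i (\<lambda>y. (F t y - F 0 y) /\<^sub>R t) y) (partial_deriv i F' y) < 1" by simp
  moreover have "\<forall>\<^sub>F t in at (0::real). t \<noteq> 0" by (simp add: eventually_at_filter)
  moreover have "\<forall>\<^sub>F t in at 0. t \<in> I" using I by (simp add: eventually_at_in_open')
  ultimately show ?thesis
  proof eventually_elim
    case (elim t)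
    show ?case
    proof
      fix y assume y: "y \<in> K \<inter> S"
      then have "dist (partial_deriv i (\<lambda>y. (F t y - F 0 y) /\<^sub>R t) y) (partial_deriv i F' y) < 1"
        using elim(1) by blast
      moreover have "partial_deriv i (\<lambda>y. (F t y - F 0 y) /\<^sub>R t) y
          = (partial_deriv i (F t) y - partial_deriv i (F 0) y) /\<^sub>R t"
        by (rule partial_deriv_quotient) (use I y elim(3) in auto)
      ultimately have "dist ((partial_deriv i (F t) y - partial_deriv i (F 0) y) /\<^sub>R t) (partial_deriv i F' y) < 1"
        by (simp only:)
      then show "norm (partial_deriv i (F t) y - partial_deriv i (F 0) y) \<le> \<bar>t\<bar> * (norm (partial_deriv i F' y) + 1)"
        by (rule norm_le_of_quotient[OF _ elim(2)])
    qed
  qed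
qed

text \<open>For a given \<open>t\<close> the equality has to hold on all of \<open>S\<close>,
  because a partial derivative at a point sees a neighbourhood of it.\<close>

lemma mixed_cong:
  assumes "mixed S F" "\<forall>\<^sub>F t in nhds 0. \<forall>y\<in>S. F t y = G t y"
  shows "mixed S G"
proof -
  obtain F' where F': "mixed_deriv S F F'" using assms(1) by (auto simp: mixed_def)
  have S: "open S" using F' by (simp add: mixed_deriv_def)
  have "mixed_deriv S G F'"
    unfolding mixed_deriv_def
  proof (intro conjI ballI allI S)
    fix y i assume y: "y \<in> S"
    note F = mixed_derivD[OF F' y]
    show "\<forall>\<^sub>F t in nhds 0. G t differentiable (at y)"
      using F(1) assms(2)
    proof eventually_elim
      case (elim t)
      from has_derivative_transform_within_open[OF has_derivative_frechet[OF elim(1)] S y, of "G t"] elim(2)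
      show ?case by (auto simp: differentiable_def)
    qed
    show "F' differentiable (at y)" by (rule F)
    have "\<forall>\<^sub>F t in nhds 0. F t y = G t y" using assms(2) by eventually_elim (use y in blast)
    then show "((\<lambda>t. G t y) has_real_derivative F' y) (at 0)"
      using F(4) by (simp add: DERIV_cong_ev[OF refl _ refl])
    have "\<forall>\<^sub>F t in nhds 0. partial_deriv i (F t) y = partial_deriv i (G t) y"
      using assms(2) by eventually_elim (rule partial_deriv_cong[OF S y], blast)
    then show "((\<lambda>t. partial_deriv i (G t) y) has_real_derivative partial_deriv i F' y) (at 0)"
      using F(5)[of i] by (simp add: DERIV_cong_ev[OF refl _ refl])
  qed
  then show ?thesis by (auto simp: mixed_def)
qed

lemma mixed_matrix_inv:
  fixes F :: "real \<Rightarrow> real^'n \<Rightarrow> real^'m^'m"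
  assumes "open S" "\<And>i j. mixed S (\<lambda>t y. F t y $ i $ j)"
    and ev: "\<forall>\<^sub>F t in nhds 0. \<forall>y\<in>S. det (F t y) \<noteq> 0"
  shows "mixed S (\<lambda>t y. matrix_inv (F t y) $ k $ l)"
proof (rule mixed_cong)
  show "mixed S (\<lambda>t y. det (\<chi> i j. if j = k then axis l 1 $ i else F t y $ i $ j) / det (F t y))"
  proof (intro mixed_divide mixed_det assms(1,2))
    fix i j
    show "mixed S (\<lambda>t y. (\<chi> i j. if j = k then axis l 1 $ i else F t y $ i $ j) $ i $ j)"
      using assms(2)[of i j] assms(1) by (cases "j = k") (auto intro: mixed_const)
    fix y assume "y \<in> S"
    then show "det (F 0 y) \<noteq> 0" using eventually_nhds_x_imp_x[OF ev] by blast
  qed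
  show "\<forall>\<^sub>F t in nhds 0. \<forall>y\<in>S. det (\<chi> i j. if j = k then axis l 1 $ i else F t y $ i $ j) / det (F t y)
      = matrix_inv (F t y) $ k $ l"
    using ev by eventually_elim (simp add: matrix_inv_cramer)
qed

section \<open>Variation of the Laplacian\<close>

context oriented_manifold
begin

text \<open>The regularity that makes \<open>gradient g f\<close> a C1 vector field.\<close>

definition C2_fun :: "'a set \<Rightarrow> ('a \<Rightarrow> real) \<Rightarrow> bool"
  where "C2_fun V f \<longleftrightarrow> C1_fun V f \<and>
    (\<forall>c\<in>A. \<forall>i. C1_on (coord c ` (cdom c \<inter> V)) (partial_deriv i (f \<circ> param c)))"

lemma C2_fun_C1: "C2_fun V f \<Longrightarrow> C1_fun V f"
  by (simp add: C2_fun_def)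

lemma smooth_fun_imp_C2_fun:
  assumes "smooth_fun_on A V f"
  shows "C2_fun V f"
  unfolding C2_fun_def
proof (intro conjI ballI allI)
  show "C1_fun V f" by (rule smooth_fun_imp_C1_fun[OF assms])
  fix c i assume "c \<in> A"
  then have "smooth_on (coord c ` (cdom c \<inter> V)) (f \<circ> param c)"
    using assms unfolding smooth_fun_on_def by blast
  then show "C1_on (coord c ` (cdom c \<inter> V)) (partial_deriv i (f \<circ> param c))"
    by (rule smooth_on_imp_C1_on[OF smooth_on_partial_deriv])
qed

lemma C2_fun_subset:
  assumes "C2_fun V f" "open W" "W \<subseteq> V"
  shows "C2_fun W f"
  unfolding C2_fun_def
proof (intro conjI ballI allI)
  show "C1_fun W f" by (rule C1_fun_subset[OF C2_fun_C1[OF assms(1)] assms(2,3)])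
  fix c i assume c: "c \<in> A"
  then have "C1_on (coord c ` (cdom c \<inter> V)) (partial_deriv i (f \<circ> param c))"
    using assms(1) unfolding C2_fun_def by blast
  then show "C1_on (coord c ` (cdom c \<inter> W)) (partial_deriv i (f \<circ> param c))"
    by (rule C1_on_subset[OF _ open_coord_image[OF c assms(2)]]) (use assms(3) in blast)
qed

lemma C1_on_differential:
  assumes "C2_fun V f" "c \<in> A"
  shows "C1_on (coord c ` (cdom c \<inter> V)) (\<lambda>y. differential f c (param c y) $ i)"
proof (rule C1_on_cong)
  show "C1_on (coord c ` (cdom c \<inter> V)) (partial_deriv i (f \<circ> param c))"
    using assms unfolding C2_fun_def by blast
  show "partial_deriv i (f \<circ> param c) y = differential f c (param c y) $ i"
    if "y \<in> coord c ` (cdom c \<inter> V)" for y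
    using that coord_param[OF assms(2)] by (auto simp: differential_nth)
qed

end

context oriented_riemannian
begin

lemma C1_on_inverse_metric:
  assumes "c \<in> A"
  shows "C1_on (coord c ` cdom c) (\<lambda>y. matrix_inv (g c (param c y)) $ i $ j)"
  using less_imp_neq[OF det_pos[OF assms param_in_cdom[OF assms]]]
  by (intro C1_on_matrix_inv open_coord C1_on_tensor2 smooth_metric assms) auto

lemma inverse_metric_transform:
  assumes "c \<in> A" "c' \<in> A" "p \<in> cdom c" "p \<in> cdom c'"
  defines "J \<equiv> jacobian (transition c c') (coord c p)"
  shows "J ** matrix_inv (g c p) ** transpose J = matrix_inv (g c' p)"
proof (rule matrix_inv_congruence)
  show "g c p = transpose J ** g c' p ** J"
    unfolding J_def by (rule tensor2_transform[OF smooth_metric assms(1-4)])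
  show "det (g c p) \<noteq> 0" using det_pos[OF assms(1,3)] by simp
qed

lemma transpose_inverse_metric:
  "c \<in> A \<Longrightarrow> p \<in> cdom c \<Longrightarrow> transpose (matrix_inv (g c p)) = matrix_inv (g c p)"
  using det_pos[of c p] metric_symmetric[of c p] by (intro transpose_matrix_inv) auto

lemma gradient_transform:
  assumes "C1_fun V f" "c \<in> A" "c' \<in> A" "p \<in> cdom c" "p \<in> cdom c'" "p \<in> V"
  shows "gradient g f c' p = jacobian (transition c c') (coord c p) *v gradient g f c p"
  unfolding gradient_def inverse_metric_transform[OF assms(2-5), symmetric]
    differential_transform[OF assms] by (simp only: matrix_vector_mul_assoc matrix_mul_assoc)

lemma gradient_nth: "gradient g' f c p $ i = (\<Sum>j\<in>UNIV. matrix_inv (g' c p) $ i $ j * differential f c p $ j)"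
  by (simp add: gradient_def matrix_vector_mult_def)

lemma C1_on_gradient:
  assumes "C2_fun V f" "c \<in> A"
  shows "C1_on (coord c ` (cdom c \<inter> V)) (\<lambda>y. gradient g f c (param c y) $ i)"
  unfolding gradient_nth
  by (intro C1_on_sum C1_on_mult C1_on_differential assms C1_on_subset[OF C1_on_inverse_metric]
      open_coord_image C1_fun_open[OF C2_fun_C1[OF assms(1)]]) auto

lemma chart_div_cong:
  assumes "c \<in> A" "p \<in> cdom c" "open W" "p \<in> W" "\<And>q. q \<in> cdom c \<Longrightarrow> q \<in> W \<Longrightarrow> X c q = Y c q"
  shows "chart_div X c p = chart_div Y c p"
proof -
  have "partial_deriv i ((\<lambda>q. volume_density g c q * X c q $ i) \<circ> param c) (coord c p)
      = partial_deriv i ((\<lambda>q. volume_density g c q * Y c q $ i) \<circ> param c) (coord c p)" for i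
    by (rule partial_deriv_cong[OF open_coord_image[OF assms(1,3)]])
      (use assms coord_image_iff[OF assms(1), of _ W] param_in_cdom[OF assms(1)] in auto)
  then show ?thesis by (simp add: chart_div_def)
qed

lemma chart_div_scale:
  assumes "C1_fun V f" "C1_vec V X" "c \<in> A" "p \<in> cdom c" "p \<in> V"
  shows "chart_div (\<lambda>c p. f p *\<^sub>R X c p) c p = f p * chart_div X c p + differential f c p \<bullet> X c p"
proof -
  let ?w = "\<lambda>i. (\<lambda>q. volume_density g c q * X c q $ i) \<circ> param c"
  have y: "coord c p \<in> coord c ` (cdom c \<inter> V)" using assms by auto
  have "(\<lambda>q. volume_density g c q * (f q *\<^sub>R X c q) $ i) \<circ> param c = (\<lambda>y. (f \<circ> param c) y * ?w i y)" for i
    by (auto simp: fun_eq_iff)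
  then have "partial_deriv i ((\<lambda>q. volume_density g c q * (f q *\<^sub>R X c q) $ i) \<circ> param c) (coord c p)
      = f p * partial_deriv i (?w i) (coord c p) + differential f c p $ i * (volume_density g c p * X c p $ i)" for i
    using partial_deriv_mult[OF C1_on_differentiable[OF C1_funD[OF assms(1,3)] y]
        C1_on_differentiable[OF C1_on_density_vec[OF assms(2,3)] y], of i]
    by (simp add: differential_nth param_coord[OF assms(3,4)])
  then show ?thesis
    using volume_density_pos[OF assms(3,4)]
    by (simp add: chart_div_def inner_vec_def sum.distrib sum_distrib_left[symmetric] add_divide_distrib
        mult.left_commute)
qed

lemma C1_vec_gradient:
  assumes "C2_fun V f"
  shows "C1_vec V (gradient g f)"
  unfolding C1_vec_def
  using C1_fun_open[OF C2_fun_C1[OF assms]] C1_on_gradient[OF assms] gradient_transform[OF C2_fun_C1[OF assms]]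
  by blast

text \<open>The gradient of \<open>f^2\<close> is \<open>2 f\<close> times that of \<open>f\<close>,
  and the product rule \<open>chart_div_scale\<close> applies.\<close>

lemma laplacian_square:
  assumes "C2_fun V f" "p \<in> V"
  shows "laplacian A g (\<lambda>q. (f q)\<^sup>2) p
    = 2 * f p * laplacian A g f p - 2 * (differential f (chart_at A p) p \<bullet> gradient g f (chart_at A p) p)"
proof -
  let ?c = "chart_at A p"
  have c: "?c \<in> A" "p \<in> cdom ?c" by (rule chart_at)+
  note f = C2_fun_C1[OF assms(1)]
  have dsq: "((\<lambda>s. s\<^sup>2) has_real_derivative 2 * f q) (at (f q))" for q
    by (auto intro!: derivative_eq_intros)
  have "chart_div (gradient g (\<lambda>q. (f q)\<^sup>2)) ?c p = chart_div (\<lambda>c q. (2 * f q) *\<^sub>R gradient g f c q) ?c p"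
    by (rule chart_div_cong[OF c C1_fun_open[OF f] assms(2)])
      (simp add: gradient_def differential_chain[OF f c(1) _ _ dsq] matrix_vector_mult_scaleR)
  also have "\<dots> = 2 * f p * chart_div (gradient g f) ?c p + differential (\<lambda>q. 2 * f q) ?c p \<bullet> gradient g f ?c p"
    by (rule chart_div_scale[OF C1_fun_mult[OF C1_fun_const[OF C1_fun_open[OF f]] f] C1_vec_gradient[OF assms(1)] c assms(2)])
  also have "differential (\<lambda>q. 2 * f q) ?c p = 2 *\<^sub>R differential f ?c p"
    by (rule differential_chain[OF f c assms(2)]) (auto intro!: derivative_eq_intros)
  finally show ?thesis by (simp add: laplacian_def divergence_chart_div)
qed

end

text \<open>Locality lets the eigenfunctions be replaced inside the domain by their extensions
  beyond the closure.\<close>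

lemma (in oriented_manifold) laplacian_cong:
  assumes "open W" "p \<in> W" "\<And>q. q \<in> W \<Longrightarrow> u q = v q"
  shows "laplacian A g' u p = laplacian A g' v p"
proof -
  let ?c = "chart_at A p"
  have c: "?c \<in> A" "p \<in> cdom ?c" by (rule chart_at)+
  have "partial_deriv i ((\<lambda>q. volume_density g' ?c q * gradient g' u ?c q $ i) \<circ> param ?c) (coord ?c p)
      = partial_deriv i ((\<lambda>q. volume_density g' ?c q * gradient g' v ?c q $ i) \<circ> param ?c) (coord ?c p)" for i
  proof (rule partial_deriv_cong[OF open_coord_image[OF c(1) assms(1)]])
    show "coord ?c p \<in> coord ?c ` (cdom ?c \<inter> W)" using c assms(2) by auto
    fix y assume "y \<in> coord ?c ` (cdom ?c \<inter> W)"
    then have "param ?c y \<in> cdom ?c" "param ?c y \<in> W"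
      using coord_image_iff[OF c(1), of y W] param_in_cdom[OF c(1)] by auto
    then have "differential u ?c (param ?c y) = differential v ?c (param ?c y)"
      by (rule differential_cong[OF c(1) _ assms(1) _ assms(3)])
    then show "((\<lambda>q. volume_density g' ?c q * gradient g' u ?c q $ i) \<circ> param ?c) y
        = ((\<lambda>q. volume_density g' ?c q * gradient g' v ?c q $ i) \<circ> param ?c) y"
      by (simp add: gradient_def)
  qed
  then show ?thesis by (simp add: laplacian_def divergence_def Let_def)
qed

section \<open>Families of metrics and their first variation\<close>

locale metric_family = oriented_riemannian A g
  for A :: "('a::{t2_space,second_countable_topology}, 'n::finite) chart set"
    and g :: "('a, 'n) tensor2" +
  fixes G :: "real \<Rightarrow> ('a, 'n) tensor2" and I :: "real set" and T :: "('a, 'n) tensor2"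
  assumes open_I: "open I" and zero_I: "0 \<in> I"
    and riemannian: "\<And>t. t \<in> I \<Longrightarrow> riemannian_metric A (G t)"
    and G_0: "G 0 = g"
    and smooth_T: "smooth_tensor2 A T"
    and Cinf_G: "\<And>c. c \<in> A \<Longrightarrow>
      Cinf_has_deriv (coord c ` cdom c) (coord c ` cdom c) (\<lambda>s. G s c \<circ> param c) (T c \<circ> param c) 0"
begin

lemma riemannian_G: "t \<in> I \<Longrightarrow> oriented_riemannian A (G t)"
  by (intro oriented_riemannian.intro oriented_riemannian_axioms.intro riemannian oriented_manifold_axioms)

lemma has_vector_derivative_G:
  assumes "c \<in> A" "p \<in> cdom c"
  shows "((\<lambda>t. G t c p) has_vector_derivative T c p) (at 0)"
  using Cinf_has_deriv_pointwise[OF Cinf_G[OF assms(1)], of "coord c p"] assms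
  by (simp add: param_coord)

lemma metric_variation_eq: "c \<in> A \<Longrightarrow> p \<in> cdom c \<Longrightarrow> metric_variation G c p = T c p"
  unfolding metric_variation_def by (rule vector_derivative_at[OF has_vector_derivative_G])

lemma DERIV_G:
  "c \<in> A \<Longrightarrow> p \<in> cdom c \<Longrightarrow> ((\<lambda>t. G t c p $ i $ j) has_real_derivative T c p $ i $ j) (at 0)"
  by (rule has_vector_derivative_nth[OF has_vector_derivative_G])

definition theta :: "('a, 'n) chart \<Rightarrow> 'a \<Rightarrow> real"
  where "theta c p = trace (matrix_inv (g c p) ** T c p) / 2"

lemma DERIV_volume_density:
  assumes "c \<in> A" "p \<in> cdom c"
  shows "((\<lambda>t. volume_density (G t) c p) has_real_derivative volume_density g c p * theta c p) (at 0)"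
proof -
  have pos: "det (G 0 c p) > 0" using det_pos[OF assms] by (simp add: G_0)
  from DERIV_chain2[OF DERIV_real_sqrt[OF pos] DERIV_det_trace[OF DERIV_G[OF assms]]] pos
  have "((\<lambda>t. sqrt (det (G t c p))) has_real_derivative
      inverse (sqrt (det (g c p))) / 2 * (det (g c p) * trace (matrix_inv (g c p) ** T c p))) (at 0)"
    by (simp add: G_0)
  moreover have "inverse (sqrt (det (g c p))) / 2 * (det (g c p) * trace (matrix_inv (g c p) ** T c p))
      = volume_density g c p * theta c p"
  proof -
    have "inverse (sqrt (det (g c p))) * det (g c p) = sqrt (det (g c p))"
      using pos by (simp add: G_0 field_simps)
    then show ?thesis by (simp add: volume_density_def theta_def)
  qed
  ultimately show ?thesis by (simp add: volume_density_def)
qed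

lemma DERIV_inverse_metric:
  assumes "c \<in> A" "p \<in> cdom c"
  shows "((\<lambda>t. matrix_inv (G t c p) $ k $ l) has_real_derivative
    - (matrix_inv (g c p) ** T c p ** matrix_inv (g c p)) $ k $ l) (at 0)"
  using DERIV_matrix_inv[OF DERIV_G[OF assms], of k l] det_pos[OF assms] by (simp add: G_0)

text \<open>The gradient for \<open>G t\<close>, weighted by the ratio of the volume densities. With
  this weight the divergence of the fixed metric \<open>g\<close> reproduces the Laplacian of
  \<open>G t\<close>, so every integral can be taken against the volume of \<open>g\<close>.\<close>

definition grad_field :: "real \<Rightarrow> ('a \<Rightarrow> real) \<Rightarrow> ('a, 'n) vec_field"
  where "grad_field t f c p = (volume_density (G t) c p / volume_density g c p) *\<^sub>R gradient (G t) f c p"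

text \<open>The derivative of \<open>grad_field t f\<close> at \<open>t = 0\<close>: the first term
  comes from the density, the second from the inverse metric.\<close>

definition var_field :: "('a \<Rightarrow> real) \<Rightarrow> ('a, 'n) vec_field"
  where "var_field f c p = theta c p *\<^sub>R gradient g f c p - matrix_inv (g c p) *v (T c p *v gradient g f c p)"

lemma density_ratio_invariant:
  assumes "t \<in> I" "c \<in> A" "c' \<in> A" "p \<in> cdom c" "p \<in> cdom c'"
  shows "volume_density (G t) c p / volume_density g c p = volume_density (G t) c' p / volume_density g c' p"
  using volume_density_transform[OF assms(2-5)] det_jacobian_pos[OF assms(2-5)]
    oriented_riemannian.volume_density_transform[OF riemannian_G[OF assms(1)] assms(2-5)] by simp

lemma C1_vec_grad_field:
  assumes "t \<in> I" "C2_fun V f"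
  shows "C1_vec V (grad_field t f)"
  unfolding C1_vec_def
proof (intro conjI ballI allI)
  note V = C1_fun_open[OF C2_fun_C1[OF assms(2)]]
  show "open V" by (rule V)
  fix c assume c: "c \<in> A"
  have sub: "C1_on (coord c ` (cdom c \<inter> V)) f" if "C1_on (coord c ` cdom c) f" for f :: "real^'n \<Rightarrow> real"
    by (rule C1_on_subset[OF that open_coord_image[OF c V]]) auto
  show "C1_on (coord c ` (cdom c \<inter> V)) (\<lambda>y. grad_field t f c (param c y) $ i)" for i
    unfolding grad_field_def vector_scaleR_component real_scaleR_def
  proof (rule C1_on_mult[OF C1_on_divide[OF sub sub]])
    show "C1_on (coord c ` cdom c) (\<lambda>y. volume_density (G t) c (param c y))"
      by (rule oriented_riemannian.C1_on_volume_density[OF riemannian_G[OF assms(1)] c])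
    show "C1_on (coord c ` cdom c) (\<lambda>y. volume_density g c (param c y))" by (rule C1_on_volume_density[OF c])
    show "C1_on (coord c ` (cdom c \<inter> V)) (\<lambda>y. gradient (G t) f c (param c y) $ i)"
      by (rule oriented_riemannian.C1_on_gradient[OF riemannian_G[OF assms(1)] assms(2) c])
    fix y assume "y \<in> coord c ` (cdom c \<inter> V)"
    then have "param c y \<in> cdom c" using param_in_cdom[OF c] by blast
    then show "volume_density g c (param c y) \<noteq> 0" using volume_density_pos[OF c] by (metis less_irrefl)
  qed
  fix c' p assume c': "c' \<in> A" and "p \<in> cdom c \<inter> cdom c' \<inter> V"
  then have p: "p \<in> cdom c" "p \<in> cdom c'" "p \<in> V" by auto
  show "grad_field t f c' p = jacobian (transition c c') (coord c p) *v grad_field t f c p"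
    unfolding grad_field_def density_ratio_invariant[OF assms(1) c c' p(1,2)]
      oriented_riemannian.gradient_transform[OF riemannian_G[OF assms(1)] C2_fun_C1[OF assms(2)] c c' p]
    by (simp add: matrix_vector_mult_scaleR)
qed

text \<open>The factor \<open>volume_density g\<close> inside the divergence cancels the denominator
  of \<open>grad_field\<close> and leaves the divergence of \<open>G t\<close>, up to the ratio of
  the densities in front.\<close>

lemma divergence_grad_field:
  assumes "t \<in> I"
  shows "divergence A g (grad_field t f) p
    = - (volume_density (G t) (chart_at A p) p / volume_density g (chart_at A p) p * laplacian A (G t) f p)"
proof -
  let ?c = "chart_at A p"
  have c: "?c \<in> A" "p \<in> cdom ?c" by (rule chart_at)+
  have "partial_deriv i ((\<lambda>q. volume_density g ?c q * grad_field t f ?c q $ i) \<circ> param ?c) (coord ?c p)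
      = partial_deriv i ((\<lambda>q. volume_density (G t) ?c q * gradient (G t) f ?c q $ i) \<circ> param ?c) (coord ?c p)" for i
  proof (rule partial_deriv_cong[OF open_coord[OF c(1)]])
    fix y assume "y \<in> coord ?c ` cdom ?c"
    then have "volume_density g ?c (param ?c y) \<noteq> 0"
      using volume_density_pos[OF c(1) param_in_cdom[OF c(1)]] by (metis less_irrefl)
    then show "((\<lambda>q. volume_density g ?c q * grad_field t f ?c q $ i) \<circ> param ?c) y
        = ((\<lambda>q. volume_density (G t) ?c q * gradient (G t) f ?c q $ i) \<circ> param ?c) y"
      by (simp add: grad_field_def)
  qed (use c in auto)
  moreover have "volume_density (G t) ?c p > 0"
    by (rule oriented_riemannian.volume_density_pos[OF riemannian_G[OF assms] c])
  ultimately show ?thesis by (simp add: laplacian_def divergence_def Let_def)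
qed

lemma theta_invariant:
  assumes "c \<in> A" "c' \<in> A" "p \<in> cdom c" "p \<in> cdom c'"
  shows "theta c p = theta c' p"
proof -
  let ?J = "jacobian (transition c c') (coord c p)" and ?N = "matrix_inv (g c p)"
  have "trace (?N ** T c p) = trace ((?N ** transpose ?J ** T c' p) ** ?J)"
    by (subst tensor2_transform[OF smooth_T assms]) (simp only: matrix_mul_assoc)
  also have "\<dots> = trace (?J ** (?N ** transpose ?J ** T c' p))" by (rule trace_mul_sym)
  also have "\<dots> = trace ((?J ** ?N ** transpose ?J) ** T c' p)" by (simp only: matrix_mul_assoc)
  also have "\<dots> = trace (matrix_inv (g c' p) ** T c' p)" by (simp only: inverse_metric_transform[OF assms])
  finally show ?thesis by (simp add: theta_def)
qed

lemma C1_on_theta: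
  assumes "c \<in> A"
  shows "C1_on (coord c ` cdom c) (\<lambda>y. theta c (param c y))"
  unfolding theta_def trace_nth
  by (intro C1_on_divide C1_on_sum C1_on_mult C1_on_inverse_metric C1_on_tensor2 smooth_T C1_on_const
      open_coord assms) simp

lemma C1_vec_var_field:
  assumes "C2_fun V f"
  shows "C1_vec V (var_field f)"
  unfolding C1_vec_def
proof (intro conjI ballI allI)
  note V = C1_fun_open[OF C2_fun_C1[OF assms]]
  show "open V" by (rule V)
  fix c assume c: "c \<in> A"
  have sub: "C1_on (coord c ` (cdom c \<inter> V)) f" if "C1_on (coord c ` cdom c) f" for f :: "real^'n \<Rightarrow> real"
    by (rule C1_on_subset[OF that open_coord_image[OF c V]]) auto
  show "C1_on (coord c ` (cdom c \<inter> V)) (\<lambda>y. var_field f c (param c y) $ i)" for i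
    unfolding var_field_def vector_minus_component vector_scaleR_component real_scaleR_def
      matrix_vector_mult_def vec_lambda_beta
    by (intro C1_on_diff C1_on_mult C1_on_sum sub[OF C1_on_theta[OF c]] sub[OF C1_on_inverse_metric[OF c]]
        sub[OF C1_on_tensor2[OF smooth_T c]] C1_on_gradient[OF assms c] open_coord_image[OF c V])
  fix c' p assume c': "c' \<in> A" and "p \<in> cdom c \<inter> cdom c' \<inter> V"
  then have p: "p \<in> cdom c" "p \<in> cdom c'" "p \<in> V" by auto
  let ?J = "jacobian (transition c c') (coord c p)"
  have "matrix_inv (g c' p) *v (T c' p *v gradient g f c' p) = ?J *v (matrix_inv (g c p) *v (T c p *v gradient g f c p))"
    unfolding gradient_transform[OF C2_fun_C1[OF assms] c c' p] inverse_metric_transform[OF c c' p(1,2), symmetric]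
      tensor2_transform[OF smooth_T c c' p(1,2)]
    by (simp only: matrix_vector_mul_assoc matrix_mul_assoc)
  then show "var_field f c' p = ?J *v var_field f c p"
    unfolding var_field_def theta_invariant[OF c c' p(1,2)]
    by (simp only: gradient_transform[OF C2_fun_C1[OF assms] c c' p] matrix_vector_mult_diff_distrib matrix_vector_mult_scaleR)
qed

text \<open>The interchange is read off from the first order seminorms in
  \<open>Cinf_has_deriv\<close>, evaluated at single points.\<close>

lemma mixed_G:
  assumes "c \<in> A" "open S" "S \<subseteq> coord c ` cdom c"
  shows "mixed S (\<lambda>t y. G t c (param c y) $ i $ j)"
proof -
  have dG: "(G t c \<circ> param c) differentiable (at y)" if "t \<in> I" "y \<in> coord c ` cdom c" for t y
  proof -
    have "smooth_tensor2 A (G t)" using riemannian[OF that(1)] by (simp add: riemannian_metric_def)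
    then have "smooth_on (coord c ` cdom c) (G t c \<circ> param c)" using assms(1) unfolding smooth_tensor2_def by blast
    then show ?thesis using C1_on_differentiable[OF smooth_on_imp_C1_on] that(2) by blast
  qed
  have dT: "(T c \<circ> param c) differentiable (at y)" if "y \<in> coord c ` cdom c" for y
  proof -
    have "smooth_on (coord c ` cdom c) (T c \<circ> param c)" using assms(1) smooth_T unfolding smooth_tensor2_def by blast
    then show ?thesis using C1_on_differentiable[OF smooth_on_imp_C1_on] that by blast
  qed
  have L: "bounded_linear (\<lambda>M :: real^'n^'n. M $ i $ j)" by (rule bounded_linear_nth_nth)
  have comp: "(\<lambda>y. f y $ i $ j) differentiable (at y)"
      "partial_deriv k (\<lambda>y. f y $ i $ j) y = partial_deriv k f y $ i $ j"
    if "f differentiable (at y)" for f :: "real^'n \<Rightarrow> real^'n^'n" and y k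
    using bounded_linear.has_derivative[OF L has_derivative_frechet[OF that]]
      partial_deriv_bounded_linear[OF L that] by (auto simp: differentiable_def)
  have evI: "\<forall>\<^sub>F t in nhds 0. t \<in> I" using open_I zero_I by (rule eventually_nhds_in_open)
  have "mixed_deriv S (\<lambda>t y. (G t c \<circ> param c) y $ i $ j) (\<lambda>y. (T c \<circ> param c) y $ i $ j)"
    unfolding mixed_deriv_def
  proof (intro conjI ballI allI assms(2))
    fix y k assume "y \<in> S"
    then have y: "y \<in> coord c ` cdom c" using assms(3) by blast
    show "\<forall>\<^sub>F t in nhds 0. (\<lambda>y. (G t c \<circ> param c) y $ i $ j) differentiable (at y)"
      using evI by eventually_elim (rule comp(1)[OF dG[OF _ y]])
    show "(\<lambda>y. (T c \<circ> param c) y $ i $ j) differentiable (at y)" by (rule comp(1)[OF dT[OF y]])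
    show "((\<lambda>t. (G t c \<circ> param c) y $ i $ j) has_real_derivative (T c \<circ> param c) y $ i $ j) (at 0)"
      by (rule has_vector_derivative_nth[OF Cinf_has_deriv_pointwise[OF Cinf_G[OF assms(1)] y y]])
    have "((\<lambda>t. partial_deriv k (G t c \<circ> param c) y $ i $ j) has_real_derivative
        partial_deriv k (T c \<circ> param c) y $ i $ j) (at 0)"
      by (rule has_vector_derivative_nth[OF Cinf_has_deriv_partial_pointwise[OF Cinf_G[OF assms(1)] y y
            open_I zero_I dG[OF _ y]]])
    moreover have "\<forall>\<^sub>F t in nhds 0. partial_deriv k (\<lambda>y. (G t c \<circ> param c) y $ i $ j) y
        = partial_deriv k (G t c \<circ> param c) y $ i $ j"
      using evI by eventually_elim (rule comp(2)[OF dG[OF _ y]])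
    ultimately show "((\<lambda>t. partial_deriv k (\<lambda>y. (G t c \<circ> param c) y $ i $ j) y) has_real_derivative
        partial_deriv k (\<lambda>y. (T c \<circ> param c) y $ i $ j) y) (at 0)"
      by (subst DERIV_cong_ev[OF refl _ comp(2)[OF dT[OF y]]])
  qed
  then show ?thesis by (auto simp: mixed_def)
qed

lemma DERIV_density_gradient:
  assumes "c \<in> A" "p \<in> cdom c"
  shows "((\<lambda>t. volume_density (G t) c p * gradient (G t) f c p $ i) has_real_derivative
    volume_density g c p * var_field f c p $ i) (at 0)"
proof -
  let ?v = "volume_density g c p" and ?N = "matrix_inv (g c p)" and ?d = "differential f c p"
  have "((\<lambda>t. gradient (G t) f c p $ i) has_real_derivative
      (\<Sum>j\<in>UNIV. - (?N ** T c p ** ?N) $ i $ j * ?d $ j)) (at 0)"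
    unfolding gradient_nth by (intro DERIV_sum DERIV_cmult_right DERIV_inverse_metric assms)
  from DERIV_mult[OF DERIV_volume_density[OF assms] this]
  have "((\<lambda>t. volume_density (G t) c p * gradient (G t) f c p $ i) has_real_derivative
      ?v * theta c p * gradient g f c p $ i + (\<Sum>j\<in>UNIV. - (?N ** T c p ** ?N) $ i $ j * ?d $ j) * ?v) (at 0)"
    by (simp add: G_0)
  moreover have "(\<Sum>j\<in>UNIV. - (?N ** T c p ** ?N) $ i $ j * ?d $ j) = - (?N *v (T c p *v gradient g f c p)) $ i"
  proof -
    have "(?N ** T c p ** ?N) *v ?d = ?N *v (T c p *v gradient g f c p)"
      unfolding gradient_def by (simp only: matrix_vector_mul_assoc matrix_mul_assoc)
    then have "((?N ** T c p ** ?N) *v ?d) $ i = (?N *v (T c p *v gradient g f c p)) $ i" by simp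
    moreover have "((?N ** T c p ** ?N) *v ?d) $ i = (\<Sum>j\<in>UNIV. (?N ** T c p ** ?N) $ i $ j * ?d $ j)"
      by (subst matrix_vector_mult_def) simp
    ultimately show ?thesis by (simp add: sum_negf)
  qed
  ultimately show ?thesis by (simp add: var_field_def algebra_simps)
qed

text \<open>The Laplacian in a chart is a sum of partial derivatives of density times gradient,
  divided by the density. The interchange differentiates the numerator in \<open>t\<close>, and the
  quotient rule adds the term with \<open>theta\<close>.\<close>

lemma DERIV_laplacian:
  assumes f: "C2_fun V f" and p: "p \<in> V"
  shows "((\<lambda>t. laplacian A (G t) f p) has_real_derivative
    - divergence A g (var_field f) p - theta (chart_at A p) p * laplacian A g f p) (at 0)"
proof -
  let ?c = "chart_at A p"
  have c: "?c \<in> A" "p \<in> cdom ?c" by (rule chart_at)+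
  have V: "open V" by (rule C1_fun_open[OF C2_fun_C1[OF f]])
  let ?S = "coord ?c ` (cdom ?c \<inter> V)" and ?y = "coord ?c p"
  let ?v = "volume_density g ?c p"
  have S: "open ?S" "?S \<subseteq> coord ?c ` cdom ?c" using open_coord_image[OF c(1) V] by auto
  have y: "?y \<in> ?S" using c p by auto
  have inS: "param ?c y \<in> cdom ?c" "param ?c y \<in> V" if "y \<in> ?S" for y
    using that coord_image_iff[OF c(1), of y V] param_in_cdom[OF c(1)] by auto
  define B where "B t i = (\<lambda>q. volume_density (G t) ?c q * gradient (G t) f ?c q $ i) \<circ> param ?c" for t i
  have evI: "\<forall>\<^sub>F t in nhds 0. t \<in> I" using open_I zero_I by (rule eventually_nhds_in_open)
  have detG: "det (G t ?c q) > 0" if "t \<in> I" "q \<in> cdom ?c" for t q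
    by (rule oriented_riemannian.det_pos[OF riemannian_G[OF that(1)] c(1) that(2)])
  have "mixed ?S (\<lambda>t. B t i)" for i
    unfolding B_def comp_def volume_density_def gradient_nth
  proof (intro mixed_mult mixed_sqrt mixed_det mixed_sum mixed_matrix_inv mixed_const mixed_G[OF c(1)] S)
    show "det (G 0 ?c (param ?c y)) > 0" if "y \<in> ?S" for y
      by (rule detG[OF zero_I inS(1)[OF that]])
    show "\<forall>\<^sub>F t in nhds 0. \<forall>y\<in>?S. det (G t ?c (param ?c y)) \<noteq> 0"
      using evI by eventually_elim (use detG inS(1) in \<open>metis less_irrefl\<close>)
    show "(\<lambda>y. differential f ?c (param ?c y) $ j) differentiable (at y)" if "y \<in> ?S" for j y
      by (rule C1_on_differentiable[OF C1_on_differential[OF f c(1)] that])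
  qed
  then have "\<exists>F'. mixed_deriv ?S (\<lambda>t. B t i) F'" for i by (simp add: mixed_def)
  then obtain F' where F': "\<And>i. mixed_deriv ?S (\<lambda>t. B t i) (F' i)" by metis
  \<comment> \<open>The closure rules give some derivative of \<open>B\<close>; the pointwise
    formula \<open>DERIV_density_gradient\<close> identifies it, and only then do its partial
    derivatives form the divergence of \<open>var_field f\<close>.\<close>
  define B' where "B' i = (\<lambda>q. volume_density g ?c q * var_field f ?c q $ i) \<circ> param ?c" for i
  have B': "mixed_deriv ?S (\<lambda>t. B t i) (B' i)" for i
  proof (rule mixed_deriv_unique[OF F'])
    fix y assume "y \<in> ?S"
    then show "((\<lambda>t. B t i y) has_real_derivative B' i y) (at 0)"
      unfolding B_def B'_def comp_def using DERIV_density_gradient[OF c(1) inS(1)] by blast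
  qed
  have num: "((\<lambda>t. \<Sum>i\<in>UNIV. partial_deriv i (B t i) ?y) has_real_derivative (\<Sum>i\<in>UNIV. partial_deriv i (B' i) ?y)) (at 0)"
    by (intro DERIV_sum mixed_derivD(5)[OF B' y])
  have v0: "volume_density (G 0) ?c p \<noteq> 0" "?v \<noteq> 0" using volume_density_pos[OF c] by (auto simp: G_0)
  have lap: "laplacian A (G t) f p = - ((\<Sum>i\<in>UNIV. partial_deriv i (B t i) ?y) / volume_density (G t) ?c p)" for t
    by (simp add: laplacian_def divergence_def Let_def B_def)
  have div: "divergence A g (var_field f) p = (\<Sum>i\<in>UNIV. partial_deriv i (B' i) ?y) / ?v"
    by (simp add: divergence_def Let_def B'_def)
  let ?n = "\<Sum>i\<in>UNIV. partial_deriv i (B 0 i) ?y" and ?n' = "\<Sum>i\<in>UNIV. partial_deriv i (B' i) ?y"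
  have "((\<lambda>t. - ((\<Sum>i\<in>UNIV. partial_deriv i (B t i) ?y) / volume_density (G t) ?c p)) has_real_derivative
      - ((?n' * ?v - ?n * (?v * theta ?c p)) / (?v * ?v))) (at 0)"
    using DERIV_minus[OF DERIV_divide[OF num DERIV_volume_density[OF c] v0(1)]] by (simp add: G_0)
  moreover have "- ((?n' * ?v - ?n * (?v * theta ?c p)) / (?v * ?v))
      = - divergence A g (var_field f) p - theta ?c p * laplacian A g f p"
  proof -
    have n: "?n = - (laplacian A g f p * ?v)" using v0(2) lap[of 0] by (simp add: G_0)
    show ?thesis unfolding div n using v0(2) by (simp add: field_simps)
  qed
  ultimately show ?thesis unfolding lap by simp
qed

lemma laplacian_variation_eq:
  assumes "C2_fun V f" "p \<in> V"
  shows "laplacian_variation A G f p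
    = - divergence A g (var_field f) p - theta (chart_at A p) p * laplacian A g f p"
  unfolding laplacian_variation_def by (rule DERIV_imp_deriv[OF DERIV_laplacian[OF assms]])

end

section \<open>Local bounds along a family\<close>

definition loc_bounded :: "'a::topological_space set \<Rightarrow> 'a \<Rightarrow> (real \<Rightarrow> 'a \<Rightarrow> real) \<Rightarrow> bool"
  where "loc_bounded \<Omega> p f \<longleftrightarrow>
    (\<exists>W C. open W \<and> p \<in> W \<and> (\<forall>\<^sub>F t in at 0. \<forall>q\<in>W \<inter> \<Omega>. \<bar>f t q\<bar> \<le> C))"

lemma loc_boundedI:
  assumes "open W" "p \<in> W" "\<forall>\<^sub>F t in at 0. \<forall>q\<in>W \<inter> \<Omega>. \<bar>f t q\<bar> \<le> C"
  shows "loc_bounded \<Omega> p f"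
  using assms unfolding loc_bounded_def by blast

lemma loc_bounded_mult:
  assumes "loc_bounded \<Omega> p f" "loc_bounded \<Omega> p f'"
  shows "loc_bounded \<Omega> p (\<lambda>t q. f t q * f' t q)"
proof -
  obtain W C where W: "open W" "p \<in> W" and C: "\<forall>\<^sub>F t in at 0. \<forall>q\<in>W \<inter> \<Omega>. \<bar>f t q\<bar> \<le> C"
    using assms(1) unfolding loc_bounded_def by blast
  obtain W' C' where W': "open W'" "p \<in> W'" and C': "\<forall>\<^sub>F t in at 0. \<forall>q\<in>W' \<inter> \<Omega>. \<bar>f' t q\<bar> \<le> C'"
    using assms(2) unfolding loc_bounded_def by blast
  have "\<forall>\<^sub>F t in at 0. \<forall>q\<in>(W \<inter> W') \<inter> \<Omega>. \<bar>f t q * f' t q\<bar> \<le> \<bar>C\<bar> * \<bar>C'\<bar>"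
    using C C'
  proof eventually_elim
    case (elim t)
    show ?case
    proof
      fix q assume "q \<in> (W \<inter> W') \<inter> \<Omega>"
      then have "\<bar>f t q\<bar> \<le> \<bar>C\<bar>" "\<bar>f' t q\<bar> \<le> \<bar>C'\<bar>" using elim by force+
      then show "\<bar>f t q * f' t q\<bar> \<le> \<bar>C\<bar> * \<bar>C'\<bar>" unfolding abs_mult by (intro mult_mono) auto
    qed
  qed
  then show ?thesis using W W' by (intro loc_boundedI[of "W \<inter> W'"]) auto
qed

lemma loc_bounded_add:
  assumes "loc_bounded \<Omega> p f" "loc_bounded \<Omega> p f'"
  shows "loc_bounded \<Omega> p (\<lambda>t q. f t q + f' t q)"
proof -
  obtain W C where W: "open W" "p \<in> W" and C: "\<forall>\<^sub>F t in at 0. \<forall>q\<in>W \<inter> \<Omega>. \<bar>f t q\<bar> \<le> C"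
    using assms(1) unfolding loc_bounded_def by blast
  obtain W' C' where W': "open W'" "p \<in> W'" and C': "\<forall>\<^sub>F t in at 0. \<forall>q\<in>W' \<inter> \<Omega>. \<bar>f' t q\<bar> \<le> C'"
    using assms(2) unfolding loc_bounded_def by blast
  have "\<forall>\<^sub>F t in at 0. \<forall>q\<in>(W \<inter> W') \<inter> \<Omega>. \<bar>f t q + f' t q\<bar> \<le> C + C'"
    using C C' by eventually_elim (auto intro: order_trans[OF abs_triangle_ineq] add_mono)
  then show ?thesis using W W' by (intro loc_boundedI[of "W \<inter> W'"]) auto
qed

lemma loc_bounded_const: "loc_bounded \<Omega> p (\<lambda>t q. k)"
  by (rule loc_boundedI[of UNIV _ _ _ "\<bar>k\<bar>"]) auto

lemma loc_bounded_sum: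
  assumes "\<And>i. i \<in> K \<Longrightarrow> loc_bounded \<Omega> p (f i)"
  shows "loc_bounded \<Omega> p (\<lambda>t q. \<Sum>i\<in>K. f i t q)"
  using assms
proof (induction K rule: infinite_finite_induct)
  case (insert i K)
  then show ?case using loc_bounded_add[of \<Omega> p "f i" "\<lambda>t q. \<Sum>i\<in>K. f i t q"] by simp
qed (simp_all add: loc_bounded_const)

lemma loc_bounded_cong:
  assumes "loc_bounded \<Omega> p f" "open W" "p \<in> W" "\<forall>\<^sub>F t in at 0. \<forall>q\<in>W \<inter> \<Omega>. f t q = f' t q"
  shows "loc_bounded \<Omega> p f'"
proof -
  obtain W' C where W': "open W'" "p \<in> W'" and C: "\<forall>\<^sub>F t in at 0. \<forall>q\<in>W' \<inter> \<Omega>. \<bar>f t q\<bar> \<le> C"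
    using assms(1) unfolding loc_bounded_def by blast
  have "\<forall>\<^sub>F t in at 0. \<forall>q\<in>(W \<inter> W') \<inter> \<Omega>. \<bar>f' t q\<bar> \<le> C"
    using C assms(4)
  proof eventually_elim
    case (elim t)
    show ?case
    proof
      fix q assume "q \<in> (W \<inter> W') \<inter> \<Omega>"
      then have "\<bar>f t q\<bar> \<le> C" "f t q = f' t q" using elim by blast+
      then show "\<bar>f' t q\<bar> \<le> C" by simp
    qed
  qed
  then show ?thesis using W' assms(2,3) by (intro loc_boundedI[of "W \<inter> W'"]) auto
qed

lemma loc_bounded_continuous:
  fixes f :: "'a::topological_space \<Rightarrow> real"
  assumes "open W" "p \<in> W" "continuous_on W f"
  shows "loc_bounded \<Omega> p (\<lambda>t. f)"
proof (rule loc_boundedI)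
  show "open (W \<inter> f -` ball (f p) 1)"
    by (rule continuous_open_preimage[OF assms(3,1)]) simp
  show "p \<in> W \<inter> f -` ball (f p) 1" using assms(2) by simp
  show "\<forall>\<^sub>F t in at 0. \<forall>q\<in>(W \<inter> f -` ball (f p) 1) \<inter> \<Omega>. \<bar>f q\<bar> \<le> \<bar>f p\<bar> + 1"
  proof (intro always_eventually allI ballI)
    fix q assume "q \<in> (W \<inter> f -` ball (f p) 1) \<inter> \<Omega>"
    then have "dist (f p) (f q) < 1" by simp
    then show "\<bar>f q\<bar> \<le> \<bar>f p\<bar> + 1" unfolding dist_real_def by linarith
  qed
qed

text \<open>Adapted to the estimates that \<open>Cinf_has_deriv\<close> provides: only the fixed
  functions \<open>f0\<close> and \<open>f1\<close> need bounds near \<open>p\<close>, and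
  restricting to parameters of absolute value below 1 absorbs the factor in
  \<open>t\<close>.\<close>

lemma loc_bounded_perturb:
  assumes W: "open W" "p \<in> W"
    and d: "\<forall>\<^sub>F t in at 0. \<forall>q\<in>W \<inter> \<Omega>. \<bar>f t q - f0 q\<bar> \<le> \<bar>t\<bar> * (\<bar>f1 q\<bar> + 1)"
    and f0: "loc_bounded \<Omega> p (\<lambda>t. f0)" and f1: "loc_bounded \<Omega> p (\<lambda>t. f1)"
  shows "loc_bounded \<Omega> p f"
proof -
  obtain W0 C0 where W0: "open W0" "p \<in> W0" and C0: "\<forall>\<^sub>F t in at (0::real). \<forall>q\<in>W0 \<inter> \<Omega>. \<bar>f0 q\<bar> \<le> C0"
    using f0 unfolding loc_bounded_def by blast
  obtain W1 C1 where W1: "open W1" "p \<in> W1" and C1: "\<forall>\<^sub>F t in at (0::real). \<forall>q\<in>W1 \<inter> \<Omega>. \<bar>f1 q\<bar> \<le> C1"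
    using f1 unfolding loc_bounded_def by blast
  have "\<forall>\<^sub>F t in at (0::real). t \<in> {-1<..<1}" by (rule eventually_at_in_open') auto
  then have "\<forall>\<^sub>F t in at 0. \<forall>q\<in>(W \<inter> W0 \<inter> W1) \<inter> \<Omega>. \<bar>f t q\<bar> \<le> C0 + (C1 + 1)"
    using d C0 C1
  proof eventually_elim
    case (elim t)
    show ?case
    proof
      fix q assume q: "q \<in> (W \<inter> W0 \<inter> W1) \<inter> \<Omega>"
      have "\<bar>t\<bar> * (\<bar>f1 q\<bar> + 1) \<le> 1 * (C1 + 1)" using elim q by (intro mult_mono) auto
      moreover have "\<bar>f t q - f0 q\<bar> \<le> \<bar>t\<bar> * (\<bar>f1 q\<bar> + 1)" "\<bar>f0 q\<bar> \<le> C0" using elim q by blast+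
      moreover have "\<bar>f t q\<bar> \<le> \<bar>f0 q\<bar> + \<bar>f t q - f0 q\<bar>" by arith
      ultimately show "\<bar>f t q\<bar> \<le> C0 + (C1 + 1)" unfolding mult_1 by (meson add_mono order_trans)
    qed
  qed
  then show ?thesis using W W0 W1 by (intro loc_boundedI[of "W \<inter> W0 \<inter> W1"]) auto
qed

text \<open>Finitely many neighbourhoods suffice, so the finitely many conditions on
  \<open>t\<close> hold together eventually.\<close>

lemma loc_bounded_compact:
  assumes K: "compact K" "\<Omega> \<subseteq> K" and f: "\<And>p. p \<in> K \<Longrightarrow> loc_bounded \<Omega> p f"
  shows "\<exists>C. \<forall>\<^sub>F t in at 0. \<forall>q\<in>\<Omega>. \<bar>f t q\<bar> \<le> C"
proof -
  define R where "R p W C \<longleftrightarrow> open W \<and> p \<in> W \<and> (\<forall>\<^sub>F t in at 0. \<forall>q\<in>W \<inter> \<Omega>. \<bar>f t q\<bar> \<le> C)" for p W C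
  have "\<forall>p\<in>K. \<exists>W C. R p W C"
    using f unfolding loc_bounded_def R_def by blast
  then obtain W C where "\<forall>p\<in>K. R p (W p) (C p)" by metis
  then have W: "\<And>p. p \<in> K \<Longrightarrow> open (W p)" "\<And>p. p \<in> K \<Longrightarrow> p \<in> W p"
    and C: "\<And>p. p \<in> K \<Longrightarrow> \<forall>\<^sub>F t in at 0. \<forall>q\<in>W p \<inter> \<Omega>. \<bar>f t q\<bar> \<le> C p"
    unfolding R_def by blast+
  have cov: "K \<subseteq> (\<Union>p\<in>K. W p)" using W(2) by blast
  obtain F where F: "F \<subseteq> K" "finite F" "K \<subseteq> (\<Union>p\<in>F. W p)"
    using compactE_image[OF K(1) W(1) cov] by metis
  have "\<forall>\<^sub>F t in at 0. \<forall>p\<in>F. \<forall>q\<in>W p \<inter> \<Omega>. \<bar>f t q\<bar> \<le> C p"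
    using F(1) C by (intro eventually_ball_finite F(2)) blast
  then have "\<forall>\<^sub>F t in at 0. \<forall>q\<in>\<Omega>. \<bar>f t q\<bar> \<le> (\<Sum>p\<in>F. \<bar>C p\<bar>)"
  proof eventually_elim
    case (elim t)
    show ?case
    proof
      fix q assume q: "q \<in> \<Omega>"
      then obtain p where p: "p \<in> F" "q \<in> W p" using F(3) K(2) by blast
      then have "\<bar>f t q\<bar> \<le> C p" using elim q by blast
      also have "\<dots> \<le> \<bar>C p\<bar>" by simp
      also have "\<dots> \<le> (\<Sum>p\<in>F. \<bar>C p\<bar>)" using F(2) p(1) by (intro member_le_sum) auto
      finally show "\<bar>f t q\<bar> \<le> (\<Sum>p\<in>F. \<bar>C p\<bar>)" .
    qed
  qed
  then show ?thesis ..
qed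

text \<open>Dominated convergence with a constant on a domain of finite volume. It is a statement on
  sequences, so the limit at \<open>0\<close> is tested along sequences, shifted by \<open>N\<close>
  because continuity and the bound hold only for small \<open>t\<close>.\<close>

lemma (in oriented_riemannian) set_integral_bounded_convergence:
  fixes f :: "real \<Rightarrow> 'a \<Rightarrow> real"
  assumes \<Omega>: "open \<Omega>" "compact (closure \<Omega>)"
    and meas: "\<forall>\<^sub>F t in at 0. continuous_on \<Omega> (f t)" and F: "continuous_on \<Omega> F"
    and bound: "\<And>p. p \<in> closure \<Omega> \<Longrightarrow> loc_bounded \<Omega> p f"
    and lim: "\<And>q. q \<in> \<Omega> \<Longrightarrow> ((\<lambda>t. f t q) \<longlongrightarrow> F q) (at 0)"
  shows "((\<lambda>t. LINT q:\<Omega>|vol. f t q) \<longlongrightarrow> (LINT q:\<Omega>|vol. F q)) (at 0)"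
  unfolding tendsto_at_iff_sequentially
proof (intro allI impI)
  fix X :: "nat \<Rightarrow> real" assume X: "\<forall>i. X i \<in> UNIV - {0}" "X \<longlonglongrightarrow> 0"
  obtain C where C: "\<forall>\<^sub>F t in at 0. \<forall>q\<in>\<Omega>. \<bar>f t q\<bar> \<le> C"
    using loc_bounded_compact[OF \<Omega>(2) closure_subset bound] by blast
  have X0: "filterlim X (at 0) sequentially"
    using X by (simp add: filterlim_at)
  have "\<forall>\<^sub>F i in sequentially. continuous_on \<Omega> (f (X i)) \<and> (\<forall>q\<in>\<Omega>. \<bar>f (X i) q\<bar> \<le> C)"
    using eventually_compose_filterlim[OF meas X0] eventually_compose_filterlim[OF C X0] by eventually_elim auto
  then obtain N where N: "\<And>i. i \<ge> N \<Longrightarrow> continuous_on \<Omega> (f (X i)) \<and> (\<forall>q\<in>\<Omega>. \<bar>f (X i) q\<bar> \<le> C)"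
    unfolding eventually_sequentially by blast
  have fin: "emeasure vol \<Omega> < \<infinity>"
    by (rule le_less_trans[OF emeasure_mono[OF closure_subset] emeasure_vol_compact[OF \<Omega>(2)]]) simp
  have "(\<lambda>i. LINT q|vol. indicator \<Omega> q *\<^sub>R f (X (i + N)) q) \<longlonglongrightarrow> (LINT q|vol. indicator \<Omega> q *\<^sub>R F q)"
  proof (rule integral_dominated_convergence[where w = "\<lambda>q. indicator \<Omega> q *\<^sub>R C"])
    show "(\<lambda>q. indicator \<Omega> q *\<^sub>R F q) \<in> borel_measurable vol"
      using measurable_continuous_on_open[OF \<Omega>(1) F] by simp
    show "(\<lambda>q. indicator \<Omega> q *\<^sub>R f (X (i + N)) q) \<in> borel_measurable vol" for i
      using measurable_continuous_on_open[OF \<Omega>(1), of "f (X (i + N))"] N[of "i + N"] by simp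
    show "integrable vol (\<lambda>q. indicator \<Omega> q *\<^sub>R C)"
      using fin \<Omega>(1) by (intro integrable_scaleR_left integrable_real_indicator) auto
    show "AE q in vol. (\<lambda>i. indicator \<Omega> q *\<^sub>R f (X (i + N)) q) \<longlonglongrightarrow> indicator \<Omega> q *\<^sub>R F q"
    proof (rule AE_I2)
      fix q
      show "(\<lambda>i. indicator \<Omega> q *\<^sub>R f (X (i + N)) q) \<longlonglongrightarrow> indicator \<Omega> q *\<^sub>R F q"
      proof (cases "q \<in> \<Omega>")
        case True
        from LIMSEQ_ignore_initial_segment[OF filterlim_compose[OF lim[OF True] X0], of N] True
        show ?thesis by simp
      qed simp
    qed
    show "AE q in vol. norm (indicator \<Omega> q *\<^sub>R f (X (i + N)) q) \<le> indicator \<Omega> q *\<^sub>R C" for i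
      using N[of "i + N"] by (intro AE_I2) (auto simp: indicator_def)
  qed
  then have "(\<lambda>i. LINT q|vol. indicator \<Omega> q *\<^sub>R f (X i) q) \<longlonglongrightarrow> (LINT q|vol. indicator \<Omega> q *\<^sub>R F q)"
    by (rule LIMSEQ_offset)
  then show "((\<lambda>t. LINT q:\<Omega>|vol. f t q) \<circ> X) \<longlonglongrightarrow> (LINT q:\<Omega>|vol. F q)"
    by (simp add: set_lebesgue_integral_def comp_def)
qed


section \<open>Variation of an eigenvalue\<close>

context metric_family
begin

text \<open>The Lipschitz constant of \<open>P\<close> times the bound of order \<open>t\<close> on
  \<open>G t - g\<close>. Both are available on a compact coordinate ball around
  \<open>p\<close>.\<close>

lemma loc_bounded_metric_quotient:
  fixes P :: "real^'n^'n \<Rightarrow> real"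
  assumes c: "c \<in> A" "p \<in> cdom c" and P: "C1_on D P" "g c p \<in> D"
  shows "loc_bounded \<Omega> p (\<lambda>t q. (P (G t c q) - P (g c q)) / t)"
proof -
  obtain r L where r: "r > 0" and L: "L \<ge> 0" and "ball (g c p) r \<subseteq> D"
    and Lip: "\<And>M N. M \<in> ball (g c p) r \<Longrightarrow> N \<in> ball (g c p) r \<Longrightarrow> \<bar>P M - P N\<bar> \<le> L * norm (M - N)"
    using C1_on_locally_Lipschitz[OF P] by metis
  let ?U = "coord c ` cdom c" and ?y = "coord c p"
  have C1: "C1_on ?U (S c \<circ> param c)" if "smooth_tensor2 A S" for S
    using that c(1) smooth_on_imp_C1_on unfolding smooth_tensor2_def by blast
  have "open (?U \<inter> (g c \<circ> param c) -` ball (g c p) (r / 2))"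
    by (rule continuous_open_preimage[OF C1_on_continuous[OF C1[OF smooth_metric]] open_coord[OF c(1)] open_ball])
  moreover have "?y \<in> ?U \<inter> (g c \<circ> param c) -` ball (g c p) (r / 2)"
    using c r by (simp add: param_coord)
  ultimately obtain e where e: "e > 0" "cball ?y e \<subseteq> ?U \<inter> (g c \<circ> param c) -` ball (g c p) (r / 2)"
    using open_contains_cball by blast
  have eU: "cball ?y e \<subseteq> ?U" using e(2) by blast
  have "bounded ((T c \<circ> param c) ` cball ?y e)"
    by (intro compact_imp_bounded compact_continuous_image compact_cball
        continuous_on_subset[OF C1_on_continuous[OF C1[OF smooth_T]] eU])
  then obtain M0 where M0: "\<forall>z\<in>(T c \<circ> param c) ` cball ?y e. norm z \<le> M0" unfolding bounded_iff by blast
  define M where "M = \<bar>M0\<bar> + 1"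
  have M: "M > 0" by (simp add: M_def)
  have TM: "norm ((T c \<circ> param c) y) + 1 \<le> M" if "y \<in> cball ?y e" for y
    using bspec[OF M0 imageI[OF that]] unfolding M_def by linarith
  \<comment> \<open>For these \<open>t\<close> the metric moves by less than \<open>r / 2\<close>.
    As \<open>g\<close> itself stays within \<open>r / 2\<close> of its value at \<open>p\<close>,
    both matrices lie in the ball where \<open>P\<close> is Lipschitz.\<close>
  have "\<forall>\<^sub>F t in at (0::real). t \<in> {- (r / (2 * M))<..<r / (2 * M)}"
    by (rule eventually_at_in_open') (use r M in auto)
  moreover have "\<forall>\<^sub>F t in at 0. \<forall>y\<in>cball ?y e \<inter> ?U. norm ((G t c \<circ> param c) y - (G 0 c \<circ> param c) y)
      \<le> \<bar>t\<bar> * (norm ((T c \<circ> param c) y) + 1)"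
    by (rule Cinf_has_deriv_bound[OF Cinf_G[OF c(1)] compact_cball eU])
  moreover have "\<forall>\<^sub>F t in at (0::real). t \<noteq> 0" by (simp add: eventually_at_filter)
  ultimately have "\<forall>\<^sub>F t in at 0. \<forall>q\<in>(cdom c \<inter> coord c -` ball ?y e) \<inter> \<Omega>. \<bar>(P (G t c q) - P (g c q)) / t\<bar> \<le> L * M"
  proof eventually_elim
    case (elim t)
    show ?case
    proof
      fix q assume "q \<in> (cdom c \<inter> coord c -` ball ?y e) \<inter> \<Omega>"
      then have q: "q \<in> cdom c" "coord c q \<in> cball ?y e" by auto
      have q2: "coord c q \<in> cball ?y e \<inter> ?U" using q by auto
      have gq: "g c q \<in> ball (g c p) (r / 2)"
        using subsetD[OF e(2) q(2)] param_coord[OF c(1) q(1)] by simp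
      have "norm (G t c q - g c q) \<le> \<bar>t\<bar> * (norm ((T c \<circ> param c) (coord c q)) + 1)"
        using bspec[OF elim(2) q2] param_coord[OF c(1) q(1)] by (simp add: G_0)
      also have "\<dots> \<le> \<bar>t\<bar> * M" using TM[OF q(2)] by (rule mult_left_mono) simp
      finally have Gg: "norm (G t c q - g c q) \<le> \<bar>t\<bar> * M" .
      also have "\<bar>t\<bar> * M < r / 2"
      proof -
        have "\<bar>t\<bar> < r / (2 * M)" using elim(1) by auto
        then have "\<bar>t\<bar> * M < r / (2 * M) * M" using M by (rule mult_strict_right_mono)
        then show ?thesis using M by simp
      qed
      finally have "G t c q \<in> ball (g c p) r"
        using gq dist_triangle[of "g c p" "G t c q" "g c q"] by (simp add: dist_norm norm_minus_commute)
      moreover have "g c q \<in> ball (g c p) r" using gq r by simp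
      ultimately have "\<bar>P (G t c q) - P (g c q)\<bar> \<le> L * norm (G t c q - g c q)" by (rule Lip)
      also have "\<dots> \<le> L * (\<bar>t\<bar> * M)" by (rule mult_left_mono[OF Gg L])
      finally show "\<bar>(P (G t c q) - P (g c q)) / t\<bar> \<le> L * M"
        using elim(3) by (simp add: abs_divide pos_divide_le_eq mult.left_commute mult.commute)
    qed
  qed
  then show ?thesis
    using e(1) c by (intro loc_boundedI[OF open_coord_vimage[OF c(1) open_ball]]) auto
qed

end

text \<open>
  The functions \<open>u t\<close> extend the eigenfunctions \<open>\<phi> t\<close> beyond the closure of the domain, and \<open>w\<close>
  extends the derivative \<open>\<psi>\<close> of the family.
\<close>

locale eigenvalue_family = metric_family A g G I T
  for A :: "('a::{t2_space,second_countable_topology}, 'n::finite) chart set"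
    and g G I T +
  fixes \<Omega> :: "'a set" and \<phi> u :: "real \<Rightarrow> 'a \<Rightarrow> real" and V :: "real \<Rightarrow> 'a set"
    and \<psi> w :: "'a \<Rightarrow> real" and V' :: "'a set" and \<Lambda> :: "real \<Rightarrow> real"
  assumes \<Omega>: "open \<Omega>" "compact (closure \<Omega>)"
    and u: "\<And>t. t \<in> I \<Longrightarrow> C2_fun (V t) (u t)" "\<And>t. t \<in> I \<Longrightarrow> closure \<Omega> \<subseteq> V t"
      "\<And>t p. t \<in> I \<Longrightarrow> p \<in> closure \<Omega> \<Longrightarrow> u t p = \<phi> t p"
    and w: "C1_fun V' w" "closure \<Omega> \<subseteq> V'" "\<And>p. p \<in> closure \<Omega> \<Longrightarrow> w p = \<psi> p"
    and Cinf_\<phi>: "\<And>c. c \<in> A \<Longrightarrow> Cinf_has_deriv (coord c ` cdom c) (coord c ` (cdom c \<inter> \<Omega>))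
      (\<lambda>s. \<phi> s \<circ> param c) (\<psi> \<circ> param c) 0"
    and \<Lambda>: "\<And>t p. t \<in> I \<Longrightarrow> p \<in> \<Omega> \<Longrightarrow> laplacian A (G t) (\<phi> t) p = \<Lambda> t * \<phi> t p"
    and boundary: "\<And>t p. t \<in> I \<Longrightarrow> p \<in> frontier \<Omega> \<Longrightarrow> \<phi> t p = 0"
begin

lemma \<Omega>_closure: "p \<in> \<Omega> \<Longrightarrow> p \<in> closure \<Omega>"
  using closure_subset by blast

lemma \<Omega>_V: "t \<in> I \<Longrightarrow> \<Omega> \<subseteq> V t"
  using u(2) closure_subset by blast

lemma u_\<phi>: "t \<in> I \<Longrightarrow> p \<in> \<Omega> \<Longrightarrow> u t p = \<phi> t p"
  using u(3) \<Omega>_closure by blast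

lemma C1_u: "t \<in> I \<Longrightarrow> C1_fun (V t) (u t)"
  by (rule C2_fun_C1[OF u(1)])

lemma C2_u_\<Omega>: "t \<in> I \<Longrightarrow> C2_fun \<Omega> (u t)"
  by (rule C2_fun_subset[OF u(1) \<Omega>(1) \<Omega>_V])

lemma differential_u:
  "t \<in> I \<Longrightarrow> c \<in> A \<Longrightarrow> p \<in> cdom c \<Longrightarrow> p \<in> \<Omega> \<Longrightarrow> differential (\<phi> t) c p = differential (u t) c p"
  by (rule differential_cong[OF _ _ \<Omega>(1)]) (simp_all add: u_\<phi>)

lemma differential_w:
  "c \<in> A \<Longrightarrow> p \<in> cdom c \<Longrightarrow> p \<in> \<Omega> \<Longrightarrow> differential \<psi> c p = differential w c p"
  by (rule differential_cong[OF _ _ \<Omega>(1)]) (simp_all add: w(3) \<Omega>_closure)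

lemma eigen_u: "t \<in> I \<Longrightarrow> p \<in> \<Omega> \<Longrightarrow> laplacian A (G t) (u t) p = \<Lambda> t * u t p"
  using laplacian_cong[OF \<Omega>(1), of p "u t" "\<phi> t"] u_\<phi> \<Lambda> by simp

lemma differentiable_\<phi>:
  assumes "t \<in> I" "c \<in> A" "y \<in> coord c ` (cdom c \<inter> \<Omega>)"
  shows "(\<phi> t \<circ> param c) differentiable (at y)"
proof -
  have "C1_fun \<Omega> (\<phi> t)"
    by (rule C1_fun_cong[OF C2_fun_C1[OF C2_u_\<Omega>[OF assms(1)]] u_\<phi>[OF assms(1)]])
  then show ?thesis using C1_on_differentiable[OF C1_funD[OF _ assms(2)] assms(3)] by blast
qed

lemma continuous_u: "t \<in> I \<Longrightarrow> continuous_on (V t) (u t)"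
  by (rule C1_fun_continuous[OF C1_u])

lemma chart_cball:
  assumes "c \<in> A" "p \<in> cdom c"
  obtains e where "e > 0" "cball (coord c p) e \<subseteq> coord c ` cdom c"
  using open_coord[OF assms(1)] assms(2) open_contains_cball by (metis imageI)

text \<open>The estimates on \<open>u t - u 0\<close> hold inside \<open>\<Omega>\<close>. Near a
  frontier point the bounds come from \<open>u 0\<close> and \<open>w\<close>, which are continuous
  across the boundary.\<close>

lemma loc_bounded_u:
  assumes "p \<in> closure \<Omega>"
  shows "loc_bounded \<Omega> p u"
proof -
  let ?c = "chart_at A p"
  have c: "?c \<in> A" "p \<in> cdom ?c" by (rule chart_at)+
  obtain e where e: "e > 0" "cball (coord ?c p) e \<subseteq> coord ?c ` cdom ?c" by (rule chart_cball[OF c])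
  let ?W = "cdom ?c \<inter> coord ?c -` ball (coord ?c p) e"
  have W: "open ?W" "p \<in> ?W" using open_coord_vimage[OF c(1) open_ball] c e(1) by auto
  have evI: "\<forall>\<^sub>F t in at 0. t \<in> I" using open_I zero_I by (rule eventually_at_in_open')
  have "\<forall>\<^sub>F t in at 0. \<forall>q\<in>?W \<inter> \<Omega>. \<bar>u t q - u 0 q\<bar> \<le> \<bar>t\<bar> * (\<bar>w q\<bar> + 1)"
    using Cinf_has_deriv_bound[OF Cinf_\<phi>[OF c(1)] compact_cball e(2)] evI
  proof eventually_elim
    case (elim t)
    show ?case
    proof
      fix q assume q: "q \<in> ?W \<inter> \<Omega>"
      then have "coord ?c q \<in> cball (coord ?c p) e \<inter> coord ?c ` (cdom ?c \<inter> \<Omega>)" by auto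
      from bspec[OF elim(1) this] q show "\<bar>u t q - u 0 q\<bar> \<le> \<bar>t\<bar> * (\<bar>w q\<bar> + 1)"
        using param_coord[OF c(1)] by (simp add: u_\<phi> elim(2) zero_I w(3) \<Omega>_closure)
    qed
  qed
  then show ?thesis
  proof (rule loc_bounded_perturb[OF W])
    show "loc_bounded \<Omega> p (\<lambda>t. u 0)"
      using u(2)[OF zero_I] assms
      by (intro loc_bounded_continuous[OF C1_fun_open[OF C1_u[OF zero_I]] _ continuous_u[OF zero_I]]) auto
    show "loc_bounded \<Omega> p (\<lambda>t. w)"
      using w(2) assms by (intro loc_bounded_continuous[OF C1_fun_open[OF w(1)] _ C1_fun_continuous[OF w(1)]]) auto
  qed
qed

lemma loc_bounded_differential:
  assumes "C1_fun W f" "c \<in> A" "p \<in> cdom c" "p \<in> W"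
  shows "loc_bounded \<Omega> p (\<lambda>t q. differential f c q $ i)"
  by (rule loc_bounded_continuous[OF _ _ continuous_on_differential[OF assms(1,2)]])
    (use open_Int[OF open_cdom[OF assms(2)] C1_fun_open[OF assms(1)]] assms in auto)

lemma loc_bounded_differential_u:
  assumes c: "c \<in> A" "p \<in> cdom c" and p: "p \<in> closure \<Omega>"
  shows "loc_bounded \<Omega> p (\<lambda>t q. differential (u t) c q $ i)"
proof -
  obtain e where e: "e > 0" "cball (coord c p) e \<subseteq> coord c ` cdom c" by (rule chart_cball[OF c])
  let ?W = "cdom c \<inter> coord c -` ball (coord c p) e"
  have W: "open ?W" "p \<in> ?W" using open_coord_vimage[OF c(1) open_ball] c e(1) by auto
  have evI: "\<forall>\<^sub>F t in at 0. t \<in> I" using open_I zero_I by (rule eventually_at_in_open')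
  have dphi: "(\<phi> t \<circ> param c) differentiable (at y)" if "t \<in> I" "y \<in> coord c ` (cdom c \<inter> \<Omega>)" for t y
    by (rule differentiable_\<phi>[OF that(1) c(1) that(2)])
  have bound: "\<forall>\<^sub>F t in at 0. \<forall>y\<in>cball (coord c p) e \<inter> coord c ` (cdom c \<inter> \<Omega>).
      norm (partial_deriv i (\<phi> t \<circ> param c) y - partial_deriv i (\<phi> 0 \<circ> param c) y)
      \<le> \<bar>t\<bar> * (norm (partial_deriv i (\<psi> \<circ> param c) y) + 1)"
    by (rule Cinf_has_deriv_partial_bound[OF Cinf_\<phi>[OF c(1)] compact_cball e(2) open_I zero_I]) (rule dphi)
  have "\<forall>\<^sub>F t in at 0. \<forall>q\<in>?W \<inter> \<Omega>. \<bar>differential (u t) c q $ i - differential (u 0) c q $ i\<bar>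
      \<le> \<bar>t\<bar> * (\<bar>differential w c q $ i\<bar> + 1)"
    using bound evI
  proof eventually_elim
    case (elim t)
    show ?case
    proof
      fix q assume q: "q \<in> ?W \<inter> \<Omega>"
      then have "coord c q \<in> cball (coord c p) e \<inter> coord c ` (cdom c \<inter> \<Omega>)" by auto
      from bspec[OF elim(1) this]
      have "\<bar>differential (\<phi> t) c q $ i - differential (\<phi> 0) c q $ i\<bar> \<le> \<bar>t\<bar> * (\<bar>differential \<psi> c q $ i\<bar> + 1)"
        by (simp add: differential_nth)
      then show "\<bar>differential (u t) c q $ i - differential (u 0) c q $ i\<bar> \<le> \<bar>t\<bar> * (\<bar>differential w c q $ i\<bar> + 1)"
        using q by (simp add: differential_u[OF _ c(1)] differential_w[OF c(1)] elim(2) zero_I)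
    qed
  qed
  then show ?thesis
  proof (rule loc_bounded_perturb[OF W])
    show "loc_bounded \<Omega> p (\<lambda>t q. differential (u 0) c q $ i)"
      by (rule loc_bounded_differential[OF C1_u[OF zero_I] c]) (use u(2)[OF zero_I] p in auto)
    show "loc_bounded \<Omega> p (\<lambda>t q. differential w c q $ i)"
      by (rule loc_bounded_differential[OF w(1) c]) (use w(2) p in auto)
  qed
qed

lemma tendsto_u:
  assumes "p \<in> \<Omega>"
  shows "((\<lambda>t. u t p) \<longlongrightarrow> u 0 p) (at 0)"
proof -
  let ?c = "chart_at A p"
  have c: "?c \<in> A" "p \<in> cdom ?c" by (rule chart_at)+
  have "((\<lambda>t. (\<phi> t \<circ> param ?c) (coord ?c p)) has_vector_derivative (\<psi> \<circ> param ?c) (coord ?c p)) (at 0)"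
    by (rule Cinf_has_deriv_pointwise[OF Cinf_\<phi>[OF c(1)]]) (use c assms in auto)
  then have "((\<lambda>t. \<phi> t p) \<longlongrightarrow> \<phi> 0 p) (at 0)"
    using has_vector_derivative_continuous[of _ _ 0 UNIV] by (simp add: param_coord c continuous_at)
  then have "((\<lambda>t. \<phi> t p) \<longlongrightarrow> u 0 p) (at 0)" by (simp add: u_\<phi> zero_I assms)
  moreover have "\<forall>\<^sub>F t in at 0. \<phi> t p = u t p"
    using eventually_at_in_open'[OF open_I zero_I] by eventually_elim (simp add: u_\<phi> assms)
  ultimately show ?thesis by (rule Lim_transform_eventually)
qed

lemma tendsto_differential_u:
  assumes "p \<in> \<Omega>" "c \<in> A" "p \<in> cdom c"
  shows "((\<lambda>t. differential (u t) c p $ i) \<longlongrightarrow> differential (u 0) c p $ i) (at 0)"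
proof -
  have y: "coord c p \<in> coord c ` (cdom c \<inter> \<Omega>)" "coord c p \<in> coord c ` cdom c" using assms by auto
  have "((\<lambda>t. partial_deriv i (\<phi> t \<circ> param c) (coord c p)) has_vector_derivative
      partial_deriv i (\<psi> \<circ> param c) (coord c p)) (at 0)"
    by (rule Cinf_has_deriv_partial_pointwise[OF Cinf_\<phi>[OF assms(2)] y open_I zero_I
          differentiable_\<phi>[OF _ assms(2) y(1)]])
  then have "((\<lambda>t. differential (\<phi> t) c p $ i) \<longlongrightarrow> differential (\<phi> 0) c p $ i) (at 0)"
    using has_vector_derivative_continuous[of _ _ 0 UNIV] by (simp add: differential_nth continuous_at)
  then have "((\<lambda>t. differential (\<phi> t) c p $ i) \<longlongrightarrow> differential (u 0) c p $ i) (at 0)"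
    by (simp add: differential_u zero_I assms)
  moreover have "\<forall>\<^sub>F t in at 0. differential (\<phi> t) c p $ i = differential (u t) c p $ i"
    using eventually_at_in_open'[OF open_I zero_I] by eventually_elim (simp add: differential_u assms)
  ultimately show ?thesis by (rule Lim_transform_eventually)
qed

section \<open>The volume ratio and the two energies\<close>

definition rho :: "real \<Rightarrow> 'a \<Rightarrow> real"
  where "rho t p = volume_density (G t) (chart_at A p) p / volume_density g (chart_at A p) p"

lemma rho_chart: "t \<in> I \<Longrightarrow> c \<in> A \<Longrightarrow> p \<in> cdom c \<Longrightarrow> rho t p = volume_density (G t) c p / volume_density g c p"
  unfolding rho_def by (rule density_ratio_invariant[OF _ chart_at(1) _ chart_at(2)])

lemma continuous_on_volume_density:
  assumes "t \<in> I" "c \<in> A"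
  shows "continuous_on (cdom c) (volume_density (G t) c)"
proof -
  have "continuous_on (cdom c) (\<lambda>p. volume_density (G t) c (param c (coord c p)))"
    using continuous_on_coord_comp[OF assms(2), of UNIV]
      C1_on_continuous[OF oriented_riemannian.C1_on_volume_density[OF riemannian_G[OF assms(1)] assms(2)]] by simp
  then show ?thesis by (rule continuous_on_eq) (simp add: param_coord[OF assms(2)])
qed

lemma continuous_on_rho:
  assumes "t \<in> I"
  shows "continuous_on UNIV (rho t)"
proof (rule continuous_on_charts[OF open_UNIV])
  fix c assume c: "c \<in> A"
  show "continuous_on (cdom c \<inter> UNIV) (\<lambda>p. volume_density (G t) c p / volume_density g c p)"
    using continuous_on_volume_density[OF assms c] continuous_on_volume_density[OF zero_I c] volume_density_pos[OF c]
    by (auto simp: G_0 intro!: continuous_intros) (metis less_irrefl)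
qed (rule rho_chart[OF assms])

lemma continuous_on_theta: "continuous_on UNIV (\<lambda>p. theta (chart_at A p) p)"
proof (rule continuous_on_charts[OF open_UNIV])
  fix c assume c: "c \<in> A"
  have "continuous_on (cdom c) (\<lambda>p. theta c (param c (coord c p)))"
    using continuous_on_coord_comp[OF c, of UNIV] C1_on_continuous[OF C1_on_theta[OF c]] by simp
  then have "continuous_on (cdom c) (theta c)" by (rule continuous_on_eq) (simp add: param_coord[OF c])
  then show "continuous_on (cdom c \<inter> UNIV) (theta c)" by simp
qed (rule theta_invariant[OF chart_at(1) _ chart_at(2)])

definition energy :: "real \<Rightarrow> 'a \<Rightarrow> real"
  where "energy t p = pairing (u 0) (grad_field t (u t)) p"

text \<open>Compared with \<open>energy\<close>, the roles of the two functions are exchanged, so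
  that integration by parts puts the Laplacian of \<open>g\<close> on \<open>u 0\<close> and
  produces the eigenvalue \<open>\<Lambda> 0\<close>.\<close>

definition energy0 :: "real \<Rightarrow> 'a \<Rightarrow> real"
  where "energy0 t p = pairing (u t) (grad_field 0 (u 0)) p"

text \<open>\<open>u 0\<close> and \<open>u t\<close> extend to different neighbourhoods of the
  closure, while integration by parts wants both on one.\<close>

definition common_nbhd :: "real \<Rightarrow> 'a set"
  where "common_nbhd t = V 0 \<inter> V t"

lemma common_nbhd:
  assumes "t \<in> I"
  shows "open (common_nbhd t)" "closure \<Omega> \<subseteq> common_nbhd t" "C1_fun (common_nbhd t) (u 0)" "C1_fun (common_nbhd t) (u t)"
    "C1_vec (common_nbhd t) (grad_field t (u t))" "C1_vec (common_nbhd t) (grad_field 0 (u 0))"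
proof -
  show o: "open (common_nbhd t)"
    unfolding common_nbhd_def using C1_fun_open[OF C1_u[OF assms]] C1_fun_open[OF C1_u[OF zero_I]] by auto
  show "closure \<Omega> \<subseteq> common_nbhd t" unfolding common_nbhd_def using u(2)[OF assms] u(2)[OF zero_I] by blast
  show "C1_fun (common_nbhd t) (u 0)" by (rule C1_fun_subset[OF C1_u[OF zero_I] o]) (simp add: common_nbhd_def)
  show "C1_fun (common_nbhd t) (u t)" by (rule C1_fun_subset[OF C1_u[OF assms] o]) (simp add: common_nbhd_def)
  show "C1_vec (common_nbhd t) (grad_field t (u t))"
    by (rule C1_vec_subset[OF C1_vec_grad_field[OF assms u(1)[OF assms]] o]) (simp add: common_nbhd_def)
  show "C1_vec (common_nbhd t) (grad_field 0 (u 0))"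
    by (rule C1_vec_subset[OF C1_vec_grad_field[OF zero_I u(1)[OF zero_I]] o]) (simp add: common_nbhd_def)
qed

lemma \<Omega>_common_nbhd: "t \<in> I \<Longrightarrow> p \<in> \<Omega> \<Longrightarrow> p \<in> common_nbhd t"
  using common_nbhd(2) \<Omega>_closure by blast

lemma u_boundary: "t \<in> I \<Longrightarrow> p \<in> frontier \<Omega> \<Longrightarrow> u t p = 0"
  using u(3)[of t p] boundary[of t p] by (simp add: frontier_def)

lemma rho_0: "rho 0 p = 1"
  using volume_density_pos[OF chart_at] by (simp add: rho_def G_0) (metis less_irrefl)

lemma integral_energy:
  assumes t: "t \<in> I"
  shows "(LINT p:\<Omega>|vol. energy t p) = \<Lambda> t * (LINT p:\<Omega>|vol. rho t p * u 0 p * u t p)"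
    "(LINT p:\<Omega>|vol. energy0 t p) = \<Lambda> 0 * (LINT p:\<Omega>|vol. u 0 p * u t p)"
proof -
  \<comment> \<open>Used for \<open>s = 0\<close>, \<open>r = t\<close> and for
    \<open>s = t\<close>, \<open>r = 0\<close>; in the second case \<open>rho\<close> is 1.\<close>
  have eq: "(LINT p:\<Omega>|vol. u s p * divergence A g (grad_field r (u r)) p)
      = - (\<Lambda> r * (LINT p:\<Omega>|vol. rho r p * u s p * u r p))" if "s \<in> I" "r \<in> I" for s r
  proof -
    have "(LINT p:\<Omega>|vol. u s p * divergence A g (grad_field r (u r)) p)
        = (LINT p:\<Omega>|vol. - \<Lambda> r * (rho r p * u s p * u r p))"
      using \<Omega>(1) by (intro set_lebesgue_integral_cong)
        (auto simp: divergence_grad_field[OF that(2)] eigen_u[OF that(2)] rho_def)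
    also have "\<dots> = - \<Lambda> r * (LINT p:\<Omega>|vol. rho r p * u s p * u r p)"
      by (rule set_integral_mult_right)
    finally show ?thesis by simp
  qed
  show "(LINT p:\<Omega>|vol. energy t p) = \<Lambda> t * (LINT p:\<Omega>|vol. rho t p * u 0 p * u t p)"
    unfolding energy_def
    using integration_by_parts[OF \<Omega> common_nbhd(2)[OF t] common_nbhd(3)[OF t] common_nbhd(5)[OF t] u_boundary[OF zero_I]] eq[OF zero_I t]
    by simp
  show "(LINT p:\<Omega>|vol. energy0 t p) = \<Lambda> 0 * (LINT p:\<Omega>|vol. u 0 p * u t p)"
    unfolding energy0_def
    using integration_by_parts[OF \<Omega> common_nbhd(2)[OF t] common_nbhd(4)[OF t] common_nbhd(6)[OF t] u_boundary[OF t]] eq[OF t zero_I]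
    by (simp add: rho_0 mult.commute)
qed

text \<open>Isolates the difference quotient of \<open>\<Lambda>\<close>, with a coefficient that
  tends to the square of the norm of the eigenfunction at \<open>t = 0\<close>.\<close>

lemma integral_energy_quotient:
  assumes t: "t \<in> I" "t \<noteq> 0"
  shows "(LINT p:\<Omega>|vol. (energy t p - energy0 t p) / t)
    = (\<Lambda> t - \<Lambda> 0) / t * (LINT p:\<Omega>|vol. rho t p * u 0 p * u t p)
      + \<Lambda> 0 * (LINT p:\<Omega>|vol. (rho t p - 1) / t * u 0 p * u t p)"
proof -
  note nbhd = common_nbhd[OF t(1)]
  have cont: "continuous_on (common_nbhd t) (u 0)" "continuous_on (common_nbhd t) (u t)" "continuous_on (common_nbhd t) (rho t)"
    by (rule C1_fun_continuous[OF nbhd(3)], rule C1_fun_continuous[OF nbhd(4)],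
        rule continuous_on_subset[OF continuous_on_rho[OF t(1)] subset_UNIV])
  note int = set_integrable_domain[OF \<Omega> nbhd(1) _ nbhd(2)]
  have i1: "set_integrable vol \<Omega> (energy t)"
    unfolding energy_def[abs_def] by (rule int[OF continuous_on_pairing[OF nbhd(3,5)]])
  have i2: "set_integrable vol \<Omega> (energy0 t)"
    unfolding energy0_def[abs_def] by (rule int[OF continuous_on_pairing[OF nbhd(4,6)]])
  have i3: "set_integrable vol \<Omega> (\<lambda>p. rho t p * u 0 p * u t p)"
    by (rule int) (intro continuous_intros cont)
  have i4: "set_integrable vol \<Omega> (\<lambda>p. u 0 p * u t p)"
    by (rule int) (intro continuous_intros cont)
  have "(LINT p:\<Omega>|vol. (rho t p - 1) / t * u 0 p * u t p)
      = (LINT p:\<Omega>|vol. (rho t p * u 0 p * u t p - u 0 p * u t p) / t)"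
    by (simp add: algebra_simps)
  also have "\<dots> = ((LINT p:\<Omega>|vol. rho t p * u 0 p * u t p) - (LINT p:\<Omega>|vol. u 0 p * u t p)) / t"
    using set_integral_diff(2)[OF i3 i4] by simp
  finally have 1: "(LINT p:\<Omega>|vol. (rho t p - 1) / t * u 0 p * u t p)
      = ((LINT p:\<Omega>|vol. rho t p * u 0 p * u t p) - (LINT p:\<Omega>|vol. u 0 p * u t p)) / t" .
  have "(LINT p:\<Omega>|vol. (energy t p - energy0 t p) / t)
      = ((LINT p:\<Omega>|vol. energy t p) - (LINT p:\<Omega>|vol. energy0 t p)) / t"
    using set_integral_diff(2)[OF i1 i2] by simp
  also have "\<dots> = (\<Lambda> t * (LINT p:\<Omega>|vol. rho t p * u 0 p * u t p) - \<Lambda> 0 * (LINT p:\<Omega>|vol. u 0 p * u t p)) / t"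
    by (simp only: integral_energy[OF t(1)])
  finally have 2: "(LINT p:\<Omega>|vol. (energy t p - energy0 t p) / t)
    = (\<Lambda> t * (LINT p:\<Omega>|vol. rho t p * u 0 p * u t p) - \<Lambda> 0 * (LINT p:\<Omega>|vol. u 0 p * u t p)) / t" .
  \<comment> \<open>Add and subtract \<open>\<Lambda> 0 * a\<close>.\<close>
  have "(\<Lambda> t * a - \<Lambda> 0 * b) / t = (\<Lambda> t - \<Lambda> 0) / t * a + \<Lambda> 0 * ((a - b) / t)" for a b
    using t(2) by (simp add: field_simps)
  then show ?thesis unfolding 1 2 .
qed

text \<open>Symmetry of the inverse metric gives both energies the common factor built from
  \<open>du_0\<close> and \<open>du_t\<close>, so only metric coefficients are subtracted.\<close>

lemma energy_chart:
  assumes t: "t \<in> I" and c: "c \<in> A" "p \<in> cdom c" and p: "p \<in> \<Omega>"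
  shows "energy t p - energy0 t p = (\<Sum>k\<in>UNIV. \<Sum>l\<in>UNIV.
      (volume_density (G t) c p / volume_density g c p * matrix_inv (G t c p) $ k $ l - matrix_inv (g c p) $ k $ l)
        * (differential (u 0) c p $ k * differential (u t) c p $ l))"
proof -
  let ?R = "volume_density (G t) c p / volume_density g c p"
  let ?N = "matrix_inv (g c p)" and ?Nt = "matrix_inv (G t c p)"
  let ?d = "differential (u 0) c p" and ?dt = "differential (u t) c p"
  note pV = \<Omega>_common_nbhd[OF t p]
  have v: "volume_density g c p \<noteq> 0" using volume_density_pos[OF c] by simp
  have sym: "?N $ k $ l = ?N $ l $ k" for k l
    using arg_cong[OF transpose_inverse_metric[OF c], of "\<lambda>M. M $ l $ k"] by (simp add: transpose_def)
  have "energy t p = (\<Sum>k\<in>UNIV. \<Sum>l\<in>UNIV. ?R * ?Nt $ k $ l * (?d $ k * ?dt $ l))"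
    unfolding energy_def pairing_chart[OF common_nbhd(3)[OF t] common_nbhd(5)[OF t] c pV] grad_field_def
    by (simp add: inner_vec_def gradient_nth sum_distrib_left algebra_simps)
  moreover have "energy0 t p = (\<Sum>l\<in>UNIV. \<Sum>k\<in>UNIV. ?N $ l $ k * (?d $ k * ?dt $ l))"
    unfolding energy0_def pairing_chart[OF common_nbhd(4)[OF t] common_nbhd(6)[OF t] c pV] grad_field_def
    using v by (simp add: inner_vec_def gradient_nth sum_distrib_left algebra_simps G_0)
  moreover have "(\<Sum>l\<in>UNIV. \<Sum>k\<in>UNIV. ?N $ l $ k * (?d $ k * ?dt $ l))
      = (\<Sum>k\<in>UNIV. \<Sum>l\<in>UNIV. ?N $ k $ l * (?d $ k * ?dt $ l))"
    by (subst sum.swap) (simp only: sym)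
  ultimately show ?thesis by (simp only: left_diff_distrib sum_subtractf)
qed

lemma loc_bounded_inverse_density:
  assumes "c \<in> A" "p \<in> cdom c"
  shows "loc_bounded \<Omega> p (\<lambda>t q. inverse (volume_density g c q))"
proof (rule loc_bounded_continuous[OF open_cdom[OF assms(1)] assms(2)])
  show "continuous_on (cdom c) (\<lambda>q. inverse (volume_density g c q))"
    using continuous_on_volume_density[OF zero_I assms(1)] volume_density_pos[OF assms(1)]
    by (auto simp: G_0 intro!: continuous_intros) (metis less_irrefl)
qed

lemma loc_bounded_energy_quotient:
  assumes p: "p \<in> closure \<Omega>"
  shows "loc_bounded \<Omega> p (\<lambda>t q. (energy t q - energy0 t q) / t)"
proof -
  define c where "c = chart_at A p"
  have c: "c \<in> A" "p \<in> cdom c" unfolding c_def by (rule chart_at)+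
  \<comment> \<open>\<open>Q\<close> is the coefficient of the energy as a C1 function of the matrix
    of the metric, so \<open>loc_bounded_metric_quotient\<close> applies to each term.\<close>
  define Q where "Q k l M = sqrt (det M) * matrix_inv M $ k $ l" for k l and M :: "real^'n^'n"
  have "loc_bounded \<Omega> p (\<lambda>t q. \<Sum>k\<in>UNIV. \<Sum>l\<in>UNIV. ((Q k l (G t c q) - Q k l (g c q)) / t)
      * inverse (volume_density g c q) * (differential (u 0) c q $ k * differential (u t) c q $ l))"
  proof (intro loc_bounded_sum loc_bounded_mult loc_bounded_inverse_density[OF c]
      loc_bounded_differential_u[OF c p])
    fix k l
    show "loc_bounded \<Omega> p (\<lambda>t q. (Q k l (G t c q) - Q k l (g c q)) / t)"
      unfolding Q_def
      by (rule loc_bounded_metric_quotient[OF c C1_on_density_inverse(1)]) (simp add: det_pos[OF c])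
    show "loc_bounded \<Omega> p (\<lambda>t q. differential (u 0) c q $ k)"
      by (rule loc_bounded_differential[OF C1_u[OF zero_I] c]) (use u(2)[OF zero_I] p in auto)
  qed
  then show ?thesis
  proof (rule loc_bounded_cong[OF _ open_cdom[OF c(1)] c(2)])
    show "\<forall>\<^sub>F t in at 0. \<forall>q\<in>cdom c \<inter> \<Omega>. (\<Sum>k\<in>UNIV. \<Sum>l\<in>UNIV. ((Q k l (G t c q) - Q k l (g c q)) / t)
        * inverse (volume_density g c q) * (differential (u 0) c q $ k * differential (u t) c q $ l))
      = (energy t q - energy0 t q) / t"
      using eventually_at_in_open'[OF open_I zero_I]
    proof eventually_elim
      case (elim t)
      show ?case
      proof
        fix q assume "q \<in> cdom c \<inter> \<Omega>"
        then have q: "q \<in> cdom c" "q \<in> \<Omega>" by auto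
        have v: "volume_density g c q \<noteq> 0" using volume_density_pos[OF c(1) q(1)] by simp
        have "(Q k l (G t c q) - Q k l (g c q)) / t * inverse (volume_density g c q)
            = (volume_density (G t) c q / volume_density g c q * matrix_inv (G t c q) $ k $ l
                - matrix_inv (g c q) $ k $ l) / t" for k l
          using v by (simp add: Q_def volume_density_def[symmetric] field_simps)
        then show "(\<Sum>k\<in>UNIV. \<Sum>l\<in>UNIV. ((Q k l (G t c q) - Q k l (g c q)) / t)
            * inverse (volume_density g c q) * (differential (u 0) c q $ k * differential (u t) c q $ l))
          = (energy t q - energy0 t q) / t"
          unfolding energy_chart[OF elim c(1) q] by (simp only: sum_divide_distrib times_divide_eq_left)
      qed
    qed
  qed
qed

lemma loc_bounded_rho_quotient:
  assumes p: "p \<in> closure \<Omega>"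
  shows "loc_bounded \<Omega> p (\<lambda>t q. (rho t q - 1) / t)"
proof -
  define c where "c = chart_at A p"
  have c: "c \<in> A" "p \<in> cdom c" unfolding c_def by (rule chart_at)+
  have "loc_bounded \<Omega> p (\<lambda>t q. (sqrt (det (G t c q)) - sqrt (det (g c q))) / t * inverse (volume_density g c q))"
    by (intro loc_bounded_mult loc_bounded_inverse_density[OF c]
        loc_bounded_metric_quotient[OF c C1_on_density_inverse(2)]) (simp add: det_pos[OF c])
  then show ?thesis
  proof (rule loc_bounded_cong[OF _ open_cdom[OF c(1)] c(2)])
    show "\<forall>\<^sub>F t in at 0. \<forall>q\<in>cdom c \<inter> \<Omega>. (sqrt (det (G t c q)) - sqrt (det (g c q))) / t * inverse (volume_density g c q)
        = (rho t q - 1) / t"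
      using eventually_at_in_open'[OF open_I zero_I]
    proof eventually_elim
      case (elim t)
      show ?case
      proof
        fix q assume "q \<in> cdom c \<inter> \<Omega>"
        then have q: "q \<in> cdom c" by auto
        have v: "volume_density g c q \<noteq> 0" using volume_density_pos[OF c(1) q(1)] by simp
        then show "(sqrt (det (G t c q)) - sqrt (det (g c q))) / t * inverse (volume_density g c q) = (rho t q - 1) / t"
          unfolding rho_chart[OF elim c(1) q] by (simp add: volume_density_def[symmetric] field_simps)
      qed
    qed
  qed
qed

lemma tendsto_rho_quotient: "((\<lambda>t. (rho t p - 1) / t) \<longlongrightarrow> theta (chart_at A p) p) (at 0)"
proof -
  let ?c = "chart_at A p" and ?v = "volume_density g (chart_at A p) p"
  have c: "?c \<in> A" "p \<in> cdom ?c" by (rule chart_at)+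
  have v: "?v \<noteq> 0" using volume_density_pos[OF c] by simp
  have "((\<lambda>t. volume_density (G t) ?c p / ?v) has_real_derivative ?v * theta ?c p / ?v) (at 0)"
    by (rule DERIV_cdivide[OF DERIV_volume_density[OF c]])
  then have "(rho' has_real_derivative theta ?c p) (at 0)" if "rho' = (\<lambda>t. rho t p)" for rho'
    using v that by (simp add: rho_def)
  from this[OF refl] show ?thesis by (simp add: DERIV_def rho_0)
qed

lemma tendsto_rho: "((\<lambda>t. rho t p) \<longlongrightarrow> 1) (at 0)"
proof -
  have "((\<lambda>t. t * ((rho t p - 1) / t) + 1) \<longlongrightarrow> 0 * theta (chart_at A p) p + 1) (at 0)"
    by (intro tendsto_intros tendsto_rho_quotient)
  moreover have "\<forall>\<^sub>F t in at 0. t * ((rho t p - 1) / t) + 1 = rho t p"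
    by (simp add: eventually_at_filter)
  ultimately show ?thesis by (auto elim: Lim_transform_eventually)
qed

lemma pairing_var_field:
  assumes "c \<in> A" "p \<in> cdom c" "p \<in> \<Omega>"
  shows "pairing (u 0) (var_field (u 0)) p = (\<Sum>k\<in>UNIV. \<Sum>l\<in>UNIV.
    (theta c p * matrix_inv (g c p) $ k $ l - (matrix_inv (g c p) ** T c p ** matrix_inv (g c p)) $ k $ l)
      * (differential (u 0) c p $ k * differential (u 0) c p $ l))"
proof -
  let ?N = "matrix_inv (g c p)" and ?d = "differential (u 0) c p"
  have "(?N *v (T c p *v gradient g (u 0) c p)) $ k = (\<Sum>l\<in>UNIV. (?N ** T c p ** ?N) $ k $ l * ?d $ l)" for k
  proof -
    have "?N *v (T c p *v gradient g (u 0) c p) = (?N ** T c p ** ?N) *v ?d"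
      unfolding gradient_def by (simp only: matrix_vector_mul_assoc matrix_mul_assoc)
    then show ?thesis by (simp add: matrix_vector_mult_def[of "?N ** T c p ** ?N"])
  qed
  then have "var_field (u 0) c p $ k = (\<Sum>l\<in>UNIV. (theta c p * ?N $ k $ l - (?N ** T c p ** ?N) $ k $ l) * ?d $ l)" for k
    by (simp add: var_field_def gradient_nth sum_distrib_left left_diff_distrib sum_subtractf mult.assoc)
  then show ?thesis
    unfolding pairing_chart[OF C2_fun_C1[OF C2_u_\<Omega>[OF zero_I]] C1_vec_var_field[OF C2_u_\<Omega>[OF zero_I]] assms]
    by (simp add: inner_vec_def sum_distrib_left ac_simps)
qed

text \<open>The difference \<open>P\<close> of the metric coefficients vanishes at \<open>0\<close>,
  so its quotient tends to the derivative given by the product rule; the accompanying factor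
  \<open>du_t\<close> merely converges.\<close>

lemma tendsto_energy_quotient:
  assumes p: "p \<in> \<Omega>"
  shows "((\<lambda>t. (energy t p - energy0 t p) / t) \<longlongrightarrow> pairing (u 0) (var_field (u 0)) p) (at 0)"
proof -
  define c where "c = chart_at A p"
  have c: "c \<in> A" "p \<in> cdom c" unfolding c_def by (rule chart_at)+
  let ?N = "matrix_inv (g c p)" and ?v = "volume_density g c p"
  have v: "?v \<noteq> 0" using volume_density_pos[OF c] by simp
  define P where "P k l t = volume_density (G t) c p / ?v * matrix_inv (G t c p) $ k $ l - ?N $ k $ l" for k l t
  have P: "((\<lambda>t. P k l t / t) \<longlongrightarrow> theta c p * ?N $ k $ l - (?N ** T c p ** ?N) $ k $ l) (at 0)" for k l
  proof -
    have "((\<lambda>t. volume_density (G t) c p / ?v) has_real_derivative theta c p) (at 0)"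
      using DERIV_cdivide[OF DERIV_volume_density[OF c], of ?v] v by simp
    from DERIV_diff[OF DERIV_mult[OF this DERIV_inverse_metric[OF c, of k l]] DERIV_const[of "?N $ k $ l"]]
    have "(P k l has_real_derivative theta c p * matrix_inv (G 0 c p) $ k $ l
        + - (?N ** T c p ** ?N) $ k $ l * (volume_density (G 0) c p / ?v) - 0) (at 0)"
      unfolding P_def[abs_def] .
    then have "(P k l has_real_derivative theta c p * ?N $ k $ l - (?N ** T c p ** ?N) $ k $ l) (at 0)"
      using v by (simp add: G_0)
    moreover have "P k l 0 = 0" using v by (simp add: P_def G_0)
    ultimately show ?thesis by (simp add: DERIV_def)
  qed
  have "((\<lambda>t. \<Sum>k\<in>UNIV. \<Sum>l\<in>UNIV. P k l t / t * (differential (u 0) c p $ k * differential (u t) c p $ l))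
      \<longlongrightarrow> pairing (u 0) (var_field (u 0)) p) (at 0)"
    unfolding pairing_var_field[OF c p] by (intro tendsto_intros P tendsto_differential_u[OF p c])
  moreover have "\<forall>\<^sub>F t in at 0. (\<Sum>k\<in>UNIV. \<Sum>l\<in>UNIV. P k l t / t * (differential (u 0) c p $ k * differential (u t) c p $ l))
      = (energy t p - energy0 t p) / t"
    using eventually_at_in_open'[OF open_I zero_I]
  proof eventually_elim
    case (elim t)
    then show ?case unfolding energy_chart[OF elim c p] P_def by (simp add: sum_divide_distrib)
  qed
  ultimately show ?thesis by (rule Lim_transform_eventually)
qed

end

context eigenvalue_family
begin

section \<open>The value of the derivative and the two integrals\<close>

lemma continuous_on_\<Omega>:
  "t \<in> I \<Longrightarrow> continuous_on \<Omega> (u t)" "t \<in> I \<Longrightarrow> continuous_on \<Omega> (rho t)"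
  "continuous_on \<Omega> (\<lambda>p. theta (chart_at A p) p)"
  using continuous_on_subset[OF continuous_u \<Omega>_V] continuous_on_subset[OF continuous_on_rho subset_UNIV]
    continuous_on_subset[OF continuous_on_theta subset_UNIV] by blast+

lemma C1_vec_var_u: "C1_vec (V 0) (var_field (u 0))"
  by (rule C1_vec_var_field[OF u(1)[OF zero_I]])

text \<open>Both sides of \<open>integral_energy_quotient\<close> converge under the integral sign,
  and limits are unique. The normalisation makes the coefficient of the difference quotient of
  \<open>\<Lambda>\<close> tend to 1.\<close>

lemma eigenvalue_derivative:
  assumes norm: "(LINT p:\<Omega>|vol. (u 0 p)\<^sup>2) = 1" and L: "(\<Lambda> has_real_derivative L) (at 0)"
  shows "L = (LINT p:\<Omega>|vol. pairing (u 0) (var_field (u 0)) p)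
    - \<Lambda> 0 * (LINT p:\<Omega>|vol. theta (chart_at A p) p * u 0 p * u 0 p)"
proof -
  have evI: "\<forall>\<^sub>F t in at 0. t \<in> I" using open_I zero_I by (rule eventually_at_in_open')
  have ev0: "\<forall>\<^sub>F t in at (0::real). t \<noteq> 0" by (simp add: eventually_at_filter)
  have lb0: "loc_bounded \<Omega> p (\<lambda>t. u 0)" if "p \<in> closure \<Omega>" for p
    using u(2)[OF zero_I] that
    by (intro loc_bounded_continuous[OF C1_fun_open[OF C1_u[OF zero_I]] _ continuous_u[OF zero_I]]) auto
  have 1: "((\<lambda>t. LINT q:\<Omega>|vol. (energy t q - energy0 t q) / t)
      \<longlongrightarrow> (LINT q:\<Omega>|vol. pairing (u 0) (var_field (u 0)) q)) (at 0)"
  proof (rule set_integral_bounded_convergence[OF \<Omega> _ _ loc_bounded_energy_quotient tendsto_energy_quotient])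
    show "\<forall>\<^sub>F t in at 0. continuous_on \<Omega> (\<lambda>q. (energy t q - energy0 t q) / t)"
      using evI ev0
    proof eventually_elim
      case (elim t)
      have sub: "\<Omega> \<subseteq> common_nbhd t" using \<Omega>_common_nbhd[OF elim(1)] by blast
      show ?case
        unfolding energy_def energy0_def
        using continuous_on_subset[OF continuous_on_pairing[OF common_nbhd(3,5)[OF elim(1)]] sub]
          continuous_on_subset[OF continuous_on_pairing[OF common_nbhd(4,6)[OF elim(1)]] sub] elim(2)
        by (intro continuous_intros) auto
    qed
    show "continuous_on \<Omega> (pairing (u 0) (var_field (u 0)))"
      by (rule continuous_on_subset[OF continuous_on_pairing[OF C1_u[OF zero_I] C1_vec_var_u] \<Omega>_V[OF zero_I]])
  qed
  have 2: "((\<lambda>t. LINT q:\<Omega>|vol. rho t q * u 0 q * u t q) \<longlongrightarrow> (LINT q:\<Omega>|vol. 1 * u 0 q * u 0 q)) (at 0)"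
  proof (rule set_integral_bounded_convergence[OF \<Omega>])
    show "\<forall>\<^sub>F t in at 0. continuous_on \<Omega> (\<lambda>q. rho t q * u 0 q * u t q)"
      using evI by eventually_elim (intro continuous_intros continuous_on_\<Omega> zero_I)
    show "continuous_on \<Omega> (\<lambda>q. 1 * u 0 q * u 0 q)"
      by (intro continuous_intros continuous_on_\<Omega> zero_I)
    show "loc_bounded \<Omega> p (\<lambda>t q. rho t q * u 0 q * u t q)" if p: "p \<in> closure \<Omega>" for p
    proof -
      \<comment> \<open>Writing \<open>rho\<close> through its difference quotient reduces its bound
        to the one already known; the two expressions agree for \<open>t \<noteq> 0\<close>.\<close>
      have "loc_bounded \<Omega> p (\<lambda>t q. (t * ((rho t q - 1) / t) + 1) * u 0 q * u t q)"
      proof (intro loc_bounded_mult loc_bounded_add loc_bounded_const loc_bounded_rho_quotient lb0 loc_bounded_u p)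
        have "\<forall>\<^sub>F t in at (0::real). t \<in> {-1<..<1}" by (rule eventually_at_in_open') auto
        then have "\<forall>\<^sub>F t in at (0::real). \<forall>q\<in>UNIV \<inter> \<Omega>. \<bar>t\<bar> \<le> 1" by eventually_elim auto
        then show "loc_bounded \<Omega> p (\<lambda>t q. t)" by (rule loc_boundedI[OF open_UNIV UNIV_I])
      qed
      then show ?thesis
        by (rule loc_bounded_cong[OF _ open_UNIV UNIV_I]) (use ev0 in eventually_elim, simp)
    qed
    show "((\<lambda>t. rho t q * u 0 q * u t q) \<longlongrightarrow> 1 * u 0 q * u 0 q) (at 0)" if "q \<in> \<Omega>" for q
      by (intro tendsto_intros tendsto_rho tendsto_u that)
  qed
  have 3: "((\<lambda>t. LINT q:\<Omega>|vol. (rho t q - 1) / t * u 0 q * u t q)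
      \<longlongrightarrow> (LINT q:\<Omega>|vol. theta (chart_at A q) q * u 0 q * u 0 q)) (at 0)"
  proof (rule set_integral_bounded_convergence[OF \<Omega>])
    show "\<forall>\<^sub>F t in at 0. continuous_on \<Omega> (\<lambda>q. (rho t q - 1) / t * u 0 q * u t q)"
      using evI ev0 by eventually_elim (intro continuous_intros continuous_on_\<Omega> zero_I, auto)
    show "continuous_on \<Omega> (\<lambda>q. theta (chart_at A q) q * u 0 q * u 0 q)"
      by (intro continuous_intros continuous_on_\<Omega> zero_I)
    show "loc_bounded \<Omega> p (\<lambda>t q. (rho t q - 1) / t * u 0 q * u t q)" if "p \<in> closure \<Omega>" for p
      by (intro loc_bounded_mult loc_bounded_rho_quotient lb0 loc_bounded_u that)
    show "((\<lambda>t. (rho t q - 1) / t * u 0 q * u t q) \<longlongrightarrow> theta (chart_at A q) q * u 0 q * u 0 q) (at 0)"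
      if "q \<in> \<Omega>" for q
      by (intro tendsto_intros tendsto_rho_quotient tendsto_u that)
  qed
  have "(LINT q:\<Omega>|vol. 1 * u 0 q * u 0 q) = 1"
    using norm by (simp add: power2_eq_square)
  moreover have "((\<lambda>t. (\<Lambda> t - \<Lambda> 0) / t) \<longlongrightarrow> L) (at 0)" using L by (simp add: DERIV_def)
  ultimately have "((\<lambda>t. (\<Lambda> t - \<Lambda> 0) / t * (LINT p:\<Omega>|vol. rho t p * u 0 p * u t p)
      + \<Lambda> 0 * (LINT p:\<Omega>|vol. (rho t p - 1) / t * u 0 p * u t p))
    \<longlongrightarrow> L * 1 + \<Lambda> 0 * (LINT q:\<Omega>|vol. theta (chart_at A q) q * u 0 q * u 0 q)) (at 0)"
    using 2 3 by (intro tendsto_intros) auto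
  moreover have "\<forall>\<^sub>F t in at 0. (\<Lambda> t - \<Lambda> 0) / t * (LINT p:\<Omega>|vol. rho t p * u 0 p * u t p)
      + \<Lambda> 0 * (LINT p:\<Omega>|vol. (rho t p - 1) / t * u 0 p * u t p)
    = (LINT p:\<Omega>|vol. (energy t p - energy0 t p) / t)"
    using evI ev0 by eventually_elim (rule integral_energy_quotient[symmetric])
  ultimately have "((\<lambda>t. LINT p:\<Omega>|vol. (energy t p - energy0 t p) / t)
      \<longlongrightarrow> L * 1 + \<Lambda> 0 * (LINT q:\<Omega>|vol. theta (chart_at A q) q * u 0 q * u 0 q)) (at 0)"
    by (rule Lim_transform_eventually)
  from tendsto_unique[OF _ 1 this] show ?thesis by simp
qed

lemma laplacian_variation_\<phi>:
  assumes "p \<in> \<Omega>"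
  shows "laplacian_variation A G (\<phi> 0) p
    = - divergence A g (var_field (u 0)) p - theta (chart_at A p) p * (\<Lambda> 0 * u 0 p)"
proof -
  have "laplacian_variation A G (\<phi> 0) p = laplacian_variation A G (u 0) p"
    unfolding laplacian_variation_def
    using laplacian_cong[OF \<Omega>(1) assms, of "\<phi> 0" "u 0"] u_\<phi>[OF zero_I] by simp
  also have "\<dots> = - divergence A g (var_field (u 0)) p - theta (chart_at A p) p * laplacian A g (u 0) p"
    by (rule laplacian_variation_eq[OF C2_u_\<Omega>[OF zero_I] assms])
  also have "laplacian A g (u 0) p = \<Lambda> 0 * u 0 p" using eigen_u[OF zero_I assms] by (simp add: G_0)
  finally show ?thesis .
qed

lemma integrable_pairing_theta:
  "set_integrable vol \<Omega> (pairing (u 0) (var_field (u 0)))"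
  "set_integrable vol \<Omega> (\<lambda>p. \<Lambda> 0 * (theta (chart_at A p) p * u 0 p * u 0 p))"
proof -
  note o = C1_fun_open[OF C1_u[OF zero_I]]
  show "set_integrable vol \<Omega> (pairing (u 0) (var_field (u 0)))"
    by (rule set_integrable_domain[OF \<Omega> o continuous_on_pairing[OF C1_u[OF zero_I] C1_vec_var_u] u(2)[OF zero_I]])
  show "set_integrable vol \<Omega> (\<lambda>p. \<Lambda> 0 * (theta (chart_at A p) p * u 0 p * u 0 p))"
    by (rule set_integrable_domain[OF \<Omega> o _ u(2)[OF zero_I]])
      (intro continuous_intros continuous_u zero_I continuous_on_subset[OF continuous_on_theta subset_UNIV])
qed

text \<open>Since \<open>u 0\<close> vanishes on the frontier, integration by parts turns the term
  with the divergence of \<open>var_field\<close> into the pairing; the remaining term carries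
  \<open>\<Lambda> 0\<close> by the eigenvalue equation.\<close>

lemma integral_laplacian_variation:
  "(LINT p:\<Omega>|vol. \<phi> 0 p * laplacian_variation A G (\<phi> 0) p)
    = (LINT p:\<Omega>|vol. pairing (u 0) (var_field (u 0)) p)
      - \<Lambda> 0 * (LINT p:\<Omega>|vol. theta (chart_at A p) p * u 0 p * u 0 p)"
proof -
  let ?div = "divergence A g (var_field (u 0))"
  note o = C1_fun_open[OF C1_u[OF zero_I]]
  have i1: "set_integrable vol \<Omega> (\<lambda>p. u 0 p * ?div p)"
    by (rule set_integrable_domain[OF \<Omega> o _ u(2)[OF zero_I]])
      (intro continuous_intros continuous_u zero_I continuous_on_divergence C1_vec_var_u)
  have i1': "set_integrable vol \<Omega> (\<lambda>p. - (u 0 p * ?div p))"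
    using i1 unfolding set_integrable_def by simp
  have "(LINT p:\<Omega>|vol. \<phi> 0 p * laplacian_variation A G (\<phi> 0) p)
      = (LINT p:\<Omega>|vol. - (u 0 p * ?div p) - \<Lambda> 0 * (theta (chart_at A p) p * u 0 p * u 0 p))"
    using \<Omega>(1) by (intro set_lebesgue_integral_cong)
      (auto simp: laplacian_variation_\<phi> u_\<phi>[OF zero_I, symmetric] algebra_simps)
  also have "\<dots> = (LINT p:\<Omega>|vol. - (u 0 p * ?div p)) - (LINT p:\<Omega>|vol. \<Lambda> 0 * (theta (chart_at A p) p * u 0 p * u 0 p))"
    by (rule set_integral_diff(2)[OF i1' integrable_pairing_theta(2)])
  also have "(LINT p:\<Omega>|vol. - (u 0 p * ?div p)) = (LINT p:\<Omega>|vol. pairing (u 0) (var_field (u 0)) p)"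
    using integration_by_parts[OF \<Omega> u(2)[OF zero_I] C1_u[OF zero_I] C1_vec_var_u u_boundary[OF zero_I]]
    by (simp add: set_lebesgue_integral_def)
  finally show ?thesis by simp
qed

text \<open>A quarter of the Laplacian of \<open>\<phi>_0^2\<close> is half of
  \<open>\<phi>_0 \<Delta>\<phi>_0 - |d\<phi>_0|^2\<close>, while the trace of \<open>h\<close> is
  \<open>2 \<theta>\<close>; this accounts for the factor 1/4. The product of the differentials
  gives \<open>h(\<nabla>\<phi>_0, \<nabla>\<phi>_0)\<close>, the remaining part of
  \<open>d\<phi>_0(X)\<close>. The identity holds at each point, before integrating.\<close>

lemma tensor2_inner_variation:
  assumes p: "p \<in> \<Omega>"
  shows "tensor2_inner A g
      (\<lambda>c q. tensor_prod (differential (\<phi> 0)) (differential (\<phi> 0)) c q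
        + ((1/4) * laplacian A g (\<lambda>x. (\<phi> 0 x)\<^sup>2) q) *\<^sub>R g c q)
      (metric_variation G) p
    = \<Lambda> 0 * (theta (chart_at A p) p * u 0 p * u 0 p) - pairing (u 0) (var_field (u 0)) p"
proof -
  define c where "c = chart_at A p"
  have c: "c \<in> A" "p \<in> cdom c" unfolding c_def by (rule chart_at)+
  let ?N = "matrix_inv (g c p)" and ?d = "differential (u 0) c p" and ?H = "T c p"
  let ?D = "gradient g (u 0) c p" and ?K = "(1/4) * laplacian A g (\<lambda>x. (\<phi> 0 x)\<^sup>2) p"
  have d: "differential (\<phi> 0) c p = ?d" by (rule differential_u[OF zero_I c p])
  have sym: "transpose ?N = ?N" by (rule transpose_inverse_metric[OF c])
  have inv: "?N ** g c p = mat 1" using matrix_inv_inverse(2) det_pos[OF c] by (metis less_irrefl)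
  have D: "?D = ?N *v ?d" by (simp add: gradient_def)
  have "laplacian A g (\<lambda>x. (\<phi> 0 x)\<^sup>2) p = laplacian A g (\<lambda>x. (u 0 x)\<^sup>2) p"
    by (rule laplacian_cong[OF \<Omega>(1) p]) (simp add: u_\<phi>[OF zero_I])
  also have "\<dots> = 2 * u 0 p * (\<Lambda> 0 * u 0 p) - 2 * (?d \<bullet> ?D)"
    using laplacian_square[OF C2_u_\<Omega>[OF zero_I] p] eigen_u[OF zero_I p] by (simp add: G_0 c_def)
  finally have K: "?K = (u 0 p * (\<Lambda> 0 * u 0 p) - ?d \<bullet> ?D) / 2" by simp
  have "tensor2_inner A g
      (\<lambda>c q. tensor_prod (differential (\<phi> 0)) (differential (\<phi> 0)) c q
        + ((1/4) * laplacian A g (\<lambda>x. (\<phi> 0 x)\<^sup>2) q) *\<^sub>R g c q) (metric_variation G) p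
    = (\<Sum>i\<in>UNIV. \<Sum>j\<in>UNIV. \<Sum>k\<in>UNIV. \<Sum>l\<in>UNIV.
      ?N $ i $ k * ?N $ j $ l * (?d $ i * ?d $ j + ?K * g c p $ i $ j) * ?H $ k $ l)"
    unfolding tensor2_inner_def Let_def c_def[symmetric] metric_variation_eq[OF c] tensor_prod_def d by simp
  also have "\<dots> = ?D \<bullet> (?H *v ?D) + ?K * trace (?N ** ?H)"
    unfolding tensor2_inner_eq[OF sym inv] D ..
  also have "\<dots> = ?D \<bullet> (?H *v ?D) + (u 0 p * (\<Lambda> 0 * u 0 p) - ?d \<bullet> ?D) * theta c p"
    unfolding K theta_def by simp
  finally have 1: "tensor2_inner A g
      (\<lambda>c q. tensor_prod (differential (\<phi> 0)) (differential (\<phi> 0)) c q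
        + ((1/4) * laplacian A g (\<lambda>x. (\<phi> 0 x)\<^sup>2) q) *\<^sub>R g c q) (metric_variation G) p
    = ?D \<bullet> (?H *v ?D) + (u 0 p * (\<Lambda> 0 * u 0 p) - ?d \<bullet> ?D) * theta c p" .
  \<comment> \<open>The symmetric inverse metric moves across the inner product and turns the
    differential into the gradient.\<close>
  have "?d \<bullet> (?N *v (?H *v ?D)) = ?D \<bullet> (?H *v ?D)"
    using inner_transpose[of ?N ?d "?H *v ?D"] unfolding sym D by simp
  then have "pairing (u 0) (var_field (u 0)) p = theta c p * (?d \<bullet> ?D) - ?D \<bullet> (?H *v ?D)"
    unfolding pairing_def var_field_def c_def[symmetric] by (simp add: inner_diff_right)
  then show ?thesis unfolding 1 c_def[symmetric] by (simp add: algebra_simps)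
qed

lemma integral_tensor2_inner_variation:
  "- (LINT p:\<Omega>|vol. tensor2_inner A g
      (\<lambda>c q. tensor_prod (differential (\<phi> 0)) (differential (\<phi> 0)) c q
        + ((1/4) * laplacian A g (\<lambda>x. (\<phi> 0 x)\<^sup>2) q) *\<^sub>R g c q)
      (metric_variation G) p)
    = (LINT p:\<Omega>|vol. pairing (u 0) (var_field (u 0)) p)
      - \<Lambda> 0 * (LINT p:\<Omega>|vol. theta (chart_at A p) p * u 0 p * u 0 p)" (is "- ?E = _")
proof -
  have "?E = (LINT p:\<Omega>|vol. \<Lambda> 0 * (theta (chart_at A p) p * u 0 p * u 0 p) - pairing (u 0) (var_field (u 0)) p)"
    using \<Omega>(1) by (intro set_lebesgue_integral_cong allI impI tensor2_inner_variation) auto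
  also have "\<dots> = \<Lambda> 0 * (LINT p:\<Omega>|vol. theta (chart_at A p) p * u 0 p * u 0 p)
      - (LINT p:\<Omega>|vol. pairing (u 0) (var_field (u 0)) p)"
    using set_integral_diff(2)[OF integrable_pairing_theta(2,1)] by simp
  finally show ?thesis by simp
qed

end

theorem proposition2p1:
  fixes A :: "('a::{t2_space,second_countable_topology}, 'n::finite) chart set"
    and g :: "('a, 'n) tensor2"
    and G :: "real \<Rightarrow> ('a, 'n) tensor2"
    and \<Omega> :: "'a set"
    and I :: "real set"
    and \<phi> :: "real \<Rightarrow> 'a \<Rightarrow> real"
    and \<Lambda> :: "real \<Rightarrow> real"
  assumes "oriented_atlas A"
    and "riemannian_metric A g"
    and "bounded_regular_domain A \<Omega>"
    and "open I" and "is_interval I" and "0 \<in> I"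
    and "differentiable_metric_family A I G" and "G 0 = g"
    and "differentiable_function_family A \<Omega> I \<phi>"
    and "\<Lambda> differentiable_on I"
    and "\<And>\<epsilon>. \<epsilon> \<in> I \<Longrightarrow> L2_norm_on A (G \<epsilon>) \<Omega> (\<phi> \<epsilon>) = 1"
    and "\<And>\<epsilon> p. \<epsilon> \<in> I \<Longrightarrow> p \<in> \<Omega> \<Longrightarrow> laplacian A (G \<epsilon>) (\<phi> \<epsilon>) p = \<Lambda> \<epsilon> * \<phi> \<epsilon> p"
    and "\<And>\<epsilon> p. \<epsilon> \<in> I \<Longrightarrow> p \<in> frontier \<Omega> \<Longrightarrow> \<phi> \<epsilon> p = 0"
  shows "(\<Lambda> has_real_derivative
            (LINT p:\<Omega>|riemannian_volume A g. \<phi> 0 p * laplacian_variation A G (\<phi> 0) p)) (at 0)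
    \<and> (LINT p:\<Omega>|riemannian_volume A g. \<phi> 0 p * laplacian_variation A G (\<phi> 0) p) =
      - (LINT p:\<Omega>|riemannian_volume A g.
           tensor2_inner A g
             (\<lambda>c q. tensor_prod (differential (\<phi> 0)) (differential (\<phi> 0)) c q
                + ((1/4) * laplacian A g (\<lambda>x. (\<phi> 0 x)\<^sup>2) q) *\<^sub>R g c q)
             (metric_variation G) p)"
proof -
  interpret oriented_riemannian A g
    by (intro oriented_riemannian.intro oriented_manifold.intro oriented_riemannian_axioms.intro assms(1,2))
  have \<Omega>: "open \<Omega>" "compact (closure \<Omega>)"
    using assms(3) by (simp_all add: bounded_regular_domain_def)
  obtain T where T: "smooth_tensor2 A T" "\<And>c. c \<in> A \<Longrightarrow>
      Cinf_has_deriv (coord c ` cdom c) (coord c ` cdom c) (\<lambda>s. G s c \<circ> param c) (T c \<circ> param c) 0"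
    using assms(6,7) unfolding differentiable_metric_family_def by blast
  obtain \<psi> where \<psi>: "smooth_up_to_boundary A \<Omega> \<psi>" "\<And>c. c \<in> A \<Longrightarrow>
      Cinf_has_deriv (coord c ` cdom c) (coord c ` (cdom c \<inter> \<Omega>)) (\<lambda>s. \<phi> s \<circ> param c) (\<psi> \<circ> param c) 0"
    using assms(6,9) unfolding differentiable_function_family_def by blast
  obtain V' w where w: "closure \<Omega> \<subseteq> V'" "smooth_fun_on A V' w" "\<forall>p\<in>closure \<Omega>. w p = \<psi> p"
    using \<psi>(1) unfolding smooth_up_to_boundary_def by blast
  \<comment> \<open>The extension of \<open>\<phi> t\<close> and its domain are chosen for each
    \<open>t\<close> on its own; dependence on \<open>t\<close> is controlled through the values of
    \<open>\<phi>\<close> on the domain.\<close>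
  have "\<forall>t\<in>I. \<exists>V u. closure \<Omega> \<subseteq> V \<and> smooth_fun_on A V u \<and> (\<forall>p\<in>closure \<Omega>. u p = \<phi> t p)"
    using assms(9) unfolding differentiable_function_family_def smooth_up_to_boundary_def by blast
  then obtain V u where u: "\<forall>t\<in>I. closure \<Omega> \<subseteq> V t \<and> smooth_fun_on A (V t) (u t) \<and> (\<forall>p\<in>closure \<Omega>. u t p = \<phi> t p)"
    by metis
  interpret eigenvalue_family A g G I T \<Omega> \<phi> u V \<psi> w V' \<Lambda>
  proof
    show "riemannian_metric A (G t)" if "t \<in> I" for t
      using assms(7) that by (simp add: differentiable_metric_family_def)
    show "C2_fun (V t) (u t)" if "t \<in> I" for t using u that smooth_fun_imp_C2_fun by blast
    show "closure \<Omega> \<subseteq> V t" if "t \<in> I" for t using u that by blast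
    show "u t p = \<phi> t p" if "t \<in> I" "p \<in> closure \<Omega>" for t p using u that by blast
    show "C1_fun V' w" by (rule smooth_fun_imp_C1_fun[OF w(2)])
    show "w p = \<psi> p" if "p \<in> closure \<Omega>" for p using w(3) that by blast
  qed (fact assms \<Omega> T \<psi> w)+
  \<comment> \<open>As \<open>I\<close> is open, differentiability on \<open>I\<close> is
    differentiability at \<open>0\<close>; what remains is to identify the derivative
    \<open>L\<close>.\<close>
  have "\<Lambda> differentiable (at 0)"
    using assms(4,6,10) by (metis at_within_open differentiable_on_def)
  then obtain L where L: "(\<Lambda> has_real_derivative L) (at 0)"
    by (metis real_differentiable_def)
  have "sqrt (LINT p:\<Omega>|vol. (\<phi> 0 p)\<^sup>2) = 1"
    using assms(11)[OF assms(6)] by (simp add: L2_norm_on_def G_0)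
  moreover have "(LINT p:\<Omega>|vol. (u 0 p)\<^sup>2) = (LINT p:\<Omega>|vol. (\<phi> 0 p)\<^sup>2)"
    using \<Omega>(1) by (intro set_lebesgue_integral_cong) (auto simp: u_\<phi>[OF zero_I])
  ultimately have "(LINT p:\<Omega>|vol. (u 0 p)\<^sup>2) = 1" by simp
  from eigenvalue_derivative[OF this L] L show ?thesis
    unfolding integral_laplacian_variation integral_tensor2_inner_variation by simp
qed

end
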